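(* Let $W$ be a weak $V$-module and $z$ a nonzero complex number. Then $(\mathcal D_{P(z)}(W),Y^R_{P(z)})$ is a weak $V$-module; that is, $Y^R_{P(z)}(v,x)\alpha\in\mathcal D_{P(z)}(W)((x))$ for $v\in V,\alpha\in\mathcal D_{P(z)}(W)$, $Y^R_{P(z)}(\mathbf 1,x)=\mathrm{id}$, and the Jacobi identity $x_0^{-1}\delta(\frac{x_1-x_2}{x_0})Y^R_{P(z)}(u,x_1)Y^R_{P(z)}(v,x_2)-x_0^{-1}\delta(\frac{x_2-x_1}{-x_0})Y^R_{P(z)}(v,x_2)Y^R_{P(z)}(u,x_1)=x_2^{-1}\delta(\frac{x_1-x_0}{x_2})Y^R_{P(z)}(Y(u,x_0)v,x_2)$ holds on $\mathcal D_{P(z)}(W)$ for all $u,v\in V$.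
   Context: $V$ is a vertex operator algebra with vacuum $\mathbf 1$, Virasoro element $\omega$, $Y(\omega,x)=\sum_{n}L(n)x^{-n-2}$, and $V=\coprod_{n\in\mathbb Z}V_{(n)}$ graded by $L(0)$-eigenvalues. The formal delta function is $\delta(x)=\sum_{n\in\mathbb Z}x^n$; binomial expressions $(x_1-x_2)^n$ are expanded in nonnegative powers of the second variable. A weak $V$-module is a vector space $W$ with a linear map $Y_W:V\to(\mathrm{End}\,W)[[x,x^{-1}]]$ such that $Y_W(v,x)w\in W((x))$, $Y_W(\mathbf 1,x)=\mathrm{id}_W$, and the Jacobi identity $x_0^{-1}\delta(\frac{x_1-x_2}{x_0})Y_W(u,x_1)Y_W(v,x_2)-x_0^{-1}\delta(\frac{x_2-x_1}{-x_0})Y_W(v,x_2)Y_W(u,x_1)=x_2^{-1}\delta(\frac{x_1-x_0}{x_2})Y_W(Y(u,x_0)v,x_2)$ holds. For $v\in V$ set $Y^o(v,x)=Y_W(e^{xL(1)}(-x^{-2})^{L(0)}v,x^{-1})$; then $Y^o(v,x)w\in W((x^{-1}))$. For a nonzero complex number $z$, $\alpha\in W^*$ is a $P(z)$-linear functional if for all $v\in V,w\in W$ the series $\langle\alpha,Y^o(v,x)w\rangle$ converges absolutely in $|x|>|z|$ to a rational function in $\mathbb C[x,x^{-1},(x-z)^{-1}]$, and for each fixed $v$ the orders of the poles at $0$ and at $z$ of these rational functions are bounded independently of $w$. $\mathcal D_{P(z)}(W)$ is the space of $P(z)$-linear functionals on $W$. Let $\iota_{x;\infty}$ and $\iota_{x;0}$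 be the injective maps from the field $\mathbb C(x)$ of rational functions to Laurent series sending a rational function to its Laurent expansion at $x=\infty$ (in $\mathbb C((x^{-1}))$) and at $x=0$ (in $\mathbb C((x))$), respectively. For $v\in V$, $\alpha\in\mathcal D_{P(z)}(W)$, define $Y^R_{P(z)}(v,x)\alpha\in W^*[[x,x^{-1}]]$ by $\langle Y^R_{P(z)}(v,x)\alpha,w\rangle=\iota_{x;0}\iota_{x;\infty}^{-1}\langle\alpha,Y^o(v,x)w\rangle$ for $w\in W$. *)

theory Defs
  imports "HOL-Analysis.Analysis" "HOL-Library.Function_Algebras"
begin

text \<open>Conventions.
  A vertex operator u acting on a space is encoded by its modes:
  Y u n m = u_n m, where Y(u,x) = sum_n u_n x^(-n-1).
  V is a complex vector space with scalar multiplication sc; a module M is a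
  subset of a complex vector space with scalar multiplication sm.
  Sums written fsum f are sums over the (finite) support of f.\<close>

definition fsum :: "('i \<Rightarrow> 'a::comm_monoid_add) \<Rightarrow> 'a" where
  "fsum f = sum f {i. f i \<noteq> 0}"

text \<open>The Jacobi identity, written coefficientwise: equality of the coefficients of
  x0^(-l-1) x1^(-p-1) x2^(-q-1) of both sides, with the delta functions expanded
  as in the formal calculus (binomials expanded in nonnegative powers of the
  second variable).\<close>

definition jacobi_identity ::
  "('v \<Rightarrow> int \<Rightarrow> 'v \<Rightarrow> 'v) \<Rightarrow> (complex \<Rightarrow> 'm::ab_group_add \<Rightarrow> 'm)
   \<Rightarrow> ('v \<Rightarrow> int \<Rightarrow> 'm \<Rightarrow> 'm) \<Rightarrow> 'm set \<Rightarrow> bool" where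
  "jacobi_identity Y sm YM M \<longleftrightarrow>
    (\<forall>u v. \<forall>m\<in>M. \<forall>l p q :: int.
       fsum (\<lambda>i::nat. sm ((-1) ^ i * (of_int l gchoose i))
                         (YM u (l + p - int i) (YM v (q + int i) m)))
     - fsum (\<lambda>i::nat. sm ((-1) powi (l + int i) * (of_int l gchoose i))
                         (YM v (l + q - int i) (YM u (p + int i) m)))
     = fsum (\<lambda>i::nat. sm ((-1) ^ i * (of_int (int i - p - 1) gchoose i))
                         (YM (Y u (l + int i) v) (p + q - int i) m)))"

definition weak_module ::
  "(complex \<Rightarrow> 'v::ab_group_add \<Rightarrow> 'v) \<Rightarrow> ('v \<Rightarrow> int \<Rightarrow> 'v \<Rightarrow> 'v) \<Rightarrow> 'v
   \<Rightarrow> 'm set \<Rightarrow> (complex \<Rightarrow> 'm::ab_group_add \<Rightarrow> 'm) \<Rightarrow> ('v \<Rightarrow> int \<Rightarrow> 'm \<Rightarrow> 'm) \<Rightarrow> bool" where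
  "weak_module sc Y vac M sm YM \<longleftrightarrow>
     module sm \<and> module.subspace sm M \<and>
     (\<forall>v n. \<forall>m\<in>M. YM v n m \<in> M) \<and>
     (\<forall>a b u u' n. \<forall>m\<in>M. YM (sc a u + sc b u') n m = sm a (YM u n m) + sm b (YM u' n m)) \<and>
     (\<forall>a b v n. \<forall>m\<in>M. \<forall>m'\<in>M. YM v n (sm a m + sm b m') = sm a (YM v n m) + sm b (YM v n m')) \<and>
     (\<forall>v. \<forall>m\<in>M. \<exists>N. \<forall>n\<ge>N. YM v n m = 0) \<and>
     (\<forall>n. \<forall>m\<in>M. YM vac n m = (if n = -1 then m else 0)) \<and>
     jacobi_identity Y sm YM M"

definition Lop :: "('v \<Rightarrow> int \<Rightarrow> 'v \<Rightarrow> 'v) \<Rightarrow> 'v \<Rightarrow> int \<Rightarrow> 'v \<Rightarrow> 'v" where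
  "Lop Y om n = Y om (n + 1)"

definition Vhom :: "(complex \<Rightarrow> 'v \<Rightarrow> 'v) \<Rightarrow> ('v \<Rightarrow> int \<Rightarrow> 'v \<Rightarrow> 'v) \<Rightarrow> 'v \<Rightarrow> int \<Rightarrow> 'v set" where
  "Vhom sc Y om n = {v. Lop Y om 0 v = sc (of_int n) v}"

definition is_VOA ::
  "(complex \<Rightarrow> 'v::ab_group_add \<Rightarrow> 'v) \<Rightarrow> ('v \<Rightarrow> int \<Rightarrow> 'v \<Rightarrow> 'v) \<Rightarrow> 'v \<Rightarrow> 'v \<Rightarrow> bool" where
  "is_VOA sc Y vac om \<longleftrightarrow>
     vector_space sc \<and>
     weak_module sc Y vac UNIV sc Y \<and>
     (\<forall>v. (\<forall>n\<ge>0. Y v n vac = 0) \<and> Y v (-1) vac = v) \<and>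
     (\<exists>c::complex. \<forall>m n v.
        Lop Y om m (Lop Y om n v) - Lop Y om n (Lop Y om m v)
        = sc (of_int (m - n)) (Lop Y om (m + n) v)
          + (if m + n = 0 then sc ((of_int m ^ 3 - of_int m) / 12 * c) v else 0)) \<and>
     (\<forall>v. \<exists>f. finite {n. f n \<noteq> 0} \<and> (\<forall>n. f n \<in> Vhom sc Y om n) \<and> v = sum f {n. f n \<noteq> 0}) \<and>
     (\<forall>n. \<exists>B. finite B \<and> Vhom sc Y om n \<subseteq> module.span sc B) \<and>
     (\<exists>N. \<forall>n<N. Vhom sc Y om n = {0}) \<and>
     (\<forall>v n w. Y (Lop Y om (-1) v) n w = sc (- of_int n) (Y v (n - 1) w))"

definition proj :: "(complex \<Rightarrow> 'v::ab_group_add \<Rightarrow> 'v) \<Rightarrow> ('v \<Rightarrow> int \<Rightarrow> 'v \<Rightarrow> 'v) \<Rightarrow> 'v \<Rightarrow> int \<Rightarrow> 'v \<Rightarrow> 'v" where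
  "proj sc Y om n v = (THE x. \<exists>f. finite {k. f k \<noteq> 0} \<and> (\<forall>k. f k \<in> Vhom sc Y om k)
                           \<and> v = sum f {k. f k \<noteq> 0} \<and> x = f n)"

text \<open>Coefficient of x^j in Y^o(v,x)w = Y_W(e^(x L(1)) (-x^(-2))^(L(0)) v, x^(-1)) w.
  For v_n of weight n: sum_k (-1)^n / k! * Y_W(L(1)^k v_n, x^(-1)) x^(k-2n),
  and Y_W(u,x^(-1)) = sum_m u_m x^(m+1).\<close>

definition Yo_coeff ::
  "(complex \<Rightarrow> 'v::ab_group_add \<Rightarrow> 'v) \<Rightarrow> ('v \<Rightarrow> int \<Rightarrow> 'v \<Rightarrow> 'v) \<Rightarrow> 'v
   \<Rightarrow> (complex \<Rightarrow> 'w::ab_group_add \<Rightarrow> 'w) \<Rightarrow> ('v \<Rightarrow> int \<Rightarrow> 'w \<Rightarrow> 'w)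
   \<Rightarrow> 'v \<Rightarrow> int \<Rightarrow> 'w \<Rightarrow> 'w" where
  "Yo_coeff sc Y om sw YW v j w =
     fsum (\<lambda>n. fsum (\<lambda>k::nat.
        sw ((-1) powi n / fact k)
           (YW ((Lop Y om 1 ^^ k) (proj sc Y om n v)) (j + 2 * n - int k - 1) w)))"

definition DPz ::
  "(complex \<Rightarrow> 'v::ab_group_add \<Rightarrow> 'v) \<Rightarrow> ('v \<Rightarrow> int \<Rightarrow> 'v \<Rightarrow> 'v) \<Rightarrow> 'v
   \<Rightarrow> (complex \<Rightarrow> 'w::ab_group_add \<Rightarrow> 'w) \<Rightarrow> ('v \<Rightarrow> int \<Rightarrow> 'w \<Rightarrow> 'w) \<Rightarrow> complex
   \<Rightarrow> ('w \<Rightarrow> complex) set" where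
  "DPz sc Y om sw YW z = {\<alpha>. Vector_Spaces.linear sw (*) \<alpha> \<and>
     (\<forall>v. \<exists>A B :: nat. \<forall>w. \<exists>p :: complex poly. \<forall>x. norm x > norm z \<longrightarrow>
        (\<lambda>j. norm (\<alpha> (Yo_coeff sc Y om sw YW v j w) * x powi j)) summable_on UNIV \<and>
        ((\<lambda>j. \<alpha> (Yo_coeff sc Y om sw YW v j w) * x powi j)
            has_sum (poly p x / (x ^ A * (x - z) ^ B))) UNIV)}"

definition rational_fun :: "(complex \<Rightarrow> complex) \<Rightarrow> bool" where
  "rational_fun f \<longleftrightarrow> (\<exists>p q :: complex poly. q \<noteq> 0 \<and> (\<forall>x. f x = poly p x / poly q x))"

definition laurent_at_zero :: "(complex \<Rightarrow> complex) \<Rightarrow> (int \<Rightarrow> complex) \<Rightarrow> bool" where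
  "laurent_at_zero f d \<longleftrightarrow> (\<exists>N. \<forall>j<N. d j = 0) \<and>
     (\<exists>r>0. \<forall>x. 0 < norm x \<and> norm x < r \<longrightarrow> ((\<lambda>j. d j * x powi j) has_sum f x) UNIV)"

definition laurent_at_infty :: "(complex \<Rightarrow> complex) \<Rightarrow> (int \<Rightarrow> complex) \<Rightarrow> bool" where
  "laurent_at_infty f c \<longleftrightarrow> (\<exists>N. \<forall>j>N. c j = 0) \<and>
     (\<exists>R. \<forall>x. norm x > R \<longrightarrow> ((\<lambda>j. c j * x powi j) has_sum f x) UNIV)"

definition iota0_iotainf_inv :: "(int \<Rightarrow> complex) \<Rightarrow> (int \<Rightarrow> complex)" where
  "iota0_iotainf_inv c = (THE d. \<exists>f. rational_fun f \<and> laurent_at_infty f c \<and> laurent_at_zero f d)"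

definition YR ::
  "(complex \<Rightarrow> 'v::ab_group_add \<Rightarrow> 'v) \<Rightarrow> ('v \<Rightarrow> int \<Rightarrow> 'v \<Rightarrow> 'v) \<Rightarrow> 'v
   \<Rightarrow> (complex \<Rightarrow> 'w::ab_group_add \<Rightarrow> 'w) \<Rightarrow> ('v \<Rightarrow> int \<Rightarrow> 'w \<Rightarrow> 'w) \<Rightarrow> complex
   \<Rightarrow> 'v \<Rightarrow> int \<Rightarrow> ('w \<Rightarrow> complex) \<Rightarrow> ('w \<Rightarrow> complex)" where
  "YR sc Y om sw YW z v n \<alpha> =
     (\<lambda>w. iota0_iotainf_inv (\<lambda>j. \<alpha> (Yo_coeff sc Y om sw YW v j w)) (- n - 1))"

definition dual_scale :: "complex \<Rightarrow> ('w \<Rightarrow> complex) \<Rightarrow> ('w \<Rightarrow> complex)" where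
  "dual_scale a \<alpha> = (\<lambda>w. a * \<alpha> w)"

end

theory Submission
  imports Defs
begin

text \<open>
  The opposite vertex operators \<open>Y\<^sup>o\<close> satisfy the Jacobi identity with the two products interchanged;
  in terms of modes this comes from the expansion of \<open>L(1)\<^sup>k (u\<^sub>n v)\<close> and a Vandermonde convolution.
  Convergence to a rational function with poles at most at \<open>0\<close> and \<open>z\<close> means that
  \<open>(x - z)\<^sup>B \<langle>\<alpha>, Y\<^sup>o(v,x)w\<rangle>\<close> is a Laurent polynomial, and \<open>\<langle>Y\<^sup>R(v,x)\<alpha>, w\<rangle>\<close> is the unique series bounded below
  whose product with \<open>(x - z)\<^sup>B\<close> is the same. So the matrix coefficients of products of \<open>Y\<^sup>o\<close> and of \<open>Y\<^sup>R\<close>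
  agree after multiplication by \<open>(x\<^sub>1 - z)\<^sup>B (x\<^sub>2 - z)\<^sup>B\<close>, and the Jacobi identity for \<open>Y\<^sup>R\<close> holds after this
  multiplication. All terms on the \<open>Y\<^sup>R\<close> side have total degree in \<open>x\<^sub>1, x\<^sub>2\<close> bounded below (by weak
  commutativity), and on such series multiplication by \<open>x\<^sub>i - z\<close> is injective, so the factor cancels.
  The same degree bound gives the uniform pole orders needed for the coefficients of \<open>Y\<^sup>R(v,x)\<alpha>\<close> to be \<open>P(z)\<close>-linear again.
\<close>

section \<open>Laurent series and rational functions\<close>

text \<open>Convergence matters only in \<open>rational_expansion_iff\<close>, which turns
  P(z)-linearity into a vanishing condition on coefficients, and in \<open>iota_eqI\<close>, which
  determines \<open>iota0_iotainf_inv\<close> without mentioning a rational function; what is built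
  on these two is algebra with coefficient sequences. The obstacle is that \<open>x - z\<close> is a
  zero divisor on doubly infinite series: it annihilates the series with coefficient
  \<open>z powi (- j)\<close> at \<open>x powi j\<close>. In a product of two operators Y^R the
  lower bound on one exponent may depend on the other exponent, which is why the total degree is
  controlled instead. The uniformity in \<open>w\<close> built into P(z)-linearity is what makes the
  comparison of double products work: \<open>w\<close> is replaced by all coefficients of
  \<open>Y^o(u,x1)w\<close> at once, and a single power of \<open>x2 - z\<close> has to serve them
  all.\<close>

lemma fsum_eq_sum:
  assumes "finite A" "\<And>i. i \<notin> A \<Longrightarrow> f i = 0"
  shows "fsum f = sum f A"
  unfolding fsum_def using assms by (intro sum.mono_neutral_left) auto

lemma fsum_nat_eq_sum:
  fixes f :: "nat \<Rightarrow> 'a::comm_monoid_add"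
  assumes "\<And>i. i \<ge> N \<Longrightarrow> f i = 0"
  shows "fsum f = sum f {..<N}"
  by (rule fsum_eq_sum) (use assms in auto)

lemma fsum_zero [simp]: "fsum (\<lambda>i. 0) = 0"
  by (simp add: fsum_def)

text \<open>\<open>zmult z c\<close> lists the coefficients of \<open>(x - z) (\<Sum>\<^sub>j c\<^sub>j x\<^sup>j)\<close>.\<close>

definition zmult :: "complex \<Rightarrow> (int \<Rightarrow> complex) \<Rightarrow> int \<Rightarrow> complex" where
  "zmult z c = (\<lambda>j. c (j - 1) - z * c j)"

text \<open>\<open>k r\<close> is the coefficient of \<open>x^r\<close> in \<open>(x - z)^B\<close>.
  Later arguments need only that it depends on neither \<open>c\<close> nor \<open>j\<close>, so it
  stays implicit.\<close>

lemma zmult_pow_expand: "\<exists>k::nat \<Rightarrow> complex. \<forall>c j. (zmult z ^^ B) c j = (\<Sum>r\<le>B. k r * c (j - int r))"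
proof (induction B)
  case 0
  show ?case by (rule exI[of _ "\<lambda>_. 1"]) simp
next
  case (Suc B)
  then obtain k where k: "\<And>c j. (zmult z ^^ B) c j = (\<Sum>r\<le>B. k r * c (j - int r))" by blast
  \<comment> \<open>The product of the polynomial with coefficients \<open>k\<close> by
    \<open>x - z\<close>. The conditionals supply the zeros outside \<open>0..B\<close>, where
    \<open>r - 1\<close> truncates and \<open>k\<close> is arbitrary.\<close>
  define k' where "k' r = (if r = 0 then 0 else k (r - 1)) - z * (if r \<le> B then k r else 0)" for r
  have "(zmult z ^^ Suc B) c j = (\<Sum>r\<le>Suc B. k' r * c (j - int r))" for c j
  proof -
    have "(\<Sum>r\<le>Suc B. k' r * c (j - int r)) =
       (\<Sum>r\<le>Suc B. (if r = 0 then 0 else k (r - 1)) * c (j - int r))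
       - z * (\<Sum>r\<le>Suc B. (if r \<le> B then k r else 0) * c (j - int r))"
      unfolding k'_def by (simp only: left_diff_distrib sum_subtractf sum_distrib_left mult.assoc)
    also have "(\<Sum>r\<le>Suc B. (if r = 0 then 0 else k (r - 1)) * c (j - int r))
        = (\<Sum>r\<le>B. k r * c (j - 1 - int r))"
      by (subst sum.atMost_Suc_shift) (simp add: algebra_simps)
    also have "(\<Sum>r\<le>Suc B. (if r \<le> B then k r else 0) * c (j - int r)) = (\<Sum>r\<le>B. k r * c (j - int r))"
      by simp
    finally show ?thesis by (simp add: k zmult_def)
  qed
  thus ?case by blast
qed

lemma zmult_pow_lincomb:
  "(zmult z ^^ B) (\<lambda>j. a * c j + b * d j) = (\<lambda>j. a * (zmult z ^^ B) c j + b * (zmult z ^^ B) d j)"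
proof -
  obtain k where k: "\<And>c j. (zmult z ^^ B) c j = (\<Sum>r\<le>B. k r * c (j - int r))"
    using zmult_pow_expand by blast
  show ?thesis
    by (rule ext) (simp add: k sum_distrib_left sum.distrib[symmetric] algebra_simps)
qed

lemma zmult_pow_diff:
  "(zmult z ^^ B) (\<lambda>j. c j - d j) = (\<lambda>j. (zmult z ^^ B) c j - (zmult z ^^ B) d j)"
  using zmult_pow_lincomb[of B z 1 c "-1" d] by simp

lemma zmult_pow_cmult: "(zmult z ^^ B) (\<lambda>j. a * c j) = (\<lambda>j. a * (zmult z ^^ B) c j)"
  using zmult_pow_lincomb[of B z a c 0 c] by simp

lemma zmult_pow_zero [simp]: "(zmult z ^^ B) (\<lambda>j. 0) = (\<lambda>j. 0)"
  using zmult_pow_cmult[of B z 0 "\<lambda>_. 0"] by simp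

lemma zmult_pow_low:
  assumes "\<And>j. j < s \<Longrightarrow> c j = 0" "j < s"
  shows "(zmult z ^^ B) c j = 0"
proof -
  obtain k where k: "\<And>c j. (zmult z ^^ B) c j = (\<Sum>r\<le>B. k r * c (j - int r))"
    using zmult_pow_expand by blast
  show ?thesis unfolding k using assms by (intro sum.neutral) auto
qed

lemma zmult_pow_high:
  assumes "\<And>j. j > N \<Longrightarrow> c j = 0" "j > N + int B"
  shows "(zmult z ^^ B) c j = 0"
proof -
  obtain k where k: "\<And>c j. (zmult z ^^ B) c j = (\<Sum>r\<le>B. k r * c (j - int r))"
    using zmult_pow_expand by blast
  show ?thesis unfolding k using assms by (intro sum.neutral) auto
qed

lemma zmult_pow_add: "(zmult z ^^ (A + B)) c = (zmult z ^^ A) ((zmult z ^^ B) c)"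
  by (simp add: funpow_add)

lemma zmult_pow_low_mono:
  assumes "\<And>j. j < s \<Longrightarrow> (zmult z ^^ B) c j = 0" "B \<le> B'" "j < s"
  shows "(zmult z ^^ B') c j = 0"
proof -
  have "B' = (B' - B) + B" using assms by simp
  hence "(zmult z ^^ B') c = (zmult z ^^ (B' - B)) ((zmult z ^^ B) c)" by (metis zmult_pow_add)
  with zmult_pow_low[of s "(zmult z ^^ B) c"] assms show ?thesis by simp
qed

lemma zmult_pow_eq_mono:
  assumes "(zmult z ^^ B) c = (zmult z ^^ B) d" "B \<le> B'"
  shows "(zmult z ^^ B') c = (zmult z ^^ B') d"
proof -
  have "B' = (B' - B) + B" using assms by simp
  thus ?thesis using assms by (metis zmult_pow_add)
qed

text \<open>Reading \<open>c (j - 1) - z * c j = 0\<close> upwards from an index where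
  \<open>c\<close> vanishes gives \<open>c j = 0\<close>. Any lower bound \<open>s'\<close>, however
  weak, provides the starting point.\<close>

lemma zmult_cancel_low:
  assumes z: "z \<noteq> 0" and low: "\<And>j. j < s' \<Longrightarrow> c j = 0"
    and 0: "\<And>j. j < s \<Longrightarrow> zmult z c j = 0" and "j < s"
  shows "c j = 0"
proof (cases "j < s'")
  case False
  have "i < s \<Longrightarrow> c i = 0" if "i \<ge> s' - 1" for i
    using that
  proof (induction i rule: int_ge_induct)
    case (step i)
    thus ?case using 0[of "i + 1"] z by (simp add: zmult_def)
  qed (use low in auto)
  thus ?thesis using False assms(4) by simp
qed (use low in auto)

lemma zmult_pow_cancel_low:
  assumes "z \<noteq> 0" "\<And>j. j < s' \<Longrightarrow> c j = 0"
    and "\<And>j. j < s \<Longrightarrow> (zmult z ^^ B) c j = 0" "j < s"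
  shows "c j = 0"
  using assms(3,4)
proof (induction B arbitrary: j)
  case 0
  thus ?case by simp
next
  case (Suc B)
  have "(zmult z ^^ B) c j = 0" if "j < s" for j
    by (rule zmult_cancel_low[OF assms(1), of s' "(zmult z ^^ B) c" s])
      (use zmult_pow_low[of s' c _ B z] assms(2) Suc.prems that in auto)
  thus ?case using Suc by blast
qed

text \<open>Formal division by \<open>x - z\<close> in nonnegative powers of \<open>x\<close>; the
  constant term \<open>- z\<close> is invertible.\<close>

lemma zmult_surj_low:
  assumes z: "z \<noteq> 0" and e: "\<And>j. j < s \<Longrightarrow> e j = 0"
  shows "\<exists>d. zmult z d = e \<and> (\<forall>j<s. d j = 0)"
proof -
  \<comment> \<open>\<open>D n\<close> is the coefficient at \<open>s + int n\<close>, from solving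
    \<open>d (j - 1) - z * d j = e j\<close> for \<open>d j\<close> with
    \<open>d (s - 1) = 0\<close>.\<close>
  define D where "D = rec_nat (- e s / z) (\<lambda>n r. (r - e (s + int n + 1)) / z)"
  define d where "d j = (if j < s then 0 else D (nat (j - s)))" for j
  have "zmult z d = e"
  proof
    fix j
    consider "j < s" | "j = s" | n where "j = s + int n + 1"
      by (metis add.commute add.left_commute linorder_less_linear of_nat_Suc zless_iff_Suc_zadd)
    thus "zmult z d j = e j"
    proof cases
      case 3
      have "nat (j - s) = Suc n" "nat (j - 1 - s) = n" using 3 by auto
      thus ?thesis using z 3 by (simp add: zmult_def d_def D_def)
    qed (use e z in \<open>auto simp: zmult_def d_def D_def\<close>)
  qed
  thus ?thesis by (auto simp: d_def)
qed

lemma zmult_pow_surj_low: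
  assumes "z \<noteq> 0" "\<And>j. j < s \<Longrightarrow> e j = 0"
  shows "\<exists>d. (zmult z ^^ B) d = e \<and> (\<forall>j<s. d j = 0)"
  using assms(2)
proof (induction B arbitrary: e)
  case (Suc B)
  then obtain d where "zmult z d = e" "\<forall>j<s. d j = 0" using zmult_surj_low[OF assms(1), of s e] by blast
  with Suc.IH[of d] show ?case by auto
qed auto

section \<open>Convergent series indexed by the integers\<close>

lemma has_sum_int_shift:
  fixes f :: "int \<Rightarrow> 'a::{comm_monoid_add, topological_space}"
  shows "((\<lambda>j. f (j - 1)) has_sum S) UNIV \<longleftrightarrow> (f has_sum S) UNIV"
  by (rule has_sum_reindex_bij_witness[of _ "\<lambda>j. j + 1" "\<lambda>j. j - 1"]) auto

lemma has_sum_int_uminus: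
  fixes f :: "int \<Rightarrow> 'a::{comm_monoid_add, topological_space}"
  shows "((\<lambda>j. f (- j)) has_sum S) UNIV \<longleftrightarrow> (f has_sum S) UNIV"
  by (rule has_sum_reindex_bij_witness[of _ uminus uminus]) auto

lemma has_sum_minus:
  fixes f g :: "'i \<Rightarrow> 'a::topological_ab_group_add"
  assumes "(f has_sum a) A" "(g has_sum b) A"
  shows "((\<lambda>i. f i - g i) has_sum (a - b)) A"
  using has_sum_add[OF assms(1), of "\<lambda>i. - g i" "- b"] assms(2) by (simp add: has_sum_uminus)

lemma has_sum_finite_supportI:
  assumes "finite A" "\<And>i. i \<notin> A \<Longrightarrow> f i = 0"
  shows "(f has_sum sum f A) UNIV"
  by (subst has_sum_cong_neutral[of A UNIV f f]) (use assms in auto)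

lemma zmult_has_sum:
  assumes "x \<noteq> 0" "((\<lambda>j. c j * x powi j) has_sum S) UNIV"
  shows "((\<lambda>j. zmult z c j * x powi j) has_sum (x - z) * S) UNIV"
proof -
  have "((\<lambda>j. c (j - 1) * x powi (j - 1)) has_sum S) UNIV"
    using has_sum_int_shift[of "\<lambda>j. c j * x powi j" S] assms by simp
  hence "((\<lambda>j. x * (c (j - 1) * x powi (j - 1)) - z * (c j * x powi j)) has_sum (x * S - z * S)) UNIV"
    by (intro has_sum_minus has_sum_cmult_right assms)
  also have "(\<lambda>j. x * (c (j - 1) * x powi (j - 1)) - z * (c j * x powi j)) = (\<lambda>j. zmult z c j * x powi j)"
    using assms by (auto simp: zmult_def power_int_diff field_simps)
  finally show ?thesis by (simp add: algebra_simps)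
qed

lemma zmult_pow_has_sum:
  assumes "x \<noteq> 0" "((\<lambda>j. c j * x powi j) has_sum S) UNIV"
  shows "((\<lambda>j. (zmult z ^^ B) c j * x powi j) has_sum (x - z) ^ B * S) UNIV"
proof (induction B)
  case (Suc B)
  show ?case using zmult_has_sum[OF assms(1) Suc] by (simp add: mult.assoc)
qed (use assms in simp)

text \<open>Divided by \<open>x powi m\<close>, the series is a power series whose constant term is
  its limit at 0. So the lowest coefficient that may be nonzero vanishes, and induction moves upward
  from \<open>N\<close>.\<close>

lemma laurent_low_zero:
  assumes low: "\<And>j. j < N \<Longrightarrow> d j = 0" and r: "r > 0"
    and sum: "\<And>x. 0 < norm x \<Longrightarrow> norm x < r \<Longrightarrow> ((\<lambda>j. d j * x powi j) has_sum 0) UNIV"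
  shows "d = (\<lambda>j. 0 :: complex)"
proof -
  have step: "d m = 0" if lowm: "\<And>j. j < m \<Longrightarrow> d j = 0" for m
  proof -
    have "(\<lambda>n. d (m + int n) * x ^ n) sums 0" if x: "x \<noteq> 0" "norm x < r" for x
    proof -
      have "((\<lambda>j. d j * x powi j) has_sum 0) (range (\<lambda>n. m + int n))"
      proof (subst has_sum_cong_neutral)
        show "((\<lambda>j. d j * x powi j) has_sum 0) UNIV" using sum x by simp
        fix j assume "j \<in> UNIV - range (\<lambda>n. m + int n)"
        hence "j < m" by (metis DiffE linorder_not_less rangeI zle_iff_zadd)
        thus "d j * x powi j = 0" using lowm by simp
      qed auto
      hence "((\<lambda>n. d (m + int n) * x powi (m + int n)) has_sum 0) UNIV"
        by (subst (asm) has_sum_reindex) (auto simp: inj_on_def o_def)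
      hence "((\<lambda>n. x powi (- m) * (d (m + int n) * x powi (m + int n))) has_sum x powi (- m) * 0) UNIV"
        by (rule has_sum_cmult_right)
      also have "(\<lambda>n. x powi (- m) * (d (m + int n) * x powi (m + int n))) = (\<lambda>n. d (m + int n) * x ^ n)"
        using x by (auto simp: power_int_add power_int_minus field_simps)
      finally show ?thesis by (intro has_sum_imp_sums) simp
    qed
    hence "((\<lambda>x. 0) \<longlongrightarrow> d (m + int 0)) (at (0::complex))"
      by (intro powser_limit_0_strong[OF r, of "\<lambda>n. d (m + int n)"]) auto
    thus ?thesis by (simp add: tendsto_const_iff)
  qed
  have "\<forall>j < N + int n. d j = 0" for n
  proof (induction n)
    case (Suc n)
    show ?case
    proof (intro allI impI)
      fix j assume "j < N + int (Suc n)"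
      hence "j < N + int n \<or> j = N + int n" by auto
      thus "d j = 0" using Suc step[of "N + int n"] by blast
    qed
  qed (use low in simp)
  moreover have "j < N + int (nat (j - N + 1))" for j by simp
  ultimately have "d j = 0" for j by blast
  thus ?thesis by blast
qed

text \<open>Substituting \<open>1 / x\<close> for \<open>x\<close> reduces this to
  \<open>laurent_low_zero\<close>; \<open>max R 1\<close> keeps the radius positive.\<close>

lemma laurent_high_zero:
  assumes high: "\<And>j. j > N \<Longrightarrow> c j = 0"
    and sum: "\<And>x. norm x > R \<Longrightarrow> ((\<lambda>j. c j * x powi j) has_sum 0) UNIV"
  shows "c = (\<lambda>j. 0 :: complex)"
proof -
  have "(\<lambda>j. c (- j)) = (\<lambda>j. 0)"
  proof (rule laurent_low_zero[of "- N" _ "1 / max R 1"])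
    fix x :: complex assume x: "0 < norm x" "norm x < 1 / max R 1"
    have "norm (inverse x) > R"
    proof -
      have "norm x * max R 1 < 1"
        using x(2) by (subst (asm) pos_less_divide_eq) auto
      hence "max R 1 < 1 / norm x"
        by (simp only: pos_less_divide_eq[OF x(1)] mult.commute)
      thus ?thesis by (simp add: norm_inverse norm_divide inverse_eq_divide)
    qed
    hence "((\<lambda>j. c j * inverse x powi j) has_sum 0) UNIV" by (rule sum)
    hence "((\<lambda>j. c (- j) * inverse x powi (- j)) has_sum 0) UNIV"
      using has_sum_int_uminus[of "\<lambda>j. c j * inverse x powi j" 0] by simp
    thus "((\<lambda>j. c (- j) * x powi j) has_sum 0) UNIV"
      by (simp add: power_int_minus power_int_inverse)
  qed (use high in auto)
  thus ?thesis by (metis minus_minus)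
qed

text \<open>Taking norms in the recurrence and summing over a finite window gives
  \<open>norm s * G \<le> Y + norm t * G\<close>, where \<open>G\<close> is the sum of
  \<open>norm (g j)\<close> over the window. The shift by one does not enlarge this sum because
  \<open>g\<close> vanishes above \<open>N\<close>. Hence all partial sums are at most
  \<open>Y / (norm s - norm t)\<close>.\<close>

lemma abs_summable_recurrence:
  fixes g y :: "int \<Rightarrow> complex"
  assumes high: "\<And>j. j > N \<Longrightarrow> g j = 0" and st: "norm t < norm s"
    and rec: "\<And>j. s * g (j - 1) = y j + t * g j"
    and y: "(\<lambda>j. norm (y j)) summable_on UNIV"
  shows "(\<lambda>j. norm (g j)) summable_on UNIV"
proof (rule nonneg_bdd_above_summable_on)
  define Y where "Y = infsum (\<lambda>j. norm (y j)) UNIV"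
  have bound: "(\<Sum>j\<in>{- int m..N}. norm (g j)) \<le> Y / (norm s - norm t)" for m
  proof -
    have sub: "(\<Sum>j\<in>{- int m + 1..N + 1}. norm (g j)) \<le> (\<Sum>j\<in>{- int m..N}. norm (g j))"
    proof -
      have "(\<Sum>j\<in>{- int m + 1..N + 1}. norm (g j)) \<le> (\<Sum>j\<in>{- int m..N+1}. norm (g j))"
        by (rule sum_mono2) auto
      also have "\<dots> = (\<Sum>j\<in>{- int m..N}. norm (g j))"
        by (rule sum.mono_neutral_right) (use high in auto)
      finally show ?thesis .
    qed
    have "norm s * (\<Sum>j\<in>{- int m..N}. norm (g j)) = (\<Sum>j\<in>{- int m + 1..N + 1}. norm s * norm (g (j - 1)))"
      unfolding sum_distrib_left by (rule sum.reindex_bij_witness[of _ "\<lambda>j. j - 1" "\<lambda>j. j + 1"]) auto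
    also have "\<dots> \<le> (\<Sum>j\<in>{- int m + 1..N + 1}. norm (y j) + norm t * norm (g j))"
      by (rule sum_mono) (metis norm_mult norm_triangle_ineq rec)
    also have "\<dots> = (\<Sum>j\<in>{- int m + 1..N + 1}. norm (y j)) + norm t * (\<Sum>j\<in>{- int m + 1..N + 1}. norm (g j))"
      by (simp add: sum.distrib sum_distrib_left)
    also have "\<dots> \<le> Y + norm t * (\<Sum>j\<in>{- int m..N}. norm (g j))"
      unfolding Y_def by (intro add_mono mult_left_mono sub finite_sum_le_infsum y) auto
    finally show ?thesis using st by (simp add: field_simps)
  qed
  show "bdd_above (sum (\<lambda>j. norm (g j)) ` {F. F \<subseteq> UNIV \<and> finite F})"
  proof (rule bdd_aboveI2)
    fix F :: "int set" assume "F \<in> {F. F \<subseteq> UNIV \<and> finite F}"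
    hence F: "finite F" by simp
    define m where "m = nat (- Min (insert 0 F))"
    have m: "- int m \<le> j" if "j \<in> F" for j
    proof -
      have "Min (insert 0 F) \<le> j" using F that by (intro Min_le) auto
      moreover have "- Min (insert 0 F) \<le> int m" unfolding m_def by (rule nat_le_iff[THEN iffD1]) simp
      ultimately show ?thesis by linarith
    qed
    have "(\<Sum>j\<in>F. norm (g j)) = (\<Sum>j\<in>F \<inter> {..N}. norm (g j))"
      by (rule sum.mono_neutral_right) (use high F not_less in auto)
    also have "\<dots> \<le> (\<Sum>j\<in>{- int m..N}. norm (g j))"
      by (rule sum_mono2) (use m in auto)
    also have "\<dots> \<le> Y / (norm s - norm t)" by (rule bound)
    finally show "(\<Sum>j\<in>F. norm (g j)) \<le> Y / (norm s - norm t)" .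
  qed
qed auto

text \<open>Rewritten, \<open>zmult\<close> is a recurrence for the terms
  \<open>g j * x powi j\<close> with factors \<open>x\<close> and \<open>z\<close>, and the one of
  larger norm dominates: for series bounded above this is used outside the circle through
  \<open>z\<close>, for series bounded below inside it.\<close>

lemma zmult_expansion_step:
  assumes x: "x \<noteq> 0"
    and dom: "(norm x > norm z \<and> (\<exists>N. \<forall>j>N. g j = 0)) \<or> (norm x < norm z \<and> (\<exists>N. \<forall>j<N. g j = 0))"
    and abs: "(\<lambda>j. norm (zmult z g j * x powi j)) summable_on UNIV"
    and sum: "((\<lambda>j. zmult z g j * x powi j) has_sum E) UNIV"
  shows "(\<lambda>j. norm (g j * x powi j)) summable_on UNIV"
    and "((\<lambda>j. g j * x powi j) has_sum (E / (x - z))) UNIV"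
proof -
  have rec: "x * (g (j - 1) * x powi (j - 1)) = zmult z g j * x powi j + z * (g j * x powi j)" for j
    using x by (simp add: zmult_def power_int_diff field_simps)
  show *: "(\<lambda>j. norm (g j * x powi j)) summable_on UNIV"
    using dom
  proof
    assume "norm x > norm z \<and> (\<exists>N. \<forall>j>N. g j = 0)"
    then obtain N where "norm x > norm z" "\<And>j. j > N \<Longrightarrow> g j = 0" by blast
    thus ?thesis by (intro abs_summable_recurrence[OF _ _ rec abs, of N]) auto
  next
    assume "norm x < norm z \<and> (\<exists>N. \<forall>j<N. g j = 0)"
    then obtain N where N: "norm x < norm z" "\<And>j. j < N \<Longrightarrow> g j = 0" by blast
    \<comment> \<open>Reflecting the index makes the series bounded above and interchanges
      \<open>x\<close> and \<open>z\<close> in the recurrence; \<open>rec\<close> at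
      \<open>1 - j\<close> supplies the step at \<open>j\<close>.\<close>
    define g' where "g' j = g (- j) * x powi (- j)" for j
    define y' where "y' j = - (zmult z g (1 - j) * x powi (1 - j))" for j
    have "(\<lambda>j. norm (g' j)) summable_on UNIV"
    proof (rule abs_summable_recurrence[of "- N" g' x z y'])
      show "z * g' (j - 1) = y' j + x * g' j" for j
        using rec[of "1 - j"] by (simp add: g'_def y'_def)
      show "(\<lambda>j. norm (y' j)) summable_on UNIV"
        using abs unfolding y'_def
        by (simp, subst summable_on_reindex_bij_witness[of _ "\<lambda>j. 1 - j" "\<lambda>j. 1 - j"]) auto
    qed (use N in \<open>auto simp: g'_def\<close>)
    thus ?thesis unfolding g'_def
      using has_sum_int_uminus[of "\<lambda>j. norm (g j * x powi j)"] unfolding summable_on_def by blast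
  qed
  have "x \<noteq> z" using dom by auto
  obtain S where S: "((\<lambda>j. g j * x powi j) has_sum S) UNIV"
    using abs_summable_summable[OF *] unfolding summable_on_def by blast
  from zmult_has_sum[OF x S] sum have "E = (x - z) * S" by (rule has_sum_unique[symmetric])
  with S \<open>x \<noteq> z\<close> show "((\<lambda>j. g j * x powi j) has_sum (E / (x - z))) UNIV" by simp
qed

lemma zmult_pow_expansion:
  assumes x: "x \<noteq> 0"
    and dom: "(norm x > norm z \<and> (\<exists>N. \<forall>j>N. g j = 0)) \<or> (norm x < norm z \<and> (\<exists>N. \<forall>j<N. g j = 0))"
    and "(\<lambda>j. norm ((zmult z ^^ B) g j * x powi j)) summable_on UNIV"
    and "((\<lambda>j. (zmult z ^^ B) g j * x powi j) has_sum E) UNIV"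
  shows "(\<lambda>j. norm (g j * x powi j)) summable_on UNIV \<and>
         ((\<lambda>j. g j * x powi j) has_sum (E / (x - z) ^ B)) UNIV"
  using assms(3,4)
proof (induction B arbitrary: E)
  case (Suc B)
  have dom': "(norm x > norm z \<and> (\<exists>N. \<forall>j>N. (zmult z ^^ B) g j = 0))
      \<or> (norm x < norm z \<and> (\<exists>N. \<forall>j<N. (zmult z ^^ B) g j = 0))"
    using dom
  proof
    assume "norm x > norm z \<and> (\<exists>N. \<forall>j>N. g j = 0)"
    then obtain N where N: "norm x > norm z" "\<And>j. j > N \<Longrightarrow> g j = 0" by blast
    have "(zmult z ^^ B) g j = 0" if "j > N + int B" for j
      using N(2) that by (rule zmult_pow_high)
    with N show ?thesis by blast
  next
    assume "norm x < norm z \<and> (\<exists>N. \<forall>j<N. g j = 0)"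
    then obtain N where N: "norm x < norm z" "\<And>j. j < N \<Longrightarrow> g j = 0" by blast
    have "(zmult z ^^ B) g j = 0" if "j < N" for j
      using N(2) that by (rule zmult_pow_low)
    with N show ?thesis by blast
  qed
  from Suc.IH[OF zmult_expansion_step[OF x dom']] Suc.prems
  have "(\<lambda>j. norm (g j * x powi j)) summable_on UNIV \<and>
         ((\<lambda>j. g j * x powi j) has_sum (E / (x - z) / (x - z) ^ B)) UNIV" by simp
  thus ?case by (simp add: field_simps)
qed auto

section \<open>Rational functions and their two expansions\<close>

lemma finite_laurent:
  assumes "\<And>j. j < - int A \<Longrightarrow> e j = 0" "\<And>j. j > N \<Longrightarrow> e j = 0"
  shows "\<exists>p :: complex poly. \<forall>x. x \<noteq> 0 \<longrightarrow> (\<lambda>j. norm (e j * x powi j)) summable_on UNIV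
     \<and> ((\<lambda>j. e j * x powi j) has_sum (poly p x / x ^ A)) UNIV"
proof -
  define K where "K = nat (N + int A)"
  define p where "p = (\<Sum>j\<le>K. monom (e (int j - int A)) j)"
  have ran: "e j = 0" if "j \<notin> {- int A..int K - int A}" for j
  proof (cases "j < - int A")
    case False
    have "N + int A \<le> int K" unfolding K_def by (rule nat_le_iff[THEN iffD1]) simp
    thus ?thesis using False that assms(2)[of j] by auto
  qed (use assms in auto)
  have *: "(\<Sum>j\<in>{- int A..int K - int A}. e j * x powi j) = poly p x / x ^ A" if "x \<noteq> 0" for x
  proof -
    have "(\<Sum>j\<in>{- int A..int K - int A}. e j * x powi j) = (\<Sum>j\<le>K. e (int j - int A) * x powi (int j - int A))"
      by (rule sum.reindex_bij_witness[of _ "\<lambda>j. int j - int A" "\<lambda>j. nat (j + int A)"]) auto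
    also have "\<dots> = poly p x / x ^ A"
      using that by (simp add: p_def poly_sum poly_monom power_int_diff sum_divide_distrib)
    finally show ?thesis .
  qed
  show ?thesis
  proof (rule exI[of _ p], intro allI impI conjI)
    fix x :: complex assume x: "x \<noteq> 0"
    show "(\<lambda>j. norm (e j * x powi j)) summable_on UNIV"
      by (rule has_sum_imp_summable, rule has_sum_finite_supportI[of "{- int A..int K - int A}"]) (use ran in auto)
    show "((\<lambda>j. e j * x powi j) has_sum (poly p x / x ^ A)) UNIV"
      unfolding *[OF x, symmetric] by (rule has_sum_finite_supportI) (use ran in auto)
  qed
qed

text \<open>After cross-multiplication two polynomials agree at infinitely many points, hence
  everywhere. A quotient with vanishing denominator has value 0, so equality is claimed only on a
  punctured disc avoiding the nonzero roots of both denominators.\<close>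

lemma rational_fun_eq_off_finite:
  assumes "rational_fun f" "rational_fun g" "\<And>x. norm x > R \<Longrightarrow> f x = g x"
  shows "\<exists>r>0. \<forall>x. 0 < norm x \<and> norm x < r \<longrightarrow> f x = g x"
proof -
  obtain p q where f: "q \<noteq> 0" "\<And>x. f x = poly p x / poly q x"
    using assms(1) unfolding rational_fun_def by blast
  obtain p' q' where g: "q' \<noteq> 0" "\<And>x. g x = poly p' x / poly q' x"
    using assms(2) unfolding rational_fun_def by blast
  have fin: "finite {x. poly (q * q') x = 0}"
    using f g by (intro poly_roots_finite) simp
  have "infinite {x::complex. norm x > R}"
  proof
    assume "finite {x::complex. norm x > R}"
    moreover have "(\<lambda>n::nat. of_real (\<bar>R\<bar> + 1 + real n)) ` UNIV \<subseteq> {x::complex. norm x > R}"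
      by (auto simp del: of_real_add)
    ultimately have "finite (range (\<lambda>n::nat. of_real (\<bar>R\<bar> + 1 + real n) :: complex))"
      by (rule rev_finite_subset)
    thus False by (subst (asm) finite_image_iff) (auto simp: inj_on_def)
  qed
  with fin have inf: "infinite ({x::complex. norm x > R} - {x. poly (q * q') x = 0})"
    by (rule Diff_infinite_finite)
  have "p * q' - p' * q = 0"
  proof (rule ccontr)
    assume "p * q' - p' * q \<noteq> 0"
    hence "finite {x. poly (p * q' - p' * q) x = 0}" by (rule poly_roots_finite)
    moreover have "{x::complex. norm x > R} - {x. poly (q * q') x = 0} \<subseteq> {x. poly (p * q' - p' * q) x = 0}"
    proof
      fix x assume x: "x \<in> {x::complex. norm x > R} - {x. poly (q * q') x = 0}"
      with assms(3)[of x] have "poly p x / poly q x = poly p' x / poly q' x" "poly q x \<noteq> 0" "poly q' x \<noteq> 0"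
        by (auto simp: f(2) g(2))
      thus "x \<in> {x. poly (p * q' - p' * q) x = 0}" by (simp add: frac_eq_eq)
    qed
    ultimately show False using inf finite_subset by blast
  qed
  hence eq: "poly p x * poly q' x = poly p' x * poly q x" for x
    by (metis eq_iff_diff_eq_0 poly_mult)
  have "\<exists>r>0. \<forall>x\<in>{x. poly (q * q') x = 0}. x \<noteq> 0 \<longrightarrow> r \<le> dist 0 x"
    by (rule finite_set_avoid[OF fin])
  then obtain r where r: "r > 0" "\<And>x. poly (q * q') x = 0 \<Longrightarrow> x \<noteq> 0 \<Longrightarrow> r \<le> norm x" by auto
  show ?thesis
  proof (intro exI[of _ r] conjI allI impI r)
    fix x :: complex assume "0 < norm x \<and> norm x < r"
    hence "poly q x \<noteq> 0" "poly q' x \<noteq> 0" using r(2)[of x] by auto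
    thus "f x = g x" using eq[of x] by (simp add: f(2) g(2) frac_eq_eq)
  qed
qed

text \<open>The common product with \<open>(x - z)^B\<close> is bounded above because of
  \<open>c\<close> and below because of \<open>d\<close>, so it is a Laurent polynomial; its
  quotient by \<open>(x - z)^B\<close> expands to \<open>c\<close> outside the circle through
  \<open>z\<close> and to \<open>d\<close> inside it.\<close>

lemma iota_eqI:
  assumes z: "z \<noteq> 0" and high: "\<And>j. j > N \<Longrightarrow> c j = 0" and low: "\<And>j. j < s \<Longrightarrow> d j = 0"
    and eq: "(zmult z ^^ B) c = (zmult z ^^ B) d"
  shows "iota0_iotainf_inv c = d"
proof -
  define e where "e = (zmult z ^^ B) c"
  define A where "A = nat (- s)"
  have e_high: "e j = 0" if "j > N + int B" for j
    unfolding e_def using high that by (rule zmult_pow_high)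
  have "e j = 0" if "j < s" for j
    unfolding e_def eq using low that by (rule zmult_pow_low)
  moreover have "- s \<le> int A" unfolding A_def by (rule nat_le_iff[THEN iffD1]) simp
  ultimately have e_low: "e j = 0" if "j < - int A" for j using that by simp
  obtain p where p: "\<And>x. x \<noteq> 0 \<Longrightarrow> (\<lambda>j. norm (e j * x powi j)) summable_on UNIV
     \<and> ((\<lambda>j. e j * x powi j) has_sum (poly p x / x ^ A)) UNIV"
    using finite_laurent[of A e "N + int B"] e_low e_high by blast
  define q where "q = monom 1 A * [:- z, 1:] ^ B"
  define f where "f x = poly p x / poly q x" for x
  have fx: "f x = poly p x / x ^ A / (x - z) ^ B" for x
    by (simp add: f_def q_def poly_monom)
  have rf: "rational_fun f" unfolding rational_fun_def f_def q_def
    by (rule exI[of _ p], rule exI[of _ "monom 1 A * [:- z, 1:] ^ B"]) (simp add: monom_eq_0_iff)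
  have "((\<lambda>j. c j * x powi j) has_sum f x) UNIV" if "norm x > norm z" for x
  proof -
    have "x \<noteq> 0" using that by auto
    thus ?thesis unfolding fx using zmult_pow_expansion[of x z c B "poly p x / x ^ A"] p[of x] that high
      unfolding e_def by blast
  qed
  hence linf: "laurent_at_infty f c" unfolding laurent_at_infty_def using high by blast
  have dsum: "((\<lambda>j. d j * x powi j) has_sum f x) UNIV" if "0 < norm x" "norm x < norm z" for x
  proof -
    have "x \<noteq> 0" using that by auto
    thus ?thesis unfolding fx using zmult_pow_expansion[of x z d B "poly p x / x ^ A"] p[of x] that low
      unfolding e_def eq by blast
  qed
  hence l0: "laurent_at_zero f d" unfolding laurent_at_zero_def using low z
    by (metis zero_less_norm_iff)
  show ?thesis unfolding iota0_iotainf_inv_def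
  proof (rule the_equality)
    show "\<exists>f. rational_fun f \<and> laurent_at_infty f c \<and> laurent_at_zero f d" using rf linf l0 by blast
  next
    fix d' assume "\<exists>f. rational_fun f \<and> laurent_at_infty f c \<and> laurent_at_zero f d'"
    \<comment> \<open>Any rational function with expansion \<open>c\<close> at infinity agrees with
      \<open>f\<close> for large arguments, thus also near 0, where Laurent coefficients are
      unique.\<close>
    then obtain f' where f': "rational_fun f'" "laurent_at_infty f' c" "laurent_at_zero f' d'" by blast
    obtain R1 R2 where "\<And>x. norm x > R1 \<Longrightarrow> ((\<lambda>j. c j * x powi j) has_sum f x) UNIV"
       "\<And>x. norm x > R2 \<Longrightarrow> ((\<lambda>j. c j * x powi j) has_sum f' x) UNIV"
      using linf f'(2) unfolding laurent_at_infty_def by blast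
    hence "f x = f' x" if "norm x > max R1 R2" for x
      using that by (metis has_sum_unique max_less_iff_conj)
    then obtain r where r: "r > 0" "\<And>x. 0 < norm x \<Longrightarrow> norm x < r \<Longrightarrow> f x = f' x"
      using rational_fun_eq_off_finite[OF rf f'(1)] by blast
    obtain N' r' where d': "\<And>j. j < N' \<Longrightarrow> d' j = 0" "r' > 0"
      "\<And>x. 0 < norm x \<Longrightarrow> norm x < r' \<Longrightarrow> ((\<lambda>j. d' j * x powi j) has_sum f' x) UNIV"
      using f'(3) unfolding laurent_at_zero_def by blast
    have "(\<lambda>j. d' j - d j) = (\<lambda>j. 0)"
    proof (rule laurent_low_zero[of "min N' s" _ "min (norm z) (min r r')"])
      fix x :: complex assume x: "0 < norm x" "norm x < min (norm z) (min r r')"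
      have "((\<lambda>j. d' j * x powi j - d j * x powi j) has_sum f' x - f x) UNIV"
        using x by (intro has_sum_minus dsum d') auto
      thus "((\<lambda>j. (d' j - d j) * x powi j) has_sum 0) UNIV"
        using r(2)[of x] x by (simp add: left_diff_distrib)
    qed (use z r d' low in auto)
    thus "d' = d" by (metis eq_iff_diff_eq_0 ext)
  qed
qed

lemma iota_props:
  assumes z: "z \<noteq> 0" and high: "\<And>j. j > N \<Longrightarrow> c j = 0"
    and low: "\<And>j. j < s \<Longrightarrow> (zmult z ^^ B) c j = 0"
  shows "(zmult z ^^ B) (iota0_iotainf_inv c) = (zmult z ^^ B) c"
    and "j < s \<Longrightarrow> iota0_iotainf_inv c j = 0"
proof -
  obtain d where "(zmult z ^^ B) d = (zmult z ^^ B) c" "\<forall>j<s. d j = 0"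
    using zmult_pow_surj_low[OF z, of s "(zmult z ^^ B) c" B] low by blast
  moreover from this have "iota0_iotainf_inv c = d"
    by (intro iota_eqI[OF z, where N = N and s = s and B = B]) (use high in auto)
  ultimately show "(zmult z ^^ B) (iota0_iotainf_inv c) = (zmult z ^^ B) c"
    and "j < s \<Longrightarrow> iota0_iotainf_inv c j = 0" by auto
qed

text \<open>From left to right, \<open>(x - z)^B\<close> times the series and the Laurent polynomial
  \<open>poly p x / x ^ A\<close> have the same sum for \<open>norm x > norm z\<close>, so the same
  coefficients. Conversely, the bounds above and below leave a Laurent polynomial, whose division by
  \<open>(x - z)^B\<close> converges absolutely there.\<close>

lemma rational_expansion_iff:
  assumes z: "z \<noteq> 0" and high: "\<And>j. j > N \<Longrightarrow> c j = 0"
  shows "(\<exists>p :: complex poly. \<forall>x. norm x > norm z \<longrightarrow>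
        (\<lambda>j. norm (c j * x powi j)) summable_on UNIV \<and>
        ((\<lambda>j. c j * x powi j) has_sum (poly p x / (x ^ A * (x - z) ^ B))) UNIV)
     \<longleftrightarrow> (\<forall>j < - int A. (zmult z ^^ B) c j = 0)" (is "?L \<longleftrightarrow> ?R")
proof
  assume ?L
  then obtain p where p: "\<And>x. norm x > norm z \<Longrightarrow>
      ((\<lambda>j. c j * x powi j) has_sum (poly p x / (x ^ A * (x - z) ^ B))) UNIV" by blast
  \<comment> \<open>Coefficients of \<open>poly p x / x ^ A\<close>; without the case distinction
    \<open>nat\<close> would send all lower indices to \<open>coeff p 0\<close>.\<close>
  define e where "e j = (if j < - int A then 0 else coeff p (nat (j + int A)))" for j
  have e: "((\<lambda>j. e j * x powi j) has_sum poly p x / x ^ A) UNIV" if "x \<noteq> 0" for x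
  proof -
    have "((\<lambda>j. e j * x powi j) has_sum (\<Sum>j\<in>(\<lambda>i. int i - int A) ` {..degree p}. e j * x powi j)) UNIV"
    proof (rule has_sum_finite_supportI)
      fix j :: int assume "j \<notin> (\<lambda>i. int i - int A) ` {..degree p}"
      hence "j < - int A \<or> nat (j + int A) > degree p"
        by (cases "j < - int A") (auto simp: image_iff not_less dest!: bspec[of _ _ "nat (j + int A)"])
      thus "e j * x powi j = 0" by (auto simp: e_def coeff_eq_0)
    qed simp
    also have "(\<Sum>j\<in>(\<lambda>i. int i - int A) ` {..degree p}. e j * x powi j) = poly p x / x ^ A"
      using that by (subst sum.reindex) (auto simp: inj_on_def e_def poly_altdef power_int_diff sum_divide_distrib)
    finally show ?thesis .
  qed
  have "(\<lambda>j. (zmult z ^^ B) c j - e j) = (\<lambda>j. 0)"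
  proof (rule laurent_high_zero[of "max (N + int B) (int (degree p) - int A)" _ "norm z"])
    fix j assume "j > max (N + int B) (int (degree p) - int A)"
    thus "(zmult z ^^ B) c j - e j = 0"
      using zmult_pow_high[where N = N and c = c and j = j and B = B and z = z] high by (auto simp: e_def intro!: coeff_eq_0)
  next
    fix x :: complex assume x: "norm x > norm z"
    hence "x \<noteq> 0" "x \<noteq> z" by auto
    have "((\<lambda>j. (zmult z ^^ B) c j * x powi j - e j * x powi j) has_sum
        ((x - z) ^ B * (poly p x / (x ^ A * (x - z) ^ B)) - poly p x / x ^ A)) UNIV"
      by (intro has_sum_minus e zmult_pow_has_sum p x \<open>x \<noteq> 0\<close>)
    thus "((\<lambda>j. ((zmult z ^^ B) c j - e j) * x powi j) has_sum 0) UNIV"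
      using \<open>x \<noteq> z\<close> by (simp add: left_diff_distrib)
  qed
  hence "(zmult z ^^ B) c j = e j" for j by (metis eq_iff_diff_eq_0)
  thus ?R by (simp add: e_def)
next
  assume R: ?R
  obtain p where p: "\<And>x. x \<noteq> 0 \<Longrightarrow> (\<lambda>j. norm ((zmult z ^^ B) c j * x powi j)) summable_on UNIV
     \<and> ((\<lambda>j. (zmult z ^^ B) c j * x powi j) has_sum (poly p x / x ^ A)) UNIV"
    using finite_laurent[of A "(zmult z ^^ B) c" "N + int B"] R zmult_pow_high[where N = N and c = c and B = B and z = z] high by auto
  show ?L
  proof (rule exI[of _ p], intro allI impI)
    fix x :: complex assume x: "norm x > norm z"
    hence "x \<noteq> 0" by auto
    have "norm x > norm z \<and> (\<exists>N. \<forall>j>N. c j = 0)" using x high by blast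
    with zmult_pow_expansion[of x z c B "poly p x / x ^ A"] p[OF \<open>x \<noteq> 0\<close>] \<open>x \<noteq> 0\<close>
    show "(\<lambda>j. norm (c j * x powi j)) summable_on UNIV \<and>
        ((\<lambda>j. c j * x powi j) has_sum (poly p x / (x ^ A * (x - z) ^ B))) UNIV"
      by (metis divide_divide_eq_left)
  qed
qed

section \<open>Formal series in two variables\<close>

text \<open>A function \<open>F\<close> stands for the series with coefficient \<open>F a b\<close> at \<open>x\<^sub>1\<^sup>a x\<^sub>2\<^sup>b\<close>. Then \<open>binom_mult l F\<close> is its
  product with \<open>(x\<^sub>1 - x\<^sub>2)\<^sup>l\<close>, expanded in nonnegative powers of \<open>x\<^sub>2\<close>, and \<open>iterate_side K\<close> is the coefficient
  of \<open>x\<^sub>0\<^sup>-\<^sup>l\<^sup>-\<^sup>1\<close> in \<open>x\<^sub>2\<^sup>-\<^sup>1 \<delta>((x\<^sub>1 - x\<^sub>0)/x\<^sub>2) (\<Sum>\<^sub>m K\<^sub>m(x\<^sub>2) x\<^sub>0\<^sup>-\<^sup>m\<^sup>-\<^sup>1)\<close>, where \<open>K i\<close> stands for \<open>K\<^sub>l\<^sub>+\<^sub>i\<close>.\<close>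

definition zmult1 :: "complex \<Rightarrow> nat \<Rightarrow> (int \<Rightarrow> int \<Rightarrow> complex) \<Rightarrow> int \<Rightarrow> int \<Rightarrow> complex" where
  "zmult1 z B F = (\<lambda>a b. (zmult z ^^ B) (\<lambda>a'. F a' b) a)"

definition zmult2 :: "complex \<Rightarrow> nat \<Rightarrow> (int \<Rightarrow> int \<Rightarrow> complex) \<Rightarrow> int \<Rightarrow> int \<Rightarrow> complex" where
  "zmult2 z B F = (\<lambda>a. (zmult z ^^ B) (F a))"

definition binom_mult :: "int \<Rightarrow> (int \<Rightarrow> int \<Rightarrow> complex) \<Rightarrow> int \<Rightarrow> int \<Rightarrow> complex" where
  "binom_mult l F = (\<lambda>a b. fsum (\<lambda>i::nat. (-1) ^ i * (of_int l gchoose i) * F (a - l + int i) (b - int i)))"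

definition iterate_side :: "(nat \<Rightarrow> int \<Rightarrow> complex) \<Rightarrow> int \<Rightarrow> int \<Rightarrow> complex" where
  "iterate_side K = (\<lambda>a b. fsum (\<lambda>i::nat. (of_int (- a - 1) gchoose i) * K i (a + b + 1 + int i)))"

abbreviation (input) flip :: "(int \<Rightarrow> int \<Rightarrow> complex) \<Rightarrow> int \<Rightarrow> int \<Rightarrow> complex" where
  "flip F \<equiv> \<lambda>a b. F b a"

text \<open>These are the diagonals along which \<open>binom_mult\<close> sums. Finite support there
  keeps \<open>fsum\<close> linear; on an infinite support it returns 0.\<close>

definition antidiag_finite :: "(int \<Rightarrow> int \<Rightarrow> complex) \<Rightarrow> bool" where
  "antidiag_finite F \<longleftrightarrow> (\<forall>a b. \<exists>N. \<forall>i\<ge>N. F (a + int i) (b - int i) = 0)"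

lemma antidiag_finiteI_high:
  assumes "\<And>a b. a > N \<Longrightarrow> F a b = 0"
  shows "antidiag_finite F"
  unfolding antidiag_finite_def
proof (intro allI)
  fix a b
  show "\<exists>M. \<forall>i\<ge>M. F (a + int i) (b - int i) = 0"
    by (rule exI[of _ "nat (N - a + 1)"]) (use assms in auto)
qed

lemma antidiag_finiteI_low:
  assumes "\<And>a b. b < s \<Longrightarrow> F a b = 0"
  shows "antidiag_finite F"
  unfolding antidiag_finite_def
proof (intro allI)
  fix a b
  show "\<exists>M. \<forall>i\<ge>M. F (a + int i) (b - int i) = 0"
    by (rule exI[of _ "nat (b - s + 1)"]) (use assms in auto)
qed

text \<open>Arbitrary shifts \<open>f\<close> and \<open>g\<close> cover powers of
  \<open>x1 - z\<close> and of \<open>x2 - z\<close> together; finitely many shifts admit a common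
  cutoff.\<close>

lemma antidiag_finite_shift_sum:
  assumes F: "antidiag_finite F"
  shows "antidiag_finite (\<lambda>a b. \<Sum>r\<le>B::nat. k r * F (a - f r) (b - g r))"
proof -
  have *: "\<exists>N. \<forall>i\<ge>N. \<forall>r\<le>B. F (a - f r + int i) (b - g r - int i) = 0" for a b
  proof -
    have "\<forall>r. \<exists>N. \<forall>i\<ge>N. F (a - f r + int i) (b - g r - int i) = 0"
      using F unfolding antidiag_finite_def by blast
    then obtain N where N: "\<And>r i. i \<ge> N r \<Longrightarrow> F (a - f r + int i) (b - g r - int i) = 0" by metis
    show ?thesis
    proof (rule exI[of _ "Max (N ` {..B})"], intro allI impI)
      fix i r assume "i \<ge> Max (N ` {..B})" "r \<le> B"
      moreover from this have "N r \<le> Max (N ` {..B})" by (intro Max_ge) auto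
      ultimately show "F (a - f r + int i) (b - g r - int i) = 0" using N by simp
    qed
  qed
  have eq: "a + int i - f r = a - f r + int i" "b - int i - g r = b - g r - int i" for i r a b
    by auto
  show ?thesis unfolding antidiag_finite_def eq
  proof (intro allI)
    fix a b
    obtain N where "\<And>i r. i \<ge> N \<Longrightarrow> r \<le> B \<Longrightarrow> F (a - f r + int i) (b - g r - int i) = 0"
      using *[of a b] by blast
    thus "\<exists>N. \<forall>i\<ge>N. (\<Sum>r\<le>B. k r * F (a - f r + int i) (b - g r - int i)) = 0"
      by (intro exI[of _ N]) simp
  qed
qed

lemma binom_mult_eq_sum:
  assumes "\<And>i. i \<ge> N \<Longrightarrow> F (a - l + int i) (b - int i) = 0"
  shows "binom_mult l F a b = (\<Sum>i<N. (-1) ^ i * (of_int l gchoose i) * F (a - l + int i) (b - int i))"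
  unfolding binom_mult_def by (rule fsum_nat_eq_sum) (simp add: assms)

lemma binom_mult_shift_sum:
  assumes F: "antidiag_finite F"
  shows "binom_mult l (\<lambda>a b. \<Sum>r\<le>B::nat. k r * F (a - f r) (b - g r)) a b
       = (\<Sum>r\<le>B. k r * binom_mult l F (a - f r) (b - g r))"
proof -
  have "\<forall>r. \<exists>N. \<forall>i\<ge>N. F (a - f r - l + int i) (b - g r - int i) = 0"
    using F unfolding antidiag_finite_def by blast
  then obtain N where N: "\<And>r i. i \<ge> N r \<Longrightarrow> F (a - f r - l + int i) (b - g r - int i) = 0" by metis
  define M where "M = Max (N ` {..B})"
  have "N r \<le> M" if "r \<le> B" for r unfolding M_def using that by (intro Max_ge) auto
  hence M: "F (a - f r - l + int i) (b - g r - int i) = 0" if "i \<ge> M" "r \<le> B" for r i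
    using that N order_trans by blast
  have eq: "a - l + int i - f r = a - f r - l + int i" "b - int i - g r = b - g r - int i" for i r
    by auto
  have "binom_mult l (\<lambda>a b. \<Sum>r\<le>B. k r * F (a - f r) (b - g r)) a b
     = (\<Sum>i<M. (-1) ^ i * (of_int l gchoose i) * (\<Sum>r\<le>B. k r * F (a - f r - l + int i) (b - g r - int i)))"
    by (subst binom_mult_eq_sum[of M]) (simp_all add: eq M)
  also have "\<dots> = (\<Sum>r\<le>B. k r * (\<Sum>i<M. (-1) ^ i * (of_int l gchoose i) * F (a - f r - l + int i) (b - g r - int i)))"
    unfolding sum_distrib_left by (subst sum.swap) (simp add: mult_ac)
  also have "\<dots> = (\<Sum>r\<le>B. k r * binom_mult l F (a - f r) (b - g r))"
    by (intro sum.cong refl arg_cong2[of _ _ _ _ "(*)"], subst binom_mult_eq_sum[of M])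
       (use M in auto)
  finally show ?thesis .
qed

lemma zmult1_expand: "\<exists>k. \<forall>F. zmult1 z B F = (\<lambda>a b. \<Sum>r\<le>B. k r * F (a - int r) (b - 0))"
proof -
  obtain k where k: "\<And>c j. (zmult z ^^ B) c j = (\<Sum>r\<le>B. k r * c (j - int r))"
    using zmult_pow_expand[where z = z and B = B] by blast
  show ?thesis unfolding zmult1_def by (rule exI[of _ k]) (auto simp: k fun_eq_iff)
qed

lemma zmult2_expand: "\<exists>k. \<forall>F. zmult2 z B F = (\<lambda>a b. \<Sum>r\<le>B. k r * F (a - 0) (b - int r))"
proof -
  obtain k where k: "\<And>c j. (zmult z ^^ B) c j = (\<Sum>r\<le>B. k r * c (j - int r))"
    using zmult_pow_expand[where z = z and B = B] by blast
  show ?thesis unfolding zmult2_def by (rule exI[of _ k]) (auto simp: k fun_eq_iff)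
qed

lemma antidiag_finite_zmult1: "antidiag_finite F \<Longrightarrow> antidiag_finite (zmult1 z B F)"
proof -
  obtain k where k: "\<And>F. zmult1 z B F = (\<lambda>a b. \<Sum>r\<le>B. k r * F (a - int r) (b - 0))"
    using zmult1_expand[where z = z and B = B] by blast
  show "antidiag_finite F \<Longrightarrow> antidiag_finite (zmult1 z B F)"
    unfolding k by (rule antidiag_finite_shift_sum[where f = int and g = "\<lambda>_. 0"])
qed

lemma antidiag_finite_zmult2: "antidiag_finite F \<Longrightarrow> antidiag_finite (zmult2 z B F)"
proof -
  obtain k where k: "\<And>F. zmult2 z B F = (\<lambda>a b. \<Sum>r\<le>B. k r * F (a - 0) (b - int r))"
    using zmult2_expand[where z = z and B = B] by blast
  show "antidiag_finite F \<Longrightarrow> antidiag_finite (zmult2 z B F)"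
    unfolding k by (rule antidiag_finite_shift_sum[where g = int and f = "\<lambda>_. 0"])
qed

lemma binom_mult_zmult1:
  assumes "antidiag_finite F"
  shows "binom_mult l (zmult1 z B F) = zmult1 z B (binom_mult l F)"
proof -
  obtain k where k: "\<And>F. zmult1 z B F = (\<lambda>a b. \<Sum>r\<le>B. k r * F (a - int r) (b - 0))"
    using zmult1_expand[where z = z and B = B] by blast
  show ?thesis
    unfolding k by (intro ext binom_mult_shift_sum[OF assms, where f = int and g = "\<lambda>_. 0"])
qed

lemma binom_mult_zmult2:
  assumes "antidiag_finite F"
  shows "binom_mult l (zmult2 z B F) = zmult2 z B (binom_mult l F)"
proof -
  obtain k where k: "\<And>F. zmult2 z B F = (\<lambda>a b. \<Sum>r\<le>B. k r * F (a - 0) (b - int r))"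
    using zmult2_expand[where z = z and B = B] by blast
  show ?thesis
    unfolding k by (intro ext binom_mult_shift_sum[OF assms, where g = int and f = "\<lambda>_. 0"])
qed

lemma zmult1_zmult2_commute: "zmult1 z A (zmult2 z B F) = zmult2 z B (zmult1 z A F)"
proof -
  obtain k where k: "\<And>F. zmult1 z A F = (\<lambda>a b. \<Sum>r\<le>A. k r * F (a - int r) (b - 0))"
    using zmult1_expand[where z = z and B = A] by blast
  obtain k' where k': "\<And>F. zmult2 z B F = (\<lambda>a b. \<Sum>r\<le>B. k' r * F (a - 0) (b - int r))"
    using zmult2_expand[where z = z and B = B] by blast
  show ?thesis unfolding k k'
    by (intro ext, simp only: sum_distrib_left diff_zero, subst sum.swap) (simp add: mult_ac)
qed

lemma zmult1_cmult: "zmult1 z B (\<lambda>a b. c * F a b) = (\<lambda>a b. c * zmult1 z B F a b)"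
  unfolding zmult1_def by (rule ext, rule ext, subst zmult_pow_cmult, rule refl)

lemma zmult2_cmult: "zmult2 z B (\<lambda>a b. c * F a b) = (\<lambda>a b. c * zmult2 z B F a b)"
  unfolding zmult2_def by (rule ext, rule ext, subst zmult_pow_cmult, rule refl)

lemma zmult1_diff: "zmult1 z B (\<lambda>a b. F a b - G a b) = (\<lambda>a b. zmult1 z B F a b - zmult1 z B G a b)"
  unfolding zmult1_def by (rule ext, rule ext, subst zmult_pow_diff, rule refl)

lemma zmult2_diff: "zmult2 z B (\<lambda>a b. F a b - G a b) = (\<lambda>a b. zmult2 z B F a b - zmult2 z B G a b)"
  unfolding zmult2_def by (rule ext, rule ext, subst zmult_pow_diff, rule refl)

lemma zmult1_zero_row: "(\<And>a. F a b = 0) \<Longrightarrow> zmult1 z B F a b = 0"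
  by (simp add: zmult1_def)

lemma zmult2_zero_col: "(\<And>b. F a b = 0) \<Longrightarrow> zmult2 z B F a b = 0"
proof -
  assume "\<And>b. F a b = 0"
  hence "F a = (\<lambda>b. 0)" by auto
  thus ?thesis by (simp add: zmult2_def)
qed

lemma binom_mult_low:
  assumes "\<And>a b. b < s \<Longrightarrow> F a b = 0" "b < s"
  shows "binom_mult l F a b = 0"
  using assms by (simp add: binom_mult_def)

lemma binom_mult_low_total:
  assumes "\<And>a b. a + b < t \<Longrightarrow> F a b = 0" "a + b < t + l"
  shows "binom_mult l F a b = 0"
  using assms by (simp add: binom_mult_def)

text \<open>The leading coefficient of \<open>(x\<^sub>1 - x\<^sub>2)\<^sup>l\<close> is \<open>x\<^sub>1\<^sup>l\<close>, so the coefficients of a series bounded below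
  in \<open>x\<^sub>2\<close> can be recovered along each antidiagonal.\<close>

lemma binom_mult_cancel_low:
  assumes low: "\<And>a b. b < s \<Longrightarrow> F a b = 0"
    and 0: "\<And>a b. a + b < t \<Longrightarrow> binom_mult l F a b = 0"
    and "a + b < t - l"
  shows "F a b = 0"
proof -
  have "a + b < t - l \<Longrightarrow> b < s + int n \<Longrightarrow> F a b = 0" for a b n
  proof (induction n arbitrary: a b)
    case (Suc n)
    \<comment> \<open>For \<open>i \<ge> 1\<close> the entry has the same total degree and second
      exponent below \<open>s + int n\<close>, so the induction hypothesis removes it; the leading
      term with coefficient 1 remains.\<close>
    have "binom_mult l F (a + l) b = (\<Sum>i<1. (-1) ^ i * (of_int l gchoose i) * F (a + l - l + int i) (b - int i))"
      by (rule binom_mult_eq_sum) (use Suc in auto)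
    thus ?case using 0[of "a + l" b] Suc.prems by simp
  qed (use low in auto)
  from this[of a b "nat (b - s + 1)"] assms(3) show ?thesis by simp
qed

lemma zmult1_cancel_low_total:
  assumes "z \<noteq> 0" "\<And>b. \<exists>s. \<forall>a<s. F a b = 0"
    and "\<And>a b. a + b < t \<Longrightarrow> zmult1 z B F a b = 0" "a + b < t"
  shows "F a b = 0"
proof -
  obtain s where "\<forall>a<s. F a b = 0" using assms(2) by blast
  thus ?thesis
    using zmult_pow_cancel_low[of z s "\<lambda>a. F a b" "t - b" B a] assms(1,3,4)
    by (auto simp: zmult1_def)
qed

lemma zmult2_cancel_low_total:
  assumes "z \<noteq> 0" "\<And>a. \<exists>s. \<forall>b<s. F a b = 0"
    and "\<And>a b. a + b < t \<Longrightarrow> zmult2 z B F a b = 0" "a + b < t"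
  shows "F a b = 0"
proof -
  obtain s where "\<forall>b<s. F a b = 0" using assms(2) by blast
  thus ?thesis
    using zmult_pow_cancel_low[of z s "F a" "t - a" B b] assms(1,3,4)
    by (auto simp: zmult2_def)
qed

text \<open>A lower bound on the total degree bounds each exponent once the other is fixed, which
  suffices to cancel one factor at a time.\<close>

lemma zmult1_zmult2_cancel:
  assumes z: "z \<noteq> 0" and low: "\<And>a b. a + b < t \<Longrightarrow> F a b = 0"
    and 0: "\<And>a b. zmult1 z A (zmult2 z B F) a b = 0"
  shows "F a b = 0"
proof -
  have low2: "zmult2 z B F a b = 0" if "a + b < t" for a b
    unfolding zmult2_def by (rule zmult_pow_low[of "t - a"]) (use low that in auto)
  have *: "zmult2 z B F a b = 0" for a b
  proof (rule zmult1_cancel_low_total[OF z, of "zmult2 z B F" "a + b + 1" A])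
    show "\<exists>s. \<forall>a<s. zmult2 z B F a b = 0" for b
      by (rule exI[of _ "t - b"]) (use low2 in auto)
  qed (use 0 in auto)
  show ?thesis
  proof (rule zmult2_cancel_low_total[OF z, of F "a + b + 1" B])
    show "\<exists>s. \<forall>b<s. F a b = 0" for a
      by (rule exI[of _ "t - a"]) (use low in auto)
  qed (use * in auto)
qed

text \<open>Meant for \<open>G\<close> and \<open>H\<close> the two products of operators Y^o, and
  \<open>G'\<close> the product in which the operator of \<open>v\<close> has become Y^R. The
  product \<open>P\<close> of \<open>G'\<close> with
  \<open>(x1 - x2)^k (x1 - z)^A (x2 - z)^B\<close> is bounded below in x2 through \<open>G\<close>
  and in x1 through \<open>H\<close>, so its total degree is at least \<open>s1 + s2\<close>.
  Removing \<open>(x1 - x2)^k\<close> costs \<open>k\<close>; removing \<open>(x2 - z)^B\<close>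
  costs nothing.\<close>

lemma binom_mult_pole_bound:
  assumes z: "z \<noteq> 0"
    and G: "\<And>a b. a > N \<Longrightarrow> G a b = 0" and H: "\<And>a b. b > N' \<Longrightarrow> H a b = 0"
    and comm: "\<And>a b. binom_mult k G a b = (-1) powi k * binom_mult k (flip H) b a"
    and Hu: "\<And>a b. a < s1 \<Longrightarrow> zmult1 z A H a b = 0"
    and Gv: "\<And>a b. b < s2 \<Longrightarrow> zmult2 z B G a b = 0"
    and G': "zmult2 z B G' = zmult2 z B G" "\<And>a b. b < s2 \<Longrightarrow> G' a b = 0"
    and ab: "a + b < s1 + s2 - k"
  shows "zmult1 z A G' a b = 0"
proof -
  have finG: "antidiag_finite G" using G by (rule antidiag_finiteI_high)
  have finH: "antidiag_finite (flip H)" using H by (rule antidiag_finiteI_high)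
  define R where "R = zmult1 z A (zmult2 z B G')"
  define P where "P = binom_mult k R"
  have P1: "P = binom_mult k (zmult1 z A (zmult2 z B G))" unfolding P_def R_def G'(1) ..
  have flipP: "binom_mult k G = (\<lambda>a b. (-1) powi k * flip (binom_mult k (flip H)) a b)"
    using comm by (intro ext)
  have "P = zmult1 z A (zmult2 z B (binom_mult k G))"
    unfolding P1 by (simp add: binom_mult_zmult1 binom_mult_zmult2 antidiag_finite_zmult2 finG)
  also have "\<dots> = (\<lambda>a b. (-1) powi k * zmult1 z A (zmult2 z B (flip (binom_mult k (flip H)))) a b)"
    unfolding flipP zmult2_cmult zmult1_cmult ..
  also have "zmult1 z A (zmult2 z B (flip (binom_mult k (flip H))))
      = flip (binom_mult k (flip (zmult1 z A (zmult2 z B H))))"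
  proof -
    have "flip (binom_mult k (flip (zmult1 z A (zmult2 z B H))))
      = flip (binom_mult k (zmult2 z A (zmult1 z B (flip H))))"
      unfolding zmult1_def zmult2_def ..
    also have "\<dots> = flip (zmult2 z A (zmult1 z B (binom_mult k (flip H))))"
      by (simp add: binom_mult_zmult1 binom_mult_zmult2 antidiag_finite_zmult1 finH)
    also have "\<dots> = zmult1 z A (zmult2 z B (flip (binom_mult k (flip H))))"
      unfolding zmult1_def zmult2_def ..
    finally show ?thesis by simp
  qed
  finally have P2: "P = (\<lambda>a b. (-1) powi k * binom_mult k (flip (zmult1 z A (zmult2 z B H))) b a)" .
  have Pb: "P a b = 0" if "b < s2" for a b
    unfolding P1 by (rule binom_mult_low[of s2]) (use that Gv in \<open>auto intro: zmult1_zero_row\<close>)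
  have Pa: "P a b = 0" if "a < s1" for a b
  proof -
    have "zmult1 z A (zmult2 z B H) a b = 0" if "a < s1" for a b
      unfolding zmult1_zmult2_commute using Hu[OF that] by (intro zmult2_zero_col)
    hence "binom_mult k (flip (zmult1 z A (zmult2 z B H))) b a = 0"
      by (intro binom_mult_low[of s1]) (use that in auto)
    thus ?thesis unfolding P2 by simp
  qed
  have low2: "zmult2 z B G' a b = 0" if "b < s2" for a b
    using that G' Gv by simp
  have Rlow: "R a b = 0" if "b < s2" for a b
    unfolding R_def using low2[OF that] by (intro zmult1_zero_row)
  \<comment> \<open>A nonzero coefficient of \<open>P\<close> would need both
    \<open>a \<ge> s1\<close> and \<open>b \<ge> s2\<close>.\<close>
  have "binom_mult k R a b = 0" if "a + b < s1 + s2" for a b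
    using Pa[of a b] Pb[of b a] that unfolding P_def by linarith
  with Rlow have "R a b = 0" if "a + b < s1 + s2 - k" for a b
    using that by (rule binom_mult_cancel_low)
  hence *: "zmult2 z B (zmult1 z A G') a b = 0" if "a + b < s1 + s2 - k" for a b
    using that unfolding R_def zmult1_zmult2_commute by blast
  show ?thesis
  proof (rule zmult2_cancel_low_total[OF z _ *])
    show "\<exists>s. \<forall>b<s. zmult1 z A G' a b = 0" for a
      using G'(2) by (intro exI[of _ s2] allI impI zmult1_zero_row)
  qed (use ab in auto)
qed

lemma iterate_side_eq_sum:
  assumes "\<And>i j. i \<ge> m \<Longrightarrow> K i j = 0"
  shows "iterate_side K = (\<lambda>a b. \<Sum>i<m. (of_int (- a - 1) gchoose i) * K i (a + b + 1 + int i))"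
  unfolding iterate_side_def by (intro ext fsum_nat_eq_sum) (simp add: assms)

text \<open>\<open>b\<close> enters \<open>iterate_side K\<close> only through the argument of
  \<open>K i\<close>, so \<open>x2 - z\<close> acts inside each \<open>K i\<close>. The exponent
  \<open>a\<close> also enters the binomial coefficient, so \<open>x1 - z\<close> does not pass
  inside in this way.\<close>

lemma zmult2_iterate_side:
  assumes K: "\<And>i j. i \<ge> m \<Longrightarrow> K i j = 0"
  shows "zmult2 z B (iterate_side K) = iterate_side (\<lambda>i. (zmult z ^^ B) (K i))"
proof -
  obtain k where k: "\<And>c j. (zmult z ^^ B) c j = (\<Sum>r\<le>B. k r * c (j - int r))"
    using zmult_pow_expand[where z = z and B = B] by blast
  have eq: "a + (b - int r) + 1 + int i = a + b + 1 + int i - int r" for a b r i by simp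
  have "K i = (\<lambda>j. 0)" if "i \<ge> m" for i using K that by auto
  hence K': "(zmult z ^^ B) (K i) j = 0" if "i \<ge> m" for i j using that by simp
  have "iterate_side K = (\<lambda>a b. \<Sum>i<m. (of_int (- a - 1) gchoose i) * K i (a + b + 1 + int i))"
    using K by (rule iterate_side_eq_sum)
  moreover have "iterate_side (\<lambda>i. (zmult z ^^ B) (K i))
      = (\<lambda>a b. \<Sum>i<m. (of_int (- a - 1) gchoose i) * (zmult z ^^ B) (K i) (a + b + 1 + int i))"
    using K' by (rule iterate_side_eq_sum)
  ultimately show ?thesis
    unfolding zmult2_def k
    by (intro ext, simp only: sum_distrib_left eq, subst sum.swap) (simp only: mult_ac)
qed

lemma iterate_side_low_total:
  assumes "\<And>i j. j < t \<Longrightarrow> K i j = 0" "\<And>i j. i \<ge> m \<Longrightarrow> K i j = 0" "a + b < t - 1 - int m"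
  shows "iterate_side K a b = 0"
proof -
  have "(\<Sum>i<m. (of_int (- a - 1) gchoose i) * K i (a + b + 1 + int i)) = 0"
    by (rule sum.neutral) (use assms(1,3) in auto)
  thus ?thesis using iterate_side_eq_sum[of m K] assms(2) by simp
qed

text \<open>\<open>F\<close>, \<open>E\<close>, \<open>K'\<close> stand for Y^R and
  \<open>G\<close>, \<open>H\<close>, \<open>K\<close> for Y^o. The exponent \<open>B\<close> is
  common to all three terms so that the defect \<open>J\<close> can be multiplied as a
  whole.\<close>

lemma jacobi_transfer:
  assumes z: "z \<noteq> 0"
    and jac: "\<And>a b. binom_mult l G a b - (-1) powi l * binom_mult l (flip H) b a = iterate_side K a b"
    and FG: "zmult1 z B (zmult2 z B F) = zmult1 z B (zmult2 z B G)"
    and EH: "zmult1 z B (zmult2 z B E) = zmult1 z B (zmult2 z B H)"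
    and KK: "\<And>i. (zmult z ^^ B) (K' i) = (zmult z ^^ B) (K i)"
    and fin: "antidiag_finite F" "antidiag_finite G" "antidiag_finite (flip E)" "antidiag_finite (flip H)"
    and Kfin: "\<And>i j. i \<ge> m \<Longrightarrow> K i j = 0" "\<And>i j. i \<ge> m \<Longrightarrow> K' i j = 0"
    and low: "\<And>a b. a + b < t \<Longrightarrow> F a b = 0" "\<And>a b. a + b < t \<Longrightarrow> E a b = 0" "\<And>i j. j < t \<Longrightarrow> K' i j = 0"
  shows "binom_mult l F a b - (-1) powi l * binom_mult l (flip E) b a = iterate_side K' a b"
proof -
  define M where "M F = zmult1 z B (zmult2 z B F)" for F
  have Mdiff: "M (\<lambda>a b. X a b - X' a b) = (\<lambda>a b. M X a b - M X' a b)" for X X'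
    unfolding M_def zmult2_diff zmult1_diff ..
  have Mcmult: "M (\<lambda>a b. c * X a b) = (\<lambda>a b. c * M X a b)" for X c
    unfolding M_def zmult2_cmult zmult1_cmult ..
  have Mbin: "M (binom_mult l X) = binom_mult l (M X)" if "antidiag_finite X" for X
    unfolding M_def using that by (simp add: binom_mult_zmult1 binom_mult_zmult2 antidiag_finite_zmult2)
  have Mflip: "M (flip X) = flip (M X)" for X
  proof -
    have "M (flip X) = flip (zmult2 z B (zmult1 z B X))" unfolding M_def zmult1_def zmult2_def ..
    also have "\<dots> = flip (M X)" unfolding M_def by (simp only: zmult1_zmult2_commute)
    finally show ?thesis .
  qed
  have Mit: "M (iterate_side K) = M (iterate_side K')"
    using zmult2_iterate_side[of m K z B] zmult2_iterate_side[of m K' z B] Kfin KK unfolding M_def by simp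
  define J where "J a b = (binom_mult l F a b - (-1) powi l * flip (binom_mult l (flip E)) a b) - iterate_side K' a b" for a b
  have "M J = (\<lambda>a b. (M (binom_mult l F) a b - (-1) powi l * M (flip (binom_mult l (flip E))) a b) - M (iterate_side K') a b)"
    unfolding J_def Mdiff Mcmult ..
  also have "M (binom_mult l F) = M (binom_mult l G)"
    unfolding Mbin[OF fin(1)] Mbin[OF fin(2)] unfolding M_def FG ..
  also have "M (flip (binom_mult l (flip E))) = M (flip (binom_mult l (flip H)))"
  proof -
    have ME: "M E = M H" unfolding M_def by (rule EH)
    show ?thesis
      unfolding Mflip[of "binom_mult l (flip E)"] Mflip[of "binom_mult l (flip H)"]
        Mbin[OF fin(3)] Mbin[OF fin(4)] Mflip[of E] Mflip[of H] ME ..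
  qed
  also have "M (iterate_side K') = M (\<lambda>a b. binom_mult l G a b - (-1) powi l * flip (binom_mult l (flip H)) a b)"
    unfolding Mit[symmetric] jac ..
  finally have MJ: "M J a b = 0" for a b unfolding Mdiff Mcmult by simp
  \<comment> \<open>\<open>binom_mult l\<close> raises the total degree by \<open>l\<close>;
    \<open>iterate_side\<close> reads \<open>K' i\<close> at \<open>a + b + 1 + int i\<close> with
    \<open>i < m\<close>, which accounts for \<open>t - 1 - int m\<close>.\<close>
  have Jlow: "J a b = 0" if "a + b < min (t + l) (t - 1 - int m)" for a b
    using that binom_mult_low_total[of t F a b l] binom_mult_low_total[of t "flip E" b a l]
      iterate_side_low_total[of t K' m a b] low Kfin(2)
    unfolding J_def by (simp add: add.commute)
  have "J a b = 0"
    by (rule zmult1_zmult2_cancel[OF z, where A = B and B = B and t = "min (t + l) (t - 1 - int m)"])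
      (use Jlow MJ in \<open>auto simp: M_def\<close>)
  thus ?thesis unfolding J_def by simp
qed

section \<open>Vertex operator modes and powers of L(1)\<close>

lemma fsum_add:
  assumes "finite {i. f i \<noteq> 0}" "finite {i. g i \<noteq> 0}"
  shows "fsum (\<lambda>i. f i + g i) = fsum f + fsum g"
proof -
  let ?A = "{i. f i \<noteq> 0} \<union> {i. g i \<noteq> 0}"
  have "fsum (\<lambda>i. f i + g i) = sum (\<lambda>i. f i + g i) ?A" "fsum f = sum f ?A" "fsum g = sum g ?A"
    using assms by (auto intro!: fsum_eq_sum)
  thus ?thesis by (simp add: sum.distrib)
qed

lemma finite_support_nat:
  assumes "\<And>i::nat. i \<ge> N \<Longrightarrow> f i = 0"
  shows "finite {i. f i \<noteq> 0}"
  by (rule finite_subset[of _ "{..<N}"]) (use assms not_less in auto)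

text \<open>The coefficient of \<open>y^j\<close> in
  \<open>(1 + y)^N (1 - y / (1 + y))^P = (1 + y)^(N - P)\<close>. Negating upper indices reduces it
  to Vandermonde's convolution.\<close>

lemma gbinomial_alternating_convolution:
  fixes P N :: complex
  shows "(\<Sum>i\<le>j. (-1) ^ i * (P gchoose i) * ((N - of_nat i) gchoose (j - i))) = (N - P) gchoose j"
proof -
  have "(\<Sum>i\<le>j. (-1) ^ i * (P gchoose i) * ((N - of_nat i) gchoose (j - i)))
      = (-1) ^ j * (\<Sum>i\<le>j. (P gchoose i) * ((of_nat j - N - 1) gchoose (j - i)))"
    unfolding sum_distrib_left
  proof (rule sum.cong)
    fix i assume "i \<in> {..j}"
    hence i: "i \<le> j" by simp
    hence "((N - of_nat i) gchoose (j - i)) = (-1) ^ (j - i) * ((of_nat j - N - 1) gchoose (j - i))"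
      by (subst gbinomial_negated_upper) (simp add: of_nat_diff algebra_simps)
    moreover have "(-1::complex) ^ j = (-1) ^ i * (-1) ^ (j - i)"
      using i by (simp only: power_add[symmetric] le_add_diff_inverse)
    ultimately show "(-1) ^ i * (P gchoose i) * ((N - of_nat i) gchoose (j - i))
        = (-1) ^ j * ((P gchoose i) * ((of_nat j - N - 1) gchoose (j - i)))" by simp
  qed simp
  also have "\<dots> = (-1) ^ j * ((P + (of_nat j - N - 1)) gchoose j)"
    using gbinomial_Vandermonde[of P "of_nat j - N - 1" j] by (simp add: atLeast0AtMost)
  also have "\<dots> = (N - P) gchoose j"
    by (subst (2) gbinomial_negated_upper) (simp add: algebra_simps)
  finally show ?thesis .
qed

lemma sum_square_antidiagonal:
  fixes g :: "nat \<Rightarrow> nat \<Rightarrow> 'a::comm_monoid_add"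
  assumes "\<And>i c. i + c \<ge> I \<Longrightarrow> g i c = 0"
  shows "(\<Sum>i<I. \<Sum>c<I. g i c) = (\<Sum>j<I. \<Sum>i\<le>j. g i (j - i))"
proof -
  have "(\<Sum>i<I. \<Sum>c<I. g i c) = (\<Sum>(i, c)\<in>{..<I} \<times> {..<I}. g i c)"
    by (rule sum.cartesian_product)
  also have "\<dots> = (\<Sum>(i, c)\<in>{(i, c). i + c < I}. g i c)"
    by (rule sum.mono_neutral_right) (use assms not_less in auto)
  also have "\<dots> = (\<Sum>j<I. \<Sum>i\<le>j. g i (j - i))" by (rule sum.triangle_reindex)
  finally show ?thesis .
qed

text \<open>Index set of the expansion in \<open>D_Y\<close>: \<open>r\<close> and \<open>t\<close>
  count the powers of \<open>L 1\<close> falling on \<open>u\<close> and \<open>v\<close>, and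
  \<open>c\<close> the increase of the mode.\<close>

definition triples :: "nat \<Rightarrow> (nat \<times> nat \<times> nat) set" where
  "triples k = {(r, t, c). r + t + c = k}"

lemma finite_triples [simp]: "finite (triples k)"
  by (rule finite_subset[of _ "{..k} \<times> {..k} \<times> {..k}"]) (auto simp: triples_def)

lemma triples_0: "triples 0 = {(0, 0, 0)}"
  by (auto simp: triples_def)

lemma sum_triples_shift1:
  assumes "\<And>t c. f 0 t c = 0"
  shows "(\<Sum>(r, t, c)\<in>triples k. f (Suc r) t c) = (\<Sum>(r, t, c)\<in>triples (Suc k). f r t c)"
proof -
  have "(\<Sum>(r, t, c)\<in>triples k. f (Suc r) t c) = (\<Sum>(r, t, c)\<in>{(r, t, c)\<in>triples (Suc k). r > 0}. f r t c)"
    by (rule sum.reindex_bij_witness[of _ "\<lambda>(r, t, c). (r - 1, t, c)" "\<lambda>(r, t, c). (Suc r, t, c)"])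
       (auto simp: triples_def)
  also have "\<dots> = (\<Sum>(r, t, c)\<in>triples (Suc k). f r t c)"
    by (rule sum.mono_neutral_left) (auto simp: assms intro!: gr0I)
  finally show ?thesis .
qed

lemma sum_triples_shift2:
  assumes "\<And>r c. f r 0 c = 0"
  shows "(\<Sum>(r, t, c)\<in>triples k. f r (Suc t) c) = (\<Sum>(r, t, c)\<in>triples (Suc k). f r t c)"
proof -
  have "(\<Sum>(r, t, c)\<in>triples k. f r (Suc t) c) = (\<Sum>(r, t, c)\<in>{(r, t, c)\<in>triples (Suc k). t > 0}. f r t c)"
    by (rule sum.reindex_bij_witness[of _ "\<lambda>(r, t, c). (r, t - 1, c)" "\<lambda>(r, t, c). (r, Suc t, c)"])
       (auto simp: triples_def)
  also have "\<dots> = (\<Sum>(r, t, c)\<in>triples (Suc k). f r t c)"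
    by (rule sum.mono_neutral_left) (auto simp: assms intro!: gr0I)
  finally show ?thesis .
qed

lemma sum_triples_shift3:
  assumes "\<And>r t. f r t 0 = 0"
  shows "(\<Sum>(r, t, c)\<in>triples k. f r t (Suc c)) = (\<Sum>(r, t, c)\<in>triples (Suc k). f r t c)"
proof -
  have "(\<Sum>(r, t, c)\<in>triples k. f r t (Suc c)) = (\<Sum>(r, t, c)\<in>{(r, t, c)\<in>triples (Suc k). c > 0}. f r t c)"
    by (rule sum.reindex_bij_witness[of _ "\<lambda>(r, t, c). (r, t, c - 1)" "\<lambda>(r, t, c). (r, t, Suc c)"])
       (auto simp: triples_def)
  also have "\<dots> = (\<Sum>(r, t, c)\<in>triples (Suc k). f r t c)"
    by (rule sum.mono_neutral_left) (auto simp: assms intro!: gr0I)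
  finally show ?thesis .
qed

text \<open>A triple in the box has \<open>r + t + c < 2 * K + C\<close>, so this range of totals
  already contains the whole box.\<close>

lemma sum_triples_box:
  fixes Z :: "nat \<Rightarrow> nat \<Rightarrow> nat \<Rightarrow> 'a::comm_monoid_add"
  assumes "\<And>r t c. r \<ge> K \<or> t \<ge> K \<or> c \<ge> C \<Longrightarrow> Z r t c = 0"
  shows "(\<Sum>k<2*K+C. \<Sum>(r, t, c)\<in>triples k. Z r t c) = (\<Sum>r<K. \<Sum>t<K. \<Sum>c<C. Z r t c)"
proof -
  have "(\<Sum>k<2*K+C. \<Sum>(r, t, c)\<in>triples k. Z r t c)
      = (\<Sum>(k, r, t, c)\<in>Sigma {..<2*K+C} triples. Z r t c)"
    by (subst sum.Sigma) (auto simp: case_prod_unfold)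
  also have "\<dots> = (\<Sum>(r, t, c)\<in>{(r, t, c). r + t + c < 2*K+C}. Z r t c)"
    by (rule sum.reindex_bij_witness[of _ "\<lambda>(r, t, c). (r + t + c, r, t, c)" snd])
       (auto simp: triples_def)
  also have "\<dots> = (\<Sum>(r, t, c)\<in>{..<K} \<times> {..<K} \<times> {..<C}. Z r t c)"
  proof (rule sum.mono_neutral_right)
    show "finite {(r, t, c). r + t + c < 2*K+C}"
      by (rule finite_subset[of _ "{..<2*K+C} \<times> {..<2*K+C} \<times> {..<2*K+C}"]) auto
  qed (auto intro!: assms simp: not_less)
  also have "\<dots> = (\<Sum>r<K. \<Sum>t<K. \<Sum>c<C. Z r t c)"
    by (simp add: sum.cartesian_product case_prod_unfold)
  finally show ?thesis .
qed

locale weak_mod =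
  fixes sc :: "complex \<Rightarrow> 'v::ab_group_add \<Rightarrow> 'v" and Y :: "'v \<Rightarrow> int \<Rightarrow> 'v \<Rightarrow> 'v" and vac :: 'v
    and sm :: "complex \<Rightarrow> 'm::ab_group_add \<Rightarrow> 'm" and YM :: "'v \<Rightarrow> int \<Rightarrow> 'm \<Rightarrow> 'm"
  assumes module_sc: "module sc" and wm: "weak_module sc Y vac UNIV sm YM"
begin

sublocale M: vector_space sm
  using wm unfolding weak_module_def by (simp add: module_iff_vector_space)

lemma YM_lincomb_left: "YM (sc a u + sc b u') n m = sm a (YM u n m) + sm b (YM u' n m)"
  using wm unfolding weak_module_def by blast

lemma YM_lincomb_right: "YM v n (sm a m + sm b m') = sm a (YM v n m) + sm b (YM v n m')"
  using wm unfolding weak_module_def by blast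

lemma YM_trunc: "\<exists>N. \<forall>n\<ge>N. YM v n m = 0"
  using wm unfolding weak_module_def by blast

lemma YM_vac: "YM vac n m = (if n = -1 then m else 0)"
  using wm unfolding weak_module_def by blast

lemma YM_jacobi: "jacobi_identity Y sm YM UNIV"
  using wm unfolding weak_module_def by blast

lemma YM_add_left: "YM (u + u') n m = YM u n m + YM u' n m"
  using YM_lincomb_left[of 1 u 1 u' n m] module_sc by (simp add: module.scale_one)

lemma YM_scale_left: "YM (sc a u) n m = sm a (YM u n m)"
  using YM_lincomb_left[of a u 0 u n m] module_sc by (simp add: module.scale_zero_left)

lemma YM_zero_left [simp]: "YM 0 n m = 0"
  using YM_scale_left[of 0 0 n m] module_sc by (simp add: module.scale_zero_left)

lemma YM_add_right: "YM v n (m + m') = YM v n m + YM v n m'"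
  using YM_lincomb_right[of v n 1 m 1 m'] by simp

lemma YM_scale_right: "YM v n (sm a m) = sm a (YM v n m)"
  using YM_lincomb_right[of v n a m 0 m] by simp

lemma YM_zero_right [simp]: "YM v n 0 = 0"
  using YM_scale_right[of v n 0 0] by simp

lemma YM_sum_left: "YM (sum f A) n m = (\<Sum>i\<in>A. YM (f i) n m)"
  by (induction A rule: infinite_finite_induct) (auto simp: YM_add_left)

lemma YM_sum_right: "YM v n (sum f A) = (\<Sum>i\<in>A. YM v n (f i))"
  by (induction A rule: infinite_finite_induct) (auto simp: YM_add_right)

lemma YM_trunc_finite:
  assumes "finite A"
  shows "\<exists>N. \<forall>v\<in>A. \<forall>n\<ge>N. YM v n m = 0"
  using assms
proof (induction A rule: finite_induct)
  case (insert v A)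
  then obtain N1 N2 where "\<forall>v\<in>A. \<forall>n\<ge>N1. YM v n m = 0" "\<forall>n\<ge>N2. YM v n m = 0"
    using YM_trunc by blast
  thus ?case by (intro exI[of _ "max N1 N2"]) auto
qed auto

text \<open>One cutoff \<open>I\<close> makes all three sums ordinary finite sums. Negating the
  upper index turns the right-hand coefficient into \<open>p\<close> choose
  \<open>i\<close>.\<close>

lemma YM_jacobi_sum:
  assumes "\<And>i. i \<ge> I \<Longrightarrow> YM v (q + int i) m = 0" "\<And>i. i \<ge> I \<Longrightarrow> YM u (p + int i) m = 0"
    "\<And>i. i \<ge> I \<Longrightarrow> Y u (l + int i) v = 0"
  shows "(\<Sum>i<I. sm ((-1) ^ i * (of_int l gchoose i)) (YM u (l + p - int i) (YM v (q + int i) m)))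
     - (\<Sum>i<I. sm ((-1) powi (l + int i) * (of_int l gchoose i)) (YM v (l + q - int i) (YM u (p + int i) m)))
     = (\<Sum>i<I. sm (of_int p gchoose i) (YM (Y u (l + int i) v) (p + q - int i) m))"
proof -
  have "fsum (\<lambda>i::nat. sm ((-1) ^ i * (of_int l gchoose i)) (YM u (l + p - int i) (YM v (q + int i) m)))
     - fsum (\<lambda>i::nat. sm ((-1) powi (l + int i) * (of_int l gchoose i)) (YM v (l + q - int i) (YM u (p + int i) m)))
     = fsum (\<lambda>i::nat. sm ((-1) ^ i * (of_int (int i - p - 1) gchoose i)) (YM (Y u (l + int i) v) (p + q - int i) m))"
    using YM_jacobi unfolding jacobi_identity_def by blast
  moreover have "(-1) ^ i * (of_int (int i - p - 1) gchoose i) = (of_int p gchoose i :: complex)" for i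
    by (subst (2) gbinomial_negated_upper) simp
  ultimately show ?thesis
    using assms by (simp add: fsum_nat_eq_sum[of I])
qed

end

section \<open>Commutators with L(0) and L(1), and divided powers of L(1)\<close>

locale voa =
  fixes sc :: "complex \<Rightarrow> 'v::ab_group_add \<Rightarrow> 'v" and Y :: "'v \<Rightarrow> int \<Rightarrow> 'v \<Rightarrow> 'v" and vac om :: 'v
  assumes voa: "is_VOA sc Y vac om"
begin

sublocale V: weak_mod sc Y vac sc Y
  using voa unfolding is_VOA_def weak_mod_def by (simp add: module_iff_vector_space)

abbreviation "L \<equiv> Lop Y om"
abbreviation "Vh \<equiv> Vhom sc Y om"

lemma L_add: "L n (u + v) = L n u + L n v"
  by (simp add: Lop_def V.YM_add_right)

lemma L_scale: "L n (sc a v) = sc a (L n v)"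
  by (simp add: Lop_def V.YM_scale_right)

lemma L_zero [simp]: "L n 0 = 0"
  by (simp add: Lop_def)

lemma L_sum: "L n (sum f A) = (\<Sum>i\<in>A. L n (f i))"
  by (simp add: Lop_def V.YM_sum_right)

lemma L_minus_1: "Y (L (-1) v) n w = sc (- of_int n) (Y v (n - 1) w)"
  using voa unfolding is_VOA_def by blast

lemma L0_L1: "L 0 (L 1 v) - L 1 (L 0 v) = sc (-1) (L 1 v)"
proof -
  have "\<exists>c::complex. \<forall>m n v. L m (L n v) - L n (L m v)
        = sc (of_int (m - n)) (L (m + n) v)
          + (if m + n = 0 then sc ((of_int m ^ 3 - of_int m) / 12 * c) v else 0)"
    using voa unfolding is_VOA_def by (elim conjE)
  then obtain c :: complex where
    "\<And>m n v. L m (L n v) - L n (L m v)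
        = sc (of_int (m - n)) (L (m + n) v)
          + (if m + n = 0 then sc ((of_int m ^ 3 - of_int m) / 12 * c) v else 0)"
    by blast
  from this[of 0 1 v] show ?thesis by simp
qed

lemma grading: "\<exists>f. finite {n. f n \<noteq> 0} \<and> (\<forall>n. f n \<in> Vh n) \<and> v = sum f {n. f n \<noteq> 0}"
  using voa unfolding is_VOA_def by blast

lemma Vh_bounded_below: "\<exists>N. \<forall>n<N. Vh n = {0}"
  using voa unfolding is_VOA_def by blast

lemma creation: "n \<ge> 0 \<Longrightarrow> Y v n vac = 0"
  using voa unfolding is_VOA_def by blast

lemma Vh_iff: "v \<in> Vh n \<longleftrightarrow> L 0 v = sc (of_int n) v"
  by (simp add: Vhom_def)

lemma Vh_zero [simp]: "0 \<in> Vh n"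
  by (simp add: Vh_iff)

lemma Vh_add: "u \<in> Vh n \<Longrightarrow> v \<in> Vh n \<Longrightarrow> u + v \<in> Vh n"
  by (simp add: Vh_iff L_add V.M.scale_right_distrib)

lemma Vh_scale: "v \<in> Vh n \<Longrightarrow> sc a v \<in> Vh n"
  by (simp add: Vh_iff L_scale mult.commute)

lemma vac_Vh: "vac \<in> Vh 0"
  by (simp add: Vh_iff Lop_def creation)

text \<open>The Jacobi identity with \<open>l = 0\<close>, where each product keeps only its term
  \<open>i = 0\<close>. As the mode of \<open>om\<close> is nonnegative, the binomials on the right
  vanish beyond \<open>i = p\<close>.\<close>

lemma om_commutator:
  "Y om (int p) (Y u n v) = Y u n (Y om (int p) v)
     + (\<Sum>i\<le>p. sc (of_nat (p choose i)) (Y (Y om (int i) u) (int p + n - int i) v))"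
proof -
  obtain N1 where N1: "\<And>j. j \<ge> N1 \<Longrightarrow> Y u j v = 0" using V.YM_trunc by blast
  obtain N2 where N2: "\<And>j. j \<ge> N2 \<Longrightarrow> Y om j v = 0" using V.YM_trunc by blast
  obtain N3 where N3: "\<And>j. j \<ge> N3 \<Longrightarrow> Y om j u = 0" using V.YM_trunc by blast
  define I where "I = Suc (nat (max (max (N1 - n) N2) N3) + p)"
  have I: "int I > N1 - n" "int I > N2" "int I > N3" "I > p" "I > 0" by (auto simp: I_def)
  have "(\<Sum>i<I. sc ((-1) ^ i * (of_int 0 gchoose i)) (Y om (0 + int p - int i) (Y u (n + int i) v)))
     - (\<Sum>i<I. sc ((-1) powi (0 + int i) * (of_int 0 gchoose i)) (Y u (0 + n - int i) (Y om (int p + int i) v)))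
     = (\<Sum>i<I. sc (of_int (int p) gchoose i) (Y (Y om (0 + int i) u) (int p + n - int i) v))"
    by (rule V.YM_jacobi_sum) (use I N1 N2 N3 in auto)
  moreover have "(\<Sum>i<I. f i) = f 0" if "\<And>i. i > 0 \<Longrightarrow> f i = 0" for f :: "nat \<Rightarrow> 'v"
    using I(5) that by (subst sum.mono_neutral_right[of _ "{0}"]) auto
  moreover have "(\<Sum>i<I. sc (of_int (int p) gchoose i) (Y (Y om (0 + int i) u) (int p + n - int i) v))
     = (\<Sum>i\<le>p. sc (of_int (int p) gchoose i) (Y (Y om (0 + int i) u) (int p + n - int i) v))"
    by (rule sum.mono_neutral_right)
      (use I in \<open>auto simp: binomial_gbinomial[symmetric] binomial_eq_0\<close>)
  ultimately show ?thesis
    by (simp add: binomial_gbinomial gbinomial_0_left algebra_simps)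
qed

lemma L0_commutator: "L 0 (Y u n v) = Y u n (L 0 v) + Y (L 0 u) n v + sc (- of_int (n + 1)) (Y u n v)"
  using om_commutator[of 1 u n v] L_minus_1[of u "n + 1" v]
  by (simp add: Lop_def atMost_Suc add_ac)

text \<open>\<open>L 1\<close> is mode 2 of \<open>om\<close>, so the commutator involves
  \<open>L (-1) u\<close>, \<open>L 0 u\<close> and \<open>L 1 u\<close>; the first is rewritten by
  the derivative property.\<close>

lemma L1_commutator:
  "L 1 (Y u n v) = Y u n (L 1 v) + Y (L 1 u) n v + sc 2 (Y (L 0 u) (n + 1) v)
     + sc (- of_int (n + 2)) (Y u (n + 1) v)"
  using om_commutator[of 2 u n v] L_minus_1[of u "n + 2" v]
  by (simp add: Lop_def numeral_2_eq_2 atMost_Suc add_ac)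

lemma L1_commutator_Vh:
  assumes "u \<in> Vh h"
  shows "L 1 (Y u n v) = Y u n (L 1 v) + Y (L 1 u) n v + sc (of_int (2 * h - n - 2)) (Y u (n + 1) v)"
proof -
  have "L 0 u = sc (of_int h) u" using assms by (simp add: Vh_iff)
  thus ?thesis unfolding L1_commutator
    by (simp add: V.YM_scale_left add.assoc V.M.scale_left_distrib[symmetric])
qed

lemma Y_Vh:
  assumes "u \<in> Vh h" "v \<in> Vh g"
  shows "Y u n v \<in> Vh (h + g - n - 1)"
proof -
  have "L 0 u = sc (of_int h) u" "L 0 v = sc (of_int g) v" using assms by (auto simp: Vh_iff)
  thus ?thesis unfolding Vh_iff L0_commutator
    by (simp add: V.YM_scale_left V.YM_scale_right V.M.scale_left_distrib[symmetric])
qed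

lemma L1_Vh:
  assumes "v \<in> Vh n"
  shows "L 1 v \<in> Vh (n - 1)"
proof -
  have "L 0 (L 1 v) = L 1 (L 0 v) - L 1 v" using L0_L1[of v] by (simp add: algebra_simps)
  thus ?thesis using assms by (simp add: Vh_iff L_scale V.M.scale_left_diff_distrib)
qed

text \<open>The coefficients of \<open>e^(x L(1))\<close>. With divided powers the induction for
  \<open>D_Y\<close> has coefficients linear in the indices.\<close>

definition D :: "nat \<Rightarrow> 'v \<Rightarrow> 'v" where
  "D k v = sc (1 / fact k) ((L 1 ^^ k) v)"

lemma L1_pow_add: "(L 1 ^^ k) (u + v) = (L 1 ^^ k) u + (L 1 ^^ k) v"
  by (induction k) (auto simp: L_add)

lemma L1_pow_Vh: "v \<in> Vh n \<Longrightarrow> (L 1 ^^ k) v \<in> Vh (n - int k)"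
proof (induction k)
  case (Suc k)
  thus ?case using L1_Vh[of "(L 1 ^^ k) v" "n - int k"] by (simp add: algebra_simps)
qed auto

lemma L1_pow_zero [simp]: "(L 1 ^^ k) 0 = 0"
  by (induction k) auto

lemma L1_nilpotent:
  assumes "v \<in> Vh n"
  shows "\<exists>K. \<forall>k\<ge>K. (L 1 ^^ k) v = 0"
proof -
  obtain N where N: "\<And>n. n < N \<Longrightarrow> Vh n = {0}" using Vh_bounded_below by blast
  have "(L 1 ^^ k) v = 0" if "k \<ge> nat (n - N + 1)" for k
    using N[of "n - int k"] L1_pow_Vh[OF assms, of k] that by auto
  thus ?thesis by blast
qed

lemma D_0 [simp]: "D 0 v = v"
  by (simp add: D_def)

lemma L1_D: "L 1 (D k v) = sc (of_nat (Suc k)) (D (Suc k) v)"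
  by (simp add: D_def L_scale del: of_nat_Suc)

lemma D_Suc: "D (Suc k) v = sc (1 / of_nat (Suc k)) (L 1 (D k v))"
  unfolding L1_D by (simp del: of_nat_Suc)

lemma D_Vh: "v \<in> Vh n \<Longrightarrow> D k v \<in> Vh (n - int k)"
  unfolding D_def by (intro Vh_scale L1_pow_Vh)

lemma D_nilpotent: "v \<in> Vh n \<Longrightarrow> \<exists>K. \<forall>k\<ge>K. D k v = 0"
  using L1_nilpotent[of v n] by (auto simp: D_def)

text \<open>The coefficient comparison in the induction step of \<open>D_Y\<close>: the triple
  \<open>(r, t, c)\<close> is reached by raising \<open>r\<close>, \<open>c\<close> or
  \<open>t\<close> by one. The upper index \<open>N + 1\<close> belongs to the predecessor with
  \<open>r - 1\<close>.\<close>

lemma gbinomial_L1_recurrence: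
  fixes N :: complex
  shows "of_nat r * ((N + 1) gchoose c)
     + (case c of 0 \<Rightarrow> 0 | Suc c' \<Rightarrow> (N - of_nat r - of_nat c') * (N gchoose c')) + of_nat t * (N gchoose c)
     = of_nat (r + t + c) * (N gchoose c)"
proof (cases c)
  case (Suc c')
  have "N * (N gchoose c') = of_nat c' * (N gchoose c') + of_nat (Suc c') * (N gchoose Suc c')"
    by (rule gbinomial_mult_1)
  moreover have "(N + 1) gchoose Suc c' = (N gchoose c') + (N gchoose Suc c')"
    by (rule gbinomial_Suc_Suc)
  ultimately show ?thesis by (simp only: Suc nat.case of_nat_add ring_distribs) (simp add: algebra_simps)
qed (simp add: algebra_simps)

text \<open>Coefficient form of
  exp(x L(1)) Y(u,y) exp(-x L(1)) = Y(exp(x(1-xy) L(1)) (1-xy)^(-2 L(0)) u, y/(1-xy)).\<close>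

lemma D_Y:
  assumes u: "u \<in> Vh h"
  shows "D k (Y u n v) = (\<Sum>(r, t, c)\<in>triples k.
     sc (of_int (2 * h - int r - n - 2) gchoose c) (Y (D r u) (n + int c) (D t v)))"
proof (induction k)
  case 0
  show ?case by (simp add: triples_0)
next
  case (Suc k)
  define X where "X r t c = Y (D r u) (n + int c) (D t v)" for r t c :: nat
  define N :: "nat \<Rightarrow> complex" where "N r = of_int (2 * h - int r - n - 2)" for r
  have nSuc: "n + int (Suc c) = n + int c + 1" for c by simp
  \<comment> \<open>After the two terms with an unchanged vector \<open>D r u\<close> are merged,
    each term raises exactly one index; the middle coefficient is
    \<open>2 * (h - r) - (n + c) - 2\<close>, since \<open>D r u\<close> has weight
    \<open>h - r\<close>.\<close>
  have L1X: "L 1 (X r t c) = sc (of_nat (Suc r)) (X (Suc r) t c)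
     + sc (N r - of_nat r - of_nat c) (X r t (Suc c)) + sc (of_nat (Suc t)) (X r (Suc t) c)" for r t c
    unfolding X_def L1_commutator_Vh[OF D_Vh[OF u]] L1_D N_def nSuc
    by (simp add: V.YM_scale_left V.YM_scale_right algebra_simps del: of_nat_Suc)
  define f1 where "f1 r t c = sc (of_nat r * ((N r + 1) gchoose c)) (X r t c)" for r t c
  define f2 where "f2 r t c = sc (case c of 0 \<Rightarrow> 0 | Suc c' \<Rightarrow> (N r - of_nat r - of_nat c') * (N r gchoose c')) (X r t c)" for r t c
  define f3 where "f3 r t c = sc (of_nat t * (N r gchoose c)) (X r t c)" for r t c
  have NS: "N (Suc r) + 1 = N r" for r by (simp add: N_def)
  have "L 1 (D k (Y u n v)) = (\<Sum>(r, t, c)\<in>triples k. sc (N r gchoose c) (L 1 (X r t c)))"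
    unfolding Suc.IH L_sum by (intro sum.cong refl) (auto simp: L_scale N_def X_def)
  also have "\<dots> = (\<Sum>(r, t, c)\<in>triples k. f1 (Suc r) t c + f2 r t (Suc c) + f3 r (Suc t) c)"
    unfolding L1X f1_def f2_def f3_def NS
    by (intro sum.cong refl) (auto simp: V.M.scale_right_distrib mult.commute)
  also have "\<dots> = (\<Sum>(r, t, c)\<in>triples k. f1 (Suc r) t c) + (\<Sum>(r, t, c)\<in>triples k. f2 r t (Suc c))
       + (\<Sum>(r, t, c)\<in>triples k. f3 r (Suc t) c)"
    by (simp only: case_prod_unfold sum.distrib)
  also have "\<dots> = (\<Sum>(r, t, c)\<in>triples (Suc k). f1 r t c) + (\<Sum>(r, t, c)\<in>triples (Suc k). f2 r t c)
       + (\<Sum>(r, t, c)\<in>triples (Suc k). f3 r t c)"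
    by (subst sum_triples_shift1, simp add: f1_def, subst sum_triples_shift3, simp add: f2_def,
        subst sum_triples_shift2, simp add: f3_def, rule refl)
  also have "\<dots> = (\<Sum>(r, t, c)\<in>triples (Suc k). f1 r t c + f2 r t c + f3 r t c)"
    by (simp only: case_prod_unfold sum.distrib)
  also have "\<dots> = (\<Sum>(r, t, c)\<in>triples (Suc k). sc (of_nat (Suc k)) (sc (N r gchoose c) (X r t c)))"
  proof (intro sum.cong refl, clarify)
    fix r t c assume "(r, t, c) \<in> triples (Suc k)"
    hence "r + t + c = Suc k" by (simp add: triples_def)
    thus "f1 r t c + f2 r t c + f3 r t c = sc (of_nat (Suc k)) (sc (N r gchoose c) (X r t c))"
      unfolding f1_def f2_def f3_def V.M.scale_left_distrib[symmetric] gbinomial_L1_recurrence by simp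
  qed
  also have "\<dots> = sc (of_nat (Suc k)) (\<Sum>(r, t, c)\<in>triples (Suc k). sc (N r gchoose c) (X r t c))"
    by (simp only: case_prod_unfold V.M.scale_sum_right)
  finally show ?case
    unfolding D_Suc N_def X_def by (simp del: of_nat_Suc)
qed

end

section \<open>Opposite vertex operators\<close>

context voa
begin

text \<open>Subtracting \<open>k\<close> times the relation from its image under \<open>L 0\<close>
  removes the term of weight \<open>k\<close>. This independence makes the definite description in
  \<open>proj\<close> unique.\<close>

lemma Vh_independent:
  assumes "finite S" "\<And>n. n \<in> S \<Longrightarrow> f n \<in> Vh n" "sum f S = 0" "n \<in> S"
  shows "f n = 0"
  using assms
proof (induction S arbitrary: f n rule: finite_induct)
  case (insert k S)
  have eig: "L 0 (f n) = sc (of_int n) (f n)" if "n \<in> insert k S" for n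
    using insert.prems(1)[OF that] by (simp add: Vh_iff)
  have "f k + sum f S = 0" using insert by simp
  moreover from arg_cong[OF this, of "L 0"]
  have "sc (of_int k) (f k) + (\<Sum>n\<in>S. sc (of_int n) (f n)) = 0"
    using eig by (simp add: L_add L_sum)
  ultimately have "(\<Sum>n\<in>S. sc (of_int n) (f n)) - sc (of_int k) (sum f S) = 0"
    by (metis V.M.scale_minus_right add_eq_0_iff diff_self)
  hence sum0: "(\<Sum>n\<in>S. sc (of_int (n - k)) (f n)) = 0"
    by (simp add: V.M.scale_sum_right V.M.scale_left_diff_distrib sum_subtractf)
  have S0: "f n = 0" if "n \<in> S" for n
  proof -
    have "sc (of_int (n - k)) (f n) = 0"
      by (rule insert.IH[OF _ sum0 that]) (use insert.prems(1) in \<open>auto intro: Vh_scale\<close>)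
    moreover have "n \<noteq> k" using that insert.hyps by auto
    ultimately show ?thesis by (simp add: V.M.scale_eq_0_iff)
  qed
  thus ?case using insert.prems \<open>f k + sum f S = 0\<close> by auto
qed simp

abbreviation "Pr \<equiv> proj sc Y om"

lemma proj_eqI:
  assumes S: "finite S" "\<And>k. k \<notin> S \<Longrightarrow> f k = 0" and f: "\<And>k. f k \<in> Vh k" and v: "v = sum f S"
  shows "Pr n v = f n"
  unfolding proj_def
proof (rule the_equality)
  have "{k. f k \<noteq> 0} \<subseteq> S" using S by blast
  moreover from this have "sum f S = sum f {k. f k \<noteq> 0}"
    using S by (intro sum.mono_neutral_right) auto
  ultimately show "\<exists>f'. finite {k. f' k \<noteq> 0} \<and> (\<forall>k. f' k \<in> Vh k) \<and> v = sum f' {k. f' k \<noteq> 0} \<and> f n = f' n"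
    using S f v by (intro exI[of _ f]) (auto intro: finite_subset)
next
  fix x assume "\<exists>f'. finite {k. f' k \<noteq> 0} \<and> (\<forall>k. f' k \<in> Vh k) \<and> v = sum f' {k. f' k \<noteq> 0} \<and> x = f' n"
  then obtain f' where f': "finite {k. f' k \<noteq> 0}" "\<And>k. f' k \<in> Vh k" "v = sum f' {k. f' k \<noteq> 0}" "x = f' n"
    by blast
  define U where "U = insert n (S \<union> {k. f' k \<noteq> 0})"
  have U: "finite U" "S \<subseteq> U" "{k. f' k \<noteq> 0} \<subseteq> U" "n \<in> U" using S f' by (auto simp: U_def)
  have "v = sum f U" unfolding v using U S by (intro sum.mono_neutral_left) auto
  moreover have "v = sum f' U" using U unfolding f'(3) by (intro sum.mono_neutral_left) auto
  ultimately have "(\<Sum>k\<in>U. f' k + sc (-1) (f k)) = 0"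
    by (simp add: sum_subtractf)
  hence "f' n + sc (-1) (f n) = 0"
    using Vh_independent[OF U(1), of "\<lambda>k. f' k + sc (-1) (f k)" n] U(4) Vh_add Vh_scale f f'(2) by blast
  thus "x = f n" using f'(4) by simp
qed

lemma proj_decomp:
  shows finite_proj: "finite {n. Pr n v \<noteq> 0}" and proj_Vh: "Pr n v \<in> Vh n"
    and sum_proj: "v = (\<Sum>n | Pr n v \<noteq> 0. Pr n v)"
proof -
  obtain f where f: "finite {n. f n \<noteq> 0}" "\<And>n. f n \<in> Vh n" "v = sum f {n. f n \<noteq> 0}"
    using grading[of v] by blast
  have "Pr n v = f n" for n
    by (rule proj_eqI[OF f(1) _ f(2,3)]) auto
  thus "finite {n. Pr n v \<noteq> 0}" "Pr n v \<in> Vh n" "v = (\<Sum>n | Pr n v \<noteq> 0. Pr n v)"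
    using f by auto
qed

lemma proj_add: "Pr n (u + v) = Pr n u + Pr n v"
proof (rule proj_eqI[of "{n. Pr n u \<noteq> 0} \<union> {n. Pr n v \<noteq> 0}"])
  have "u = (\<Sum>n\<in>{n. Pr n u \<noteq> 0} \<union> {n. Pr n v \<noteq> 0}. Pr n u)"
    by (subst sum_proj, rule sum.mono_neutral_left) (auto simp: finite_proj)
  moreover have "v = (\<Sum>n\<in>{n. Pr n u \<noteq> 0} \<union> {n. Pr n v \<noteq> 0}. Pr n v)"
    by (subst sum_proj, rule sum.mono_neutral_left) (auto simp: finite_proj)
  ultimately show "u + v = (\<Sum>n\<in>{n. Pr n u \<noteq> 0} \<union> {n. Pr n v \<noteq> 0}. Pr n u + Pr n v)"
    by (simp add: sum.distrib)
qed (auto simp: finite_proj intro: Vh_add proj_Vh)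

lemma proj_scale: "Pr n (sc a v) = sc a (Pr n v)"
proof (rule proj_eqI[of "{n. Pr n v \<noteq> 0}"])
  show "sc a v = (\<Sum>n | Pr n v \<noteq> 0. sc a (Pr n v))"
    using arg_cong[OF sum_proj[of v], of "sc a"] by (simp add: V.M.scale_sum_right)
qed (auto simp: finite_proj intro: Vh_scale proj_Vh)

lemma proj_homogeneous:
  assumes "v \<in> Vh g"
  shows "Pr n v = (if n = g then v else 0)"
  by (rule proj_eqI[of "{g}"]) (use assms in auto)

lemma homogeneous_induct:
  assumes "\<And>n v. v \<in> Vh n \<Longrightarrow> P v" "\<And>u v. P u \<Longrightarrow> P v \<Longrightarrow> P (u + v)"
  shows "P v"
proof -
  have "P (sum f S)" if "finite S" "\<And>n. f n \<in> Vh n" for f S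
    using that by (induction S rule: finite_induct) (auto intro: assms(2) assms(1)[of _ "_ :: int"] assms(1)[OF Vh_zero])
  thus ?thesis using grading[of v] by metis
qed

end

section \<open>Modes of the opposite vertex operators and their Jacobi identity\<close>

locale voa_mod = voa sc Y vac om + W: weak_mod sc Y vac sw YW
  for sc :: "complex \<Rightarrow> 'v::ab_group_add \<Rightarrow> 'v" and Y :: "'v \<Rightarrow> int \<Rightarrow> 'v \<Rightarrow> 'v" and vac om :: 'v
    and sw :: "complex \<Rightarrow> 'w::ab_group_add \<Rightarrow> 'w" and YW :: "'v \<Rightarrow> int \<Rightarrow> 'w \<Rightarrow> 'w"
begin

abbreviation "Yo \<equiv> Yo_coeff sc Y om sw YW"

definition Yo_weight :: "int \<Rightarrow> 'v \<Rightarrow> int \<Rightarrow> 'w \<Rightarrow> 'w" where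
  "Yo_weight n x j w = fsum (\<lambda>k::nat.
     sw ((-1) powi n / fact k) (YW ((L 1 ^^ k) x) (j + 2 * n - int k - 1) w))"

lemma Yo_weight_zero [simp]: "Yo_weight n 0 j w = 0"
  by (simp add: Yo_weight_def)

lemma finite_Yo_weight:
  assumes "x \<in> Vh n"
  shows "finite {k. sw ((-1) powi n / fact k) (YW ((L 1 ^^ k) x) (j + 2 * n - int k - 1) w) \<noteq> 0}"
proof -
  obtain K where "\<And>k. k \<ge> K \<Longrightarrow> (L 1 ^^ k) x = 0" using L1_nilpotent[OF assms] by blast
  thus ?thesis by (intro finite_support_nat[of K]) simp
qed

lemma Yo_weight_add:
  assumes "x \<in> Vh n" "y \<in> Vh n"
  shows "Yo_weight n (x + y) j w = Yo_weight n x j w + Yo_weight n y j w"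
  unfolding Yo_weight_def
  by (subst fsum_add[symmetric, OF finite_Yo_weight[OF assms(1)] finite_Yo_weight[OF assms(2)]])
     (simp add: L1_pow_add W.YM_add_left W.M.scale_right_distrib)

lemma L1_pow_scale: "(L 1 ^^ k) (sc a v) = sc a ((L 1 ^^ k) v)"
  by (induction k) (auto simp: L_scale)

lemma fsum_scale: "fsum (\<lambda>i. sw a (f i)) = sw a (fsum f)"
proof (cases "a = 0")
  case False
  hence "{i. sw a (f i) \<noteq> 0} = {i. f i \<noteq> 0}" by (auto simp: W.M.scale_eq_0_iff)
  thus ?thesis by (simp add: fsum_def W.M.scale_sum_right)
qed simp

lemma Yo_weight_scale: "Yo_weight n (sc a x) j w = sw a (Yo_weight n x j w)"
  unfolding Yo_weight_def
  by (subst fsum_scale[symmetric]) (simp add: L1_pow_scale W.YM_scale_left mult.commute)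

lemma Yo_eq: "Yo v j w = fsum (\<lambda>n. Yo_weight n (Pr n v) j w)"
  by (simp add: Yo_coeff_def Yo_weight_def)

lemma finite_Yo: "finite {n. Yo_weight n (Pr n v) j w \<noteq> 0}"
  by (rule finite_subset[OF _ finite_proj[of v]]) auto

lemma Yo_add_left: "Yo (u + v) j w = Yo u j w + Yo v j w"
  unfolding Yo_eq
  by (subst fsum_add[symmetric, OF finite_Yo finite_Yo])
     (simp add: proj_add Yo_weight_add proj_Vh)

lemma Yo_scale_left: "Yo (sc a v) j w = sw a (Yo v j w)"
  unfolding Yo_eq by (simp add: proj_scale Yo_weight_scale fsum_scale)

lemma Yo_zero_left [simp]: "Yo 0 j w = 0"
  using Yo_scale_left[of 0 0 j w] by simp

lemma Yo_homogeneous: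
  assumes v: "v \<in> Vh g" and K: "\<And>k. k \<ge> K \<Longrightarrow> D k v = 0"
  shows "Yo v j w = (\<Sum>k<K. sw ((-1) powi g) (YW (D k v) (j + 2 * g - int k - 1) w))"
proof -
  have "Yo v j w = Yo_weight g v j w"
    unfolding Yo_eq by (subst fsum_eq_sum[of "{g}"]) (auto simp: proj_homogeneous[OF v])
  also have "\<dots> = fsum (\<lambda>k. sw ((-1) powi g) (YW (D k v) (j + 2 * g - int k - 1) w))"
    by (simp add: Yo_weight_def D_def W.YM_scale_left)
  also have "\<dots> = (\<Sum>k<K. sw ((-1) powi g) (YW (D k v) (j + 2 * g - int k - 1) w))"
    by (rule fsum_nat_eq_sum) (simp add: K)
  finally show ?thesis .
qed

lemma Yo_add_right: "Yo v j (w + w') = Yo v j w + Yo v j w'"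
proof (induction v rule: homogeneous_induct)
  case (1 n v)
  then obtain K where "\<And>k. k \<ge> K \<Longrightarrow> D k v = 0" using D_nilpotent by blast
  from Yo_homogeneous[OF 1 this] show ?case
    by (simp add: W.YM_add_right W.M.scale_right_distrib sum.distrib)
next
  case (2 u v)
  thus ?case by (simp add: Yo_add_left)
qed

lemma Yo_scale_right: "Yo v j (sw a w) = sw a (Yo v j w)"
proof (induction v rule: homogeneous_induct)
  case (1 n v)
  then obtain K where "\<And>k. k \<ge> K \<Longrightarrow> D k v = 0" using D_nilpotent by blast
  from Yo_homogeneous[OF 1 this] show ?case
    by (simp add: W.YM_scale_right W.M.scale_sum_right mult.commute)
next
  case (2 u v)
  thus ?case by (simp add: Yo_add_left W.M.scale_right_distrib)
qed

lemma Yo_zero_right [simp]: "Yo v j 0 = 0"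
  using Yo_scale_right[of v j 0 0] by simp

text \<open>The mode \<open>j + 2 * n - int k - 1\<close> grows with the exponent \<open>j\<close>,
  so truncation of \<open>YW\<close> bounds exponents from above; only finitely many
  \<open>D k v\<close> occur.\<close>

lemma Yo_trunc: "\<exists>N. \<forall>j>N. Yo v j w = 0"
proof (induction v rule: homogeneous_induct)
  case (1 n v)
  then obtain K where K: "\<And>k. k \<ge> K \<Longrightarrow> D k v = 0" using D_nilpotent by blast
  obtain N where N: "\<And>k m. k < K \<Longrightarrow> m \<ge> N \<Longrightarrow> YW (D k v) m w = 0"
    using W.YM_trunc_finite[of "(\<lambda>k. D k v) ` {..<K}" w] by auto
  have "Yo v j w = 0" if "j > N - 2 * n + int K + 1" for j
    by (subst Yo_homogeneous[OF 1, of K], rule K, assumption, rule sum.neutral) (use N that in auto)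
  thus ?case by blast
next
  case (2 u v)
  then obtain N1 N2 where "\<forall>j>N1. Yo u j w = 0" "\<forall>j>N2. Yo v j w = 0" by blast
  thus ?case by (intro exI[of _ "max N1 N2"]) (auto simp: Yo_add_left)
qed

lemma Yo_vac: "Yo vac j w = (if j = 0 then w else 0)"
proof -
  have "L 1 vac = 0" by (simp add: Lop_def creation)
  hence "(L 1 ^^ k) vac = 0" if "k > 0" for k
    using that by (cases k) (auto simp: funpow_Suc_right simp del: funpow.simps)
  hence "D k vac = 0" if "k \<ge> 1" for k
    using that by (simp add: D_def)
  from Yo_homogeneous[OF vac_Vh this] show ?thesis by (simp add: W.YM_vac)
qed

text \<open>Indices are exponents here, not modes: \<open>Yo v j\<close> is the coefficient of \<open>x\<^sup>j\<close>.\<close>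

definition opp_jacobi :: "'v \<Rightarrow> 'v \<Rightarrow> bool" where
  "opp_jacobi u v \<longleftrightarrow> (\<forall>l a b w.
     fsum (\<lambda>i::nat. sw ((-1) ^ i * (of_int l gchoose i)) (Yo v (b - int i) (Yo u (a - l + int i) w)))
     - fsum (\<lambda>i::nat. sw ((-1) powi l * ((-1) ^ i * (of_int l gchoose i))) (Yo u (a - int i) (Yo v (b - l + int i) w)))
     = fsum (\<lambda>i::nat. sw (of_int (- a - 1) gchoose i) (Yo (Y u (l + int i) v) (a + b + 1 + int i) w)))"

lemma Yo_shift_trunc: "\<exists>N. \<forall>i\<ge>N. Yo u (a + int i) w = 0"
proof -
  obtain N where "\<And>j. j > N \<Longrightarrow> Yo u j w = 0" using Yo_trunc by blast
  thus ?thesis by (intro exI[of _ "nat (N - a + 1)"]) auto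
qed

lemma Y_shift_trunc: "\<exists>N. \<forall>i\<ge>N. Y u (a + int i) w = 0"
proof -
  obtain N where "\<And>j. j \<ge> N \<Longrightarrow> Y u j w = 0" using V.YM_trunc by blast
  thus ?thesis by (intro exI[of _ "nat (N - a)"]) auto
qed

lemma opp_jacobi_finite:
  shows "finite {i. sw (c i) (Yo v (b' i) (Yo u (a + int i) w)) \<noteq> 0}"
    and "finite {i. sw (c i) (Yo (Y u (l + int i) v) (b' i) w) \<noteq> 0}"
proof -
  obtain N where "\<And>i. i \<ge> N \<Longrightarrow> Yo u (a + int i) w = 0" using Yo_shift_trunc by blast
  thus "finite {i. sw (c i) (Yo v (b' i) (Yo u (a + int i) w)) \<noteq> 0}"
    by (intro finite_support_nat[of N]) simp
  obtain N where "\<And>i. i \<ge> N \<Longrightarrow> Y u (l + int i) v = 0" using Y_shift_trunc by blast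
  thus "finite {i. sw (c i) (Yo (Y u (l + int i) v) (b' i) w) \<noteq> 0}"
    by (intro finite_support_nat[of N]) simp
qed

lemma opp_jacobi_add_left:
  assumes "opp_jacobi u v" "opp_jacobi u' v"
  shows "opp_jacobi (u + u') v"
  unfolding opp_jacobi_def
  by (simp only: Yo_add_left Yo_add_right V.YM_add_left W.M.scale_right_distrib fsum_add opp_jacobi_finite
        add_diff_add assms[unfolded opp_jacobi_def, rule_format]) simp

lemma opp_jacobi_add_right:
  assumes "opp_jacobi u v" "opp_jacobi u v'"
  shows "opp_jacobi u (v + v')"
  unfolding opp_jacobi_def
  by (simp only: Yo_add_left Yo_add_right V.YM_add_right W.M.scale_right_distrib fsum_add opp_jacobi_finite
        add_diff_add assms[unfolded opp_jacobi_def, rule_format]) simp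

text \<open>Every \<open>Yo\<close> expands into modes of the divided powers. The left-hand side
  reduces, for each pair \<open>D r u\<close>, \<open>D t v\<close>, to the Jacobi identity of
  \<open>YW\<close>; on the right \<open>D_Y\<close> introduces an extra sum over \<open>c\<close>,
  which \<open>gbinomial_alternating_convolution\<close> absorbs.\<close>

lemma opp_jacobi_homogeneous:
  assumes u: "u \<in> Vh h" and v: "v \<in> Vh g"
  shows "opp_jacobi u v"
  unfolding opp_jacobi_def
proof (intro allI)
  fix l a b :: int and w :: 'w
  obtain K1 where K1: "\<And>k. k \<ge> K1 \<Longrightarrow> D k u = 0" using D_nilpotent[OF u] by blast
  obtain K2 where K2: "\<And>k. k \<ge> K2 \<Longrightarrow> D k v = 0" using D_nilpotent[OF v] by blast
  define K where "K = max K1 K2"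
  have Ku: "D k u = 0" and Kv: "D k v = 0" if "k \<ge> K" for k
    using K1 K2 that by (auto simp: K_def)
  \<comment> \<open>The modes of \<open>D r u\<close> and \<open>D t v\<close> that occur in
    \<open>Yo u (a - l)\<close> and \<open>Yo v (b - l)\<close>; raising the exponent by
    \<open>i\<close> raises the mode by \<open>i\<close>.\<close>
  define p where "p r = a - l + 2 * h - int r - 1" for r
  define q where "q t = b - l + 2 * g - int t - 1" for t
  obtain N1 where N1: "\<And>r n. r < K \<Longrightarrow> n \<ge> N1 \<Longrightarrow> YW (D r u) n w = 0"
    using W.YM_trunc_finite[of "(\<lambda>k. D k u) ` {..<K}" w] by auto
  obtain N2 where N2: "\<And>t n. t < K \<Longrightarrow> n \<ge> N2 \<Longrightarrow> YW (D t v) n w = 0"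
    using W.YM_trunc_finite[of "(\<lambda>k. D k v) ` {..<K}" w] by auto
  have "\<forall>t. \<exists>N. \<forall>r n. r < K \<longrightarrow> n \<ge> N \<longrightarrow> Y (D r u) n (D t v) = 0"
    using V.YM_trunc_finite[of "(\<lambda>k. D k u) ` {..<K}"] by fastforce
  then obtain N3 where N3: "\<And>t r n. r < K \<Longrightarrow> n \<ge> N3 t \<Longrightarrow> Y (D r u) n (D t v) = 0" by metis
  \<comment> \<open>A common cutoff for all sums over \<open>i\<close>. As \<open>p\<close> and
    \<open>q\<close> decrease in their argument, \<open>p K\<close> and \<open>q K\<close> lie below
    all values that matter.\<close>
  define I where "I = nat (max (max (N1 - p K) (N2 - q K)) (Max (insert 0 (N3 ` {..<K})) - l))"
  have IN: "N1 - p K \<le> int I" "N2 - q K \<le> int I" "Max (insert 0 (N3 ` {..<K})) - l \<le> int I"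
    unfolding I_def by linarith+
  have Iu: "YW (D r u) (p r + int i) w = 0" if "i \<ge> I" for r i
  proof (cases "r < K")
    case True
    have "N1 \<le> p r + int i" using IN(1) True that by (simp add: p_def)
    thus ?thesis using N1[OF True] by blast
  qed (use Ku in simp)
  have Iv: "YW (D t v) (q t + int i) w = 0" if "i \<ge> I" for t i
  proof (cases "t < K")
    case True
    have "N2 \<le> q t + int i" using IN(2) True that by (simp add: q_def)
    thus ?thesis using N2[OF True] by blast
  qed (use Kv in simp)
  have Iuv: "Y (D r u) (l + int i) (D t v) = 0" if "i \<ge> I" for r t i
  proof (cases "r < K \<and> t < K")
    case True
    hence "N3 t \<le> Max (insert 0 (N3 ` {..<K}))" by (intro Max_ge) auto
    hence "N3 t \<le> l + int i" using IN(3) that by simp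
    thus ?thesis using N3 True by blast
  next
    case False
    hence "D r u = 0 \<or> D t v = 0" using Ku[of r] Kv[of t] by linarith
    thus ?thesis by auto
  qed
  define S :: complex where "S = (-1) powi h * (-1) powi g"
  define e :: complex where "e = (-1) powi l"
  have ee: "e * e = 1" by (simp add: e_def power_int_mult_distrib[symmetric])
  define A where "A r t i = YW (D t v) (l + q t - int i) (YW (D r u) (p r + int i) w)" for r t i
  define B where "B r t i = YW (D r u) (l + p r - int i) (YW (D t v) (q t + int i) w)" for r t i
  define Z where "Z r t i = YW (Y (D r u) (l + int i) (D t v)) (p r + q t - int i) w" for r t i
  have Z0: "Z r t j = 0" if "j \<ge> I" for r t j using Iuv[OF that] by (simp add: Z_def)
  have pull: "(\<Sum>i<I. sw (c i) (sw S (\<Sum>r<K. \<Sum>t<K. X r t i)))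
      = sw S (\<Sum>r<K. \<Sum>t<K. \<Sum>i<I. sw (c i) (X r t i))" for c X
  proof -
    have "(\<Sum>i<I. sw (c i) (sw S (\<Sum>r<K. \<Sum>t<K. X r t i)))
       = sw S (\<Sum>i<I. \<Sum>r<K. \<Sum>t<K. sw (c i) (X r t i))"
      by (simp only: W.M.scale_sum_right W.M.scale_scale mult.commute)
    also have "(\<Sum>i<I. \<Sum>r<K. \<Sum>t<K. sw (c i) (X r t i)) = (\<Sum>r<K. \<Sum>i<I. \<Sum>t<K. sw (c i) (X r t i))"
      by (rule sum.swap)
    also have "\<dots> = (\<Sum>r<K. \<Sum>t<K. \<Sum>i<I. sw (c i) (X r t i))"
      by (intro sum.cong refl sum.swap)
    finally show ?thesis .
  qed
  have Yo_u: "Yo u j x = (\<Sum>k<K. sw ((-1) powi h) (YW (D k u) (j + 2 * h - int k - 1) x))" for j x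
    by (rule Yo_homogeneous[OF u]) (fact Ku)
  have Yo_v: "Yo v j x = (\<Sum>k<K. sw ((-1) powi g) (YW (D k v) (j + 2 * g - int k - 1) x))" for j x
    by (rule Yo_homogeneous[OF v]) (fact Kv)
  have YoA: "Yo v (b - int i) (Yo u (a - l + int i) w) = sw S (\<Sum>r<K. \<Sum>t<K. A r t i)" for i
  proof -
    have "Yo v (b - int i) (Yo u (a - l + int i) w) = (\<Sum>t<K. \<Sum>r<K. sw S (A r t i))"
      unfolding Yo_v Yo_u A_def S_def p_def q_def
      by (simp add: W.YM_sum_right W.YM_scale_right W.M.scale_sum_right algebra_simps)
    also have "\<dots> = (\<Sum>r<K. \<Sum>t<K. sw S (A r t i))" by (rule sum.swap)
    finally show ?thesis by (simp add: W.M.scale_sum_right)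
  qed
  have YoB: "Yo u (a - int i) (Yo v (b - l + int i) w) = sw S (\<Sum>r<K. \<Sum>t<K. B r t i)" for i
    unfolding Yo_v Yo_u B_def S_def p_def q_def
    by (simp add: W.YM_sum_right W.YM_scale_right W.M.scale_sum_right algebra_simps)
  \<comment> \<open>Multiplying the Jacobi identity of \<open>YW\<close> by \<open>- e\<close>
    interchanges the two products, because \<open>e * e = 1\<close>.\<close>
  have jac: "(\<Sum>i<I. sw ((-1) ^ i * (of_int l gchoose i)) (A r t i))
      - (\<Sum>i<I. sw (e * ((-1) ^ i * (of_int l gchoose i))) (B r t i))
      = sw (- e) (\<Sum>i<I. sw (of_int (p r) gchoose i) (Z r t i))" for r t
  proof -
    have "(\<Sum>i<I. sw ((-1) ^ i * (of_int l gchoose i)) (B r t i))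
      - (\<Sum>i<I. sw ((-1) powi (l + int i) * (of_int l gchoose i)) (A r t i))
      = (\<Sum>i<I. sw (of_int (p r) gchoose i) (Z r t i))"
      unfolding A_def B_def Z_def by (rule W.YM_jacobi_sum) (auto simp: Iu Iv Iuv)
    hence "sw (- e) (\<Sum>i<I. sw (of_int (p r) gchoose i) (Z r t i))
      = (\<Sum>i<I. sw (e * ((-1) powi (l + int i) * (of_int l gchoose i))) (A r t i))
        - (\<Sum>i<I. sw (e * ((-1) ^ i * (of_int l gchoose i))) (B r t i))"
      by (simp add: W.M.scale_right_diff_distrib W.M.scale_sum_right sum_negf flip: \<open>_ = (\<Sum>i<I. sw (of_int (p r) gchoose i) (Z r t i))\<close>)
    moreover have "e * ((-1) powi (l + int i) * x) = (-1) ^ i * x" for i x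
      using ee by (simp add: power_int_add e_def[symmetric] mult.assoc[symmetric])
    ultimately show ?thesis by simp
  qed
  have Yuv: "Yo (Y u (l + int i) v) (a + b + 1 + int i) w
      = sw S (\<Sum>r<K. \<Sum>t<K. \<Sum>c<I. sw (- e * (-1) ^ i * (of_int (2 * h - int r - (l + int i) - 2) gchoose c)) (Z r t (i + c)))" for i
  proof -
    define m where "m = h + g - (l + int i) - 1"
    have m: "Y u (l + int i) v \<in> Vh m" unfolding m_def using u v by (rule Y_Vh)
    have Zm: "YW (Y (D r u) (l + int i + int c) (D t v)) (a + b + 1 + int i + 2 * m - int k - 1) w = Z r t (i + c)"
      if "(r, t, c) \<in> triples k" for r t c k
    proof -
      have "a + b + 1 + int i + 2 * m - int k - 1 = p r + q t - int (i + c)"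
        using that by (simp add: triples_def p_def q_def m_def)
      moreover have "l + int i + int c = l + int (i + c)" by simp
      ultimately show ?thesis by (simp only: Z_def)
    qed
    have D0: "D k (Y u (l + int i) v) = 0" if "k \<ge> 2 * K + I" for k
      unfolding D_Y[OF u]
    proof (rule sum.neutral, clarify)
      fix r t c assume "(r, t, c) \<in> triples k"
      hence "r \<ge> K \<or> t \<ge> K \<or> c \<ge> I" using that by (auto simp: triples_def)
      thus "sc (of_int (2 * h - int r - (l + int i) - 2) gchoose c) (Y (D r u) (l + int i + int c) (D t v)) = 0"
        using Ku Kv Iuv[of "i + c" r t] by (auto simp: add.assoc)
    qed
    have "Yo (Y u (l + int i) v) (a + b + 1 + int i) w
      = (\<Sum>k<2*K+I. \<Sum>(r, t, c)\<in>triples k. sw ((-1) powi m)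
           (sw (of_int (2 * h - int r - (l + int i) - 2) gchoose c) (Z r t (i + c))))"
      by (subst Yo_homogeneous[OF m, of "2 * K + I"], rule D0, assumption,
          unfold D_Y[OF u] W.YM_sum_left W.M.scale_sum_right, intro sum.cong refl)
        (clarify, simp only: prod.case W.YM_scale_left Zm)
    also have "\<dots> = (\<Sum>r<K. \<Sum>t<K. \<Sum>c<I. sw ((-1) powi m)
           (sw (of_int (2 * h - int r - (l + int i) - 2) gchoose c) (Z r t (i + c))))"
    proof (rule sum_triples_box)
      fix r t c assume "r \<ge> K \<or> t \<ge> K \<or> c \<ge> I"
      hence "Z r t (i + c) = 0" using Ku Kv Iuv[of "i + c" r t] by (auto simp: Z_def)
      thus "sw ((-1) powi m) (sw (of_int (2 * h - int r - (l + int i) - 2) gchoose c) (Z r t (i + c))) = 0" by simp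
    qed
    \<comment> \<open>The factor \<open>- e\<close> acquired by the products in \<open>jac\<close>
      reappears from the parity of the weight \<open>m\<close>.\<close>
    also have "(-1) powi m = S * (- e * (-1) ^ i)"
      unfolding m_def S_def e_def by (simp add: power_int_diff power_int_add field_simps)
    finally show ?thesis by (simp only: W.M.scale_sum_right W.M.scale_scale mult.assoc)
  qed
  \<comment> \<open>\<open>Z r t (i + c)\<close> sees only \<open>j = i + c\<close>, so coefficients
    are collected along antidiagonals; \<open>N - P\<close> is exactly the mode
    \<open>p r\<close>.\<close>
  have conv: "(\<Sum>i<I. sw (of_int (- a - 1) gchoose i) (\<Sum>c<I. sw (- e * (-1) ^ i * (of_int (2 * h - int r - (l + int i) - 2) gchoose c)) (Z r t (i + c))))
      = sw (- e) (\<Sum>i<I. sw (of_int (p r) gchoose i) (Z r t i))" for r t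
  proof -
    define N :: complex where "N = of_int (2 * h - int r - l - 2)"
    define P :: complex where "P = of_int (- a - 1)"
    have N: "of_int (2 * h - int r - (l + int i) - 2) = N - of_nat i" for i by (simp add: N_def)
    have NP: "N - P = of_int (p r)" by (simp add: N_def P_def p_def)
    have "(\<Sum>i<I. sw (P gchoose i) (\<Sum>c<I. sw (- e * (-1) ^ i * ((N - of_nat i) gchoose c)) (Z r t (i + c))))
      = sw (- e) (\<Sum>i<I. \<Sum>c<I. sw ((-1) ^ i * (P gchoose i) * ((N - of_nat i) gchoose c)) (Z r t (i + c)))"
      by (simp add: W.M.scale_sum_right mult_ac)
    also have "(\<Sum>i<I. \<Sum>c<I. sw ((-1) ^ i * (P gchoose i) * ((N - of_nat i) gchoose c)) (Z r t (i + c)))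
      = (\<Sum>j<I. \<Sum>i\<le>j. sw ((-1) ^ i * (P gchoose i) * ((N - of_nat i) gchoose (j - i))) (Z r t (i + (j - i))))"
      by (rule sum_square_antidiagonal) (simp only: Z0 W.M.scale_zero_right)
    also have "\<dots> = (\<Sum>j<I. sw ((N - P) gchoose j) (Z r t j))"
    proof (intro sum.cong refl)
      fix j
      have "(\<Sum>i\<le>j. sw ((-1) ^ i * (P gchoose i) * ((N - of_nat i) gchoose (j - i))) (Z r t (i + (j - i))))
        = (\<Sum>i\<le>j. sw ((-1) ^ i * (P gchoose i) * ((N - of_nat i) gchoose (j - i))) (Z r t j))"
        by (intro sum.cong refl) simp
      thus "(\<Sum>i\<le>j. sw ((-1) ^ i * (P gchoose i) * ((N - of_nat i) gchoose (j - i))) (Z r t (i + (j - i))))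
        = sw ((N - P) gchoose j) (Z r t j)"
        by (simp only: W.M.scale_sum_left[symmetric] gbinomial_alternating_convolution)
    qed
    finally show ?thesis by (simp only: N P_def[symmetric] NP)
  qed
  have "fsum (\<lambda>i::nat. sw ((-1) ^ i * (of_int l gchoose i)) (Yo v (b - int i) (Yo u (a - l + int i) w)))
     = sw S (\<Sum>r<K. \<Sum>t<K. \<Sum>i<I. sw ((-1) ^ i * (of_int l gchoose i)) (A r t i))"
    by (subst fsum_nat_eq_sum[of I]) (simp_all only: YoA pull, simp add: A_def Iu)
  moreover have "fsum (\<lambda>i::nat. sw ((-1) powi l * ((-1) ^ i * (of_int l gchoose i))) (Yo u (a - int i) (Yo v (b - l + int i) w)))
     = sw S (\<Sum>r<K. \<Sum>t<K. \<Sum>i<I. sw (e * ((-1) ^ i * (of_int l gchoose i))) (B r t i))"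
    unfolding e_def[symmetric]
    by (subst fsum_nat_eq_sum[of I]) (simp_all only: YoB pull, simp add: B_def Iv)
  moreover have "fsum (\<lambda>i::nat. sw (of_int (- a - 1) gchoose i) (Yo (Y u (l + int i) v) (a + b + 1 + int i) w))
     = sw S (\<Sum>r<K. \<Sum>t<K. sw (- e) (\<Sum>i<I. sw (of_int (p r) gchoose i) (Z r t i)))"
  proof (subst fsum_nat_eq_sum[of I])
    fix i assume "i \<ge> I"
    thus "sw (of_int (- a - 1) gchoose i) (Yo (Y u (l + int i) v) (a + b + 1 + int i) w) = 0"
      using Iuv[of i 0 0] by simp
  qed (simp only: Yuv pull conv)
  ultimately show "fsum (\<lambda>i::nat. sw ((-1) ^ i * (of_int l gchoose i)) (Yo v (b - int i) (Yo u (a - l + int i) w)))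
     - fsum (\<lambda>i::nat. sw ((-1) powi l * ((-1) ^ i * (of_int l gchoose i))) (Yo u (a - int i) (Yo v (b - l + int i) w)))
     = fsum (\<lambda>i::nat. sw (of_int (- a - 1) gchoose i) (Yo (Y u (l + int i) v) (a + b + 1 + int i) w))"
    by (simp only: jac[symmetric] W.M.scale_right_diff_distrib[symmetric] sum_subtractf[symmetric])
qed

lemma opp_jacobi: "opp_jacobi u v"
proof (induction u rule: homogeneous_induct)
  case (1 n u)
  show ?case
    by (induction v rule: homogeneous_induct) (use 1 in \<open>auto intro: opp_jacobi_homogeneous opp_jacobi_add_right\<close>)
qed (rule opp_jacobi_add_left)

end

section \<open>The action on P(z)-linear functionals\<close>

lemma fsum_cmult: "fsum (\<lambda>i. a * f i) = a * fsum f" for f :: "'i \<Rightarrow> complex"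
proof (cases "a = 0")
  case False
  hence "{i. a * f i \<noteq> 0} = {i. f i \<noteq> 0}" by auto
  thus ?thesis by (simp add: fsum_def sum_distrib_left)
qed simp

lemma fsum_fun_apply:
  fixes f :: "nat \<Rightarrow> 'a \<Rightarrow> complex"
  assumes "\<And>i. i \<ge> N \<Longrightarrow> f i = 0"
  shows "fsum f x = fsum (\<lambda>i. f i x)"
proof -
  have "sum f A x = (\<Sum>i\<in>A. f i x)" for A
    by (induction A rule: infinite_finite_induct) (auto simp: zero_fun_def)
  moreover have "f i x = 0" if "i \<ge> N" for i using assms[OF that] by simp
  ultimately show ?thesis
    using fsum_nat_eq_sum[of N f] fsum_nat_eq_sum[of N "\<lambda>i. f i x"] assms by simp
qed

text \<open>The two series may need different powers of \<open>x - z\<close>;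
  \<open>max B B'\<close> clears both.\<close>

lemma iota_lincomb:
  assumes z: "z \<noteq> 0"
    and c: "\<And>j. j > N \<Longrightarrow> c j = 0" "\<And>j. j < s \<Longrightarrow> (zmult z ^^ B) c j = 0"
    and c': "\<And>j. j > N' \<Longrightarrow> c' j = 0" "\<And>j. j < s' \<Longrightarrow> (zmult z ^^ B') c' j = 0"
  shows "iota0_iotainf_inv (\<lambda>j. a * c j + b * c' j)
    = (\<lambda>j. a * iota0_iotainf_inv c j + b * iota0_iotainf_inv c' j)"
proof (rule iota_eqI[OF z, where N = "max N N'" and s = "min s s'" and B = "max B B'"])
  have "(zmult z ^^ max B B') (iota0_iotainf_inv c) = (zmult z ^^ max B B') c"
    by (rule zmult_pow_eq_mono[of B]) (use iota_props(1)[OF z, of N c s B] c in auto)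
  moreover have "(zmult z ^^ max B B') (iota0_iotainf_inv c') = (zmult z ^^ max B B') c'"
    by (rule zmult_pow_eq_mono[of B']) (use iota_props(1)[OF z, of N' c' s' B'] c' in auto)
  ultimately show "(zmult z ^^ max B B') (\<lambda>j. a * c j + b * c' j)
     = (zmult z ^^ max B B') (\<lambda>j. a * iota0_iotainf_inv c j + b * iota0_iotainf_inv c' j)"
    unfolding zmult_pow_lincomb by simp
  show "a * c j + b * c' j = 0" if "j > max N N'" for j using that c c' by simp
  show "a * iota0_iotainf_inv c j + b * iota0_iotainf_inv c' j = 0" if "j < min s s'" for j
    using that iota_props(2)[OF z, of N c s B] iota_props(2)[OF z, of N' c' s' B'] c c' by simp
qed

locale voa_mod_dual = voa_mod sc Y vac om sw YW
  for sc :: "complex \<Rightarrow> 'v::ab_group_add \<Rightarrow> 'v" and Y :: "'v \<Rightarrow> int \<Rightarrow> 'v \<Rightarrow> 'v" and vac om :: 'v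
    and sw :: "complex \<Rightarrow> 'w::ab_group_add \<Rightarrow> 'w" and YW :: "'v \<Rightarrow> int \<Rightarrow> 'w \<Rightarrow> 'w" +
  fixes z :: complex
  assumes z: "z \<noteq> 0"
begin

abbreviation "lin \<equiv> Vector_Spaces.linear sw ((*) :: complex \<Rightarrow> complex \<Rightarrow> complex)"

lemma lin_iff: "lin \<alpha> \<longleftrightarrow> (\<forall>a b x y. \<alpha> (sw a x + sw b y) = a * \<alpha> x + b * \<alpha> y)"
proof
  assume "lin \<alpha>"
  then interpret Vector_Spaces.linear sw "(*) :: complex \<Rightarrow> complex \<Rightarrow> complex" \<alpha> .
  show "\<forall>a b x y. \<alpha> (sw a x + sw b y) = a * \<alpha> x + b * \<alpha> y" by (simp add: add scale)
next
  assume *: "\<forall>a b x y. \<alpha> (sw a x + sw b y) = a * \<alpha> x + b * \<alpha> y"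
  have "\<alpha> (x + y) = \<alpha> x + \<alpha> y" for x y using *[rule_format, of 1 x 1 y] by simp
  moreover have "\<alpha> (sw a x) = a * \<alpha> x" for a x using *[rule_format, of a x 0 x] by simp
  moreover have "vector_space ((*) :: complex \<Rightarrow> complex \<Rightarrow> complex)"
    by unfold_locales (simp_all add: algebra_simps)
  ultimately show "lin \<alpha>"
    using W.M.vector_space_axioms by (simp add: Vector_Spaces.linear_iff)
qed

lemma lin_add: "lin \<alpha> \<Longrightarrow> \<alpha> (x + y) = \<alpha> x + \<alpha> y"
  unfolding lin_iff by (metis W.M.scale_one mult_1)

lemma lin_scale: "lin \<alpha> \<Longrightarrow> \<alpha> (sw a x) = a * \<alpha> x"
  unfolding lin_iff by (metis W.M.scale_zero_left add.right_neutral mult_zero_left)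

lemma lin_zero: "lin \<alpha> \<Longrightarrow> \<alpha> 0 = 0"
  using lin_scale[of \<alpha> 0 0] by simp

lemma lin_sum: "lin \<alpha> \<Longrightarrow> \<alpha> (sum f A) = (\<Sum>i\<in>A. \<alpha> (f i))"
  by (induction A rule: infinite_finite_induct) (auto simp: lin_add lin_zero)

lemma lin_diff: "lin \<alpha> \<Longrightarrow> \<alpha> (x - y) = \<alpha> x - \<alpha> y"
  using lin_add[of \<alpha> "x - y" y] by simp

lemma lin_fsum:
  assumes "lin \<alpha>" "finite {i. f i \<noteq> 0}"
  shows "\<alpha> (fsum f) = fsum (\<lambda>i. \<alpha> (f i))"
proof -
  have "fsum (\<lambda>i. \<alpha> (f i)) = (\<Sum>i | f i \<noteq> 0. \<alpha> (f i))"
    by (rule fsum_eq_sum) (use assms in \<open>auto simp: lin_zero\<close>)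
  thus ?thesis by (simp add: fsum_def[of f] lin_sum[OF assms(1)])
qed

section \<open>P(z)-linear functionals and their transformed series\<close>

abbreviation "Dz \<equiv> DPz sc Y om sw YW z"

definition pairing :: "('w \<Rightarrow> complex) \<Rightarrow> 'v \<Rightarrow> 'w \<Rightarrow> int \<Rightarrow> complex" where
  "pairing \<alpha> v w = (\<lambda>j. \<alpha> (Yo v j w))"

lemma pairing_high: "lin \<alpha> \<Longrightarrow> \<exists>N. \<forall>j>N. pairing \<alpha> v w j = 0"
  using Yo_trunc[of v w] lin_zero[of \<alpha>] unfolding pairing_def by metis

text \<open>\<open>A\<close> and \<open>B\<close> bound the pole orders at 0 and at
  \<open>z\<close>. They are chosen before \<open>w\<close>, which later permits \<open>w\<close> to
  be replaced by coefficients of another operator.\<close>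

lemma DPz_iff: "\<alpha> \<in> Dz \<longleftrightarrow> lin \<alpha> \<and> (\<forall>v. \<exists>A B :: nat. \<forall>w. \<forall>j < - int A. (zmult z ^^ B) (pairing \<alpha> v w) j = 0)"
proof (cases "lin \<alpha>")
  case True
  have "(\<exists>p :: complex poly. \<forall>x. norm x > norm z \<longrightarrow>
        (\<lambda>j. norm (pairing \<alpha> v w j * x powi j)) summable_on UNIV \<and>
        ((\<lambda>j. pairing \<alpha> v w j * x powi j) has_sum (poly p x / (x ^ A * (x - z) ^ B))) UNIV)
     \<longleftrightarrow> (\<forall>j < - int A. (zmult z ^^ B) (pairing \<alpha> v w) j = 0)" for v w A B
  proof -
    obtain N where "\<And>j. j > N \<Longrightarrow> pairing \<alpha> v w j = 0" using pairing_high[OF True] by blast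
    thus ?thesis by (rule rational_expansion_iff[OF z])
  qed
  thus ?thesis using True unfolding DPz_def pairing_def by simp
qed (auto simp: DPz_def)

lemma DPz_lin: "\<alpha> \<in> Dz \<Longrightarrow> lin \<alpha>"
  by (simp add: DPz_iff)

lemma DPz_low:
  assumes "\<alpha> \<in> Dz"
  shows "\<exists>s B. \<forall>w. \<forall>j<s. (zmult z ^^ B) (pairing \<alpha> v w) j = 0"
  using assms unfolding DPz_iff by blast

lemma DPzI:
  assumes "lin \<alpha>" "\<And>v. \<exists>s B. \<forall>w. \<forall>j<s. (zmult z ^^ B) (pairing \<alpha> v w) j = 0"
  shows "\<alpha> \<in> Dz"
  unfolding DPz_iff
proof (intro conjI allI assms(1))
  fix v
  obtain s B where sB: "\<And>w j. j < s \<Longrightarrow> (zmult z ^^ B) (pairing \<alpha> v w) j = 0" using assms(2) by blast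
  have "- int (nat (- s)) \<le> s" by simp
  hence "\<forall>w. \<forall>j < - int (nat (- s)). (zmult z ^^ B) (pairing \<alpha> v w) j = 0"
    using sB by (meson order_less_le_trans)
  thus "\<exists>A B :: nat. \<forall>w. \<forall>j < - int A. (zmult z ^^ B) (pairing \<alpha> v w) j = 0" by blast
qed

lemma DPz_lincomb:
  assumes "\<alpha> \<in> Dz" "\<beta> \<in> Dz"
  shows "(\<lambda>w. a * \<alpha> w + b * \<beta> w) \<in> Dz"
proof (rule DPzI)
  show "lin (\<lambda>w. a * \<alpha> w + b * \<beta> w)"
    using DPz_lin[OF assms(1)] DPz_lin[OF assms(2)] unfolding lin_iff by (simp add: algebra_simps)
  fix v
  obtain s B where 1: "\<And>w j. j < s \<Longrightarrow> (zmult z ^^ B) (pairing \<alpha> v w) j = 0" using DPz_low[OF assms(1)] by blast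
  obtain s' B' where 2: "\<And>w j. j < s' \<Longrightarrow> (zmult z ^^ B') (pairing \<beta> v w) j = 0" using DPz_low[OF assms(2)] by blast
  have eq: "pairing (\<lambda>w. a * \<alpha> w + b * \<beta> w) v w = (\<lambda>j. a * pairing \<alpha> v w j + b * pairing \<beta> v w j)" for w
    by (simp add: pairing_def)
  have "(zmult z ^^ max B B') (pairing (\<lambda>w. a * \<alpha> w + b * \<beta> w) v w) j = 0" if "j < min s s'" for w j
    unfolding eq zmult_pow_lincomb
    using that zmult_pow_low_mono[of s B z "pairing \<alpha> v w" "max B B'" j]
      zmult_pow_low_mono[of s' B' z "pairing \<beta> v w" "max B B'" j] 1 2 by simp
  thus "\<exists>s B. \<forall>w. \<forall>j<s. (zmult z ^^ B) (pairing (\<lambda>w. a * \<alpha> w + b * \<beta> w) v w) j = 0" by blast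
qed

lemma zero_DPz: "(\<lambda>w. 0) \<in> Dz"
  by (rule DPzI) (auto simp: lin_iff pairing_def intro: exI[of _ 0])

text \<open>Indexed by the exponent of \<open>x\<close> rather than the mode, so that
  \<open>zmult\<close> applies directly; the vector comes last so that
  \<open>Rc \<alpha> v b\<close> is a functional.\<close>

definition Rc :: "('w \<Rightarrow> complex) \<Rightarrow> 'v \<Rightarrow> int \<Rightarrow> 'w \<Rightarrow> complex" where
  "Rc \<alpha> v b w = iota0_iotainf_inv (pairing \<alpha> v w) b"

lemma YR_eq: "YR sc Y om sw YW z v n \<alpha> = Rc \<alpha> v (- n - 1)"
  by (simp add: YR_def Rc_def pairing_def fun_eq_iff)

lemma Rc_props:
  assumes "lin \<alpha>" "\<And>j. j < s \<Longrightarrow> (zmult z ^^ B) (pairing \<alpha> v w) j = 0"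
  shows "(zmult z ^^ B) (\<lambda>b. Rc \<alpha> v b w) = (zmult z ^^ B) (pairing \<alpha> v w)"
    and "b < s \<Longrightarrow> Rc \<alpha> v b w = 0"
proof -
  obtain N where N: "\<And>j. j > N \<Longrightarrow> pairing \<alpha> v w j = 0" using pairing_high[OF assms(1)] by blast
  show "(zmult z ^^ B) (\<lambda>b. Rc \<alpha> v b w) = (zmult z ^^ B) (pairing \<alpha> v w)" "b < s \<Longrightarrow> Rc \<alpha> v b w = 0"
    unfolding Rc_def using iota_props[OF z, of N "pairing \<alpha> v w" s B] N assms(2) by simp_all
qed

lemma Rc_bounds:
  assumes "\<alpha> \<in> Dz"
  shows "\<exists>s B. \<forall>w. (zmult z ^^ B) (\<lambda>b. Rc \<alpha> v b w) = (zmult z ^^ B) (pairing \<alpha> v w)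
     \<and> (\<forall>b<s. Rc \<alpha> v b w = 0) \<and> (\<forall>b<s. (zmult z ^^ B) (pairing \<alpha> v w) b = 0)"
  using DPz_low[OF assms, of v] Rc_props[OF DPz_lin[OF assms]] by metis

text \<open>Linear relations between pairings pass to \<open>Rc\<close>. Separate functionals and
  vectors are allowed, so linearity in \<open>w\<close>, in \<open>v\<close> and in \<alpha> are all
  instances.\<close>

lemma Rc_lincomb:
  assumes "\<alpha> \<in> Dz" "\<beta> \<in> Dz"
    and "pairing \<gamma> v w = (\<lambda>j. a * pairing \<alpha> u x j + b * pairing \<beta> u' x' j)"
  shows "Rc \<gamma> v n w = a * Rc \<alpha> u n x + b * Rc \<beta> u' n x'"
proof -
  obtain s B where 1: "\<And>w j. j < s \<Longrightarrow> (zmult z ^^ B) (pairing \<alpha> u w) j = 0" using DPz_low[OF assms(1)] by blast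
  obtain s' B' where 2: "\<And>w j. j < s' \<Longrightarrow> (zmult z ^^ B') (pairing \<beta> u' w) j = 0" using DPz_low[OF assms(2)] by blast
  obtain N where N: "\<And>j. j > N \<Longrightarrow> pairing \<alpha> u x j = 0" using pairing_high[OF DPz_lin[OF assms(1)]] by blast
  obtain N' where N': "\<And>j. j > N' \<Longrightarrow> pairing \<beta> u' x' j = 0" using pairing_high[OF DPz_lin[OF assms(2)]] by blast
  show ?thesis
    unfolding Rc_def assms(3) using iota_lincomb[OF z N 1 N' 2, where a = a and b = b] by (simp add: fun_eq_iff)
qed

lemma Rc_lin:
  assumes "\<alpha> \<in> Dz"
  shows "lin (Rc \<alpha> v n)"
  unfolding lin_iff
proof (intro allI)
  fix a b x y
  show "Rc \<alpha> v n (sw a x + sw b y) = a * Rc \<alpha> v n x + b * Rc \<alpha> v n y"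
    by (rule Rc_lincomb[OF assms assms])
       (use DPz_lin[OF assms] in \<open>simp add: pairing_def Yo_add_right Yo_scale_right lin_add lin_scale\<close>)
qed

lemma Rc_lincomb_vector:
  assumes "\<alpha> \<in> Dz"
  shows "Rc \<alpha> (sc a u + sc b u') n w = a * Rc \<alpha> u n w + b * Rc \<alpha> u' n w"
  by (rule Rc_lincomb[OF assms assms])
     (use DPz_lin[OF assms] in \<open>simp add: pairing_def Yo_add_left Yo_scale_left lin_add lin_scale\<close>)

lemma Rc_lincomb_functional:
  assumes "\<alpha> \<in> Dz" "\<beta> \<in> Dz"
  shows "Rc (\<lambda>w. a * \<alpha> w + b * \<beta> w) v n w = a * Rc \<alpha> v n w + b * Rc \<beta> v n w"
  by (rule Rc_lincomb[OF assms]) (simp add: pairing_def)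

lemma Rc_zero_functional [simp]: "Rc (\<lambda>w. 0) v n w = 0"
  using Rc_lincomb_functional[OF zero_DPz zero_DPz, of 0 0 v n w] by simp

lemma Rc_zero_vector: "\<alpha> \<in> Dz \<Longrightarrow> Rc \<alpha> 0 n w = 0"
  using Rc_lincomb_vector[of \<alpha> 0 0 0 0 n w] by simp

lemma Rc_vac:
  assumes "\<alpha> \<in> Dz"
  shows "Rc \<alpha> vac n w = (if n = 0 then \<alpha> w else 0)"
proof -
  have "pairing \<alpha> vac w = (\<lambda>j. if j = 0 then \<alpha> w else 0)"
    using DPz_lin[OF assms] by (auto simp: pairing_def Yo_vac lin_zero)
  moreover have "iota0_iotainf_inv (\<lambda>j. if j = 0 then \<alpha> w else 0) = (\<lambda>j. if j = 0 then \<alpha> w else 0)"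
    by (rule iota_eqI[OF z, where N = 0 and s = 0 and B = 0]) auto
  ultimately show ?thesis by (simp add: Rc_def)
qed

lemma functional_jacobi:
  assumes "lin \<alpha>"
  shows "binom_mult l (\<lambda>a b. \<alpha> (Yo v b (Yo u a w))) a b
     - (-1) powi l * binom_mult l (\<lambda>b a. \<alpha> (Yo u a (Yo v b w))) b a
     = iterate_side (\<lambda>i. pairing \<alpha> (Y u (l + int i) v) w) a b"
proof -
  have "\<alpha> (fsum (\<lambda>i::nat. sw ((-1) ^ i * (of_int l gchoose i)) (Yo v (b - int i) (Yo u (a - l + int i) w)))
     - fsum (\<lambda>i::nat. sw ((-1) powi l * ((-1) ^ i * (of_int l gchoose i))) (Yo u (a - int i) (Yo v (b - l + int i) w))))
     = \<alpha> (fsum (\<lambda>i::nat. sw (of_int (- a - 1) gchoose i) (Yo (Y u (l + int i) v) (a + b + 1 + int i) w)))"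
    using opp_jacobi[of u v] unfolding opp_jacobi_def by simp
  thus ?thesis
    unfolding lin_diff[OF assms] lin_fsum[OF assms opp_jacobi_finite(1)] lin_fsum[OF assms opp_jacobi_finite(2)]
      lin_scale[OF assms]
    by (simp add: binom_mult_def iterate_side_def pairing_def mult.assoc fsum_cmult)
qed

text \<open>The pole orders and the total-degree bound obtained here are independent of \<open>w\<close>, and those at \<open>z\<close>
  also of \<open>b\<close>; the latter is what lets the powers of \<open>x\<^sub>1 - z\<close> and \<open>x\<^sub>2 - z\<close> be cleared simultaneously.\<close>

lemma Rc_pole_bound:
  assumes \<alpha>: "\<alpha> \<in> Dz"
  shows "\<exists>t s A B. \<forall>w.
      (\<forall>a b. a + b < t \<longrightarrow> (zmult z ^^ A) (pairing (Rc \<alpha> v b) u w) a = 0)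
    \<and> (\<forall>a. (zmult z ^^ B) (\<lambda>b. Rc \<alpha> v b (Yo u a w)) = (zmult z ^^ B) (\<lambda>b. \<alpha> (Yo v b (Yo u a w))))
    \<and> (\<forall>b<s. \<forall>x. Rc \<alpha> v b x = 0)"
proof -
  have lin: "lin \<alpha>" using \<alpha> by (rule DPz_lin)
  obtain s1 A where u: "\<And>w j. j < s1 \<Longrightarrow> (zmult z ^^ A) (pairing \<alpha> u w) j = 0" using DPz_low[OF \<alpha>] by blast
  obtain s2 B where v: "\<And>w. (zmult z ^^ B) (\<lambda>b. Rc \<alpha> v b w) = (zmult z ^^ B) (pairing \<alpha> v w)"
     "\<And>w b. b < s2 \<Longrightarrow> Rc \<alpha> v b w = 0" "\<And>w b. b < s2 \<Longrightarrow> (zmult z ^^ B) (pairing \<alpha> v w) b = 0"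
    using Rc_bounds[OF \<alpha>, of v] by blast
  \<comment> \<open>Weak commutativity: \<open>Y u n v\<close> vanishes from \<open>k\<close> on, so
    multiplication by \<open>(x1 - x2)^k\<close> leaves no iterate term.\<close>
  obtain k where k: "\<And>n. n \<ge> k \<Longrightarrow> Y u n v = 0" using V.YM_trunc by blast
  have "(zmult z ^^ A) (pairing (Rc \<alpha> v b) u w) a = 0" if ab: "a + b < s1 + s2 - k" for w a b
  proof -
    define G where "G = (\<lambda>a b. \<alpha> (Yo v b (Yo u a w)))"
    define H where "H = (\<lambda>a b. \<alpha> (Yo u a (Yo v b w)))"
    define G' where "G' = (\<lambda>a b. Rc \<alpha> v b (Yo u a w))"
    obtain N where N: "\<And>j. j > N \<Longrightarrow> Yo u j w = 0" using Yo_trunc by blast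
    obtain N' where N': "\<And>j. j > N' \<Longrightarrow> Yo v j w = 0" using Yo_trunc by blast
    have "zmult1 z A G' a b = 0"
    proof (rule binom_mult_pole_bound[OF z, where G = G and H = H and N = N and N' = N' and B = B])
      show "G a b = 0" if "a > N" for a b using N[OF that] by (simp add: G_def lin_zero lin)
      show "H a b = 0" if "b > N'" for a b using N'[OF that] by (simp add: H_def lin_zero lin)
      show "binom_mult k G a b = (- 1) powi k * binom_mult k (flip H) b a" for a b
      proof -
        have "pairing \<alpha> (Y u (k + int i) v) w = (\<lambda>j. 0)" for i
          using k[of "k + int i"] by (simp add: pairing_def lin_zero lin)
        thus ?thesis
          using functional_jacobi[OF lin, of k v u w a b] by (simp add: G_def H_def iterate_side_def)
      qed
      show "zmult1 z A H a b = 0" if "a < s1" for a b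
        using u[OF that] by (simp add: zmult1_def H_def pairing_def)
      show "zmult2 z B G a b = 0" if "b < s2" for a b
        using v(3)[OF that] by (simp add: zmult2_def G_def pairing_def)
      show "zmult2 z B G' = zmult2 z B G"
        using v(1) by (simp add: zmult2_def G_def G'_def pairing_def)
      show "G' a b = 0" if "b < s2" for a b using v(2)[OF that] by (simp add: G'_def)
    qed (rule ab)
    thus ?thesis by (simp add: zmult1_def G'_def pairing_def)
  qed
  moreover have "(zmult z ^^ B) (\<lambda>b. Rc \<alpha> v b (Yo u a w)) = (zmult z ^^ B) (\<lambda>b. \<alpha> (Yo v b (Yo u a w)))" for a w
    using v(1) by (simp add: pairing_def)
  ultimately show ?thesis using v(2) by blast
qed

lemma Rc_DPz:
  assumes \<alpha>: "\<alpha> \<in> Dz"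
  shows "Rc \<alpha> v b \<in> Dz"
proof (rule DPzI[OF Rc_lin[OF \<alpha>]])
  fix u
  obtain t s A B where "\<And>w a b. a + b < t \<Longrightarrow> (zmult z ^^ A) (pairing (Rc \<alpha> v b) u w) a = 0"
    using Rc_pole_bound[OF \<alpha>, of v u] by blast
  \<comment> \<open>For fixed \<open>b\<close> the bound on the total degree is a bound on the
    exponent of the new operator; it may depend on \<open>b\<close>.\<close>
  hence "\<forall>w. \<forall>j<t - b. (zmult z ^^ A) (pairing (Rc \<alpha> v b) u w) j = 0" by simp
  thus "\<exists>s B. \<forall>w. \<forall>j<s. (zmult z ^^ B) (pairing (Rc \<alpha> v b) u w) j = 0" by blast
qed

text \<open>A power of \<open>x1 - z\<close> turns the outer \<open>Rc\<close> into a pairing with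
  \<open>Yo u\<close>, then a power of \<open>x2 - z\<close> turns \<open>Rc \<alpha> v b\<close>
  into \<alpha> applied after \<open>Yo v\<close>. All large exponents are allowed so that several
  terms can share one.\<close>

lemma Rc_Rc_props:
  assumes \<alpha>: "\<alpha> \<in> Dz"
  shows "\<exists>t s B0. \<forall>w.
      (\<forall>a b. a + b < t \<longrightarrow> Rc (Rc \<alpha> v b) u a w = 0)
    \<and> (\<forall>a b. b < s \<longrightarrow> Rc (Rc \<alpha> v b) u a w = 0)
    \<and> (\<forall>B\<ge>B0. zmult1 z B (zmult2 z B (\<lambda>a b. Rc (Rc \<alpha> v b) u a w))
           = zmult1 z B (zmult2 z B (\<lambda>a b. \<alpha> (Yo v b (Yo u a w)))))"
proof -
  obtain t s A B where b: "\<And>w a b. a + b < t \<Longrightarrow> (zmult z ^^ A) (pairing (Rc \<alpha> v b) u w) a = 0"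
    "\<And>w a. (zmult z ^^ B) (\<lambda>b. Rc \<alpha> v b (Yo u a w)) = (zmult z ^^ B) (\<lambda>b. \<alpha> (Yo v b (Yo u a w)))"
    "\<And>b x. b < s \<Longrightarrow> Rc \<alpha> v b x = 0"
    using Rc_pole_bound[OF \<alpha>, of v u] by metis
  have F: "(zmult z ^^ A) (\<lambda>a. Rc (Rc \<alpha> v b) u a w) = (zmult z ^^ A) (pairing (Rc \<alpha> v b) u w)"
    "a + b < t \<Longrightarrow> Rc (Rc \<alpha> v b) u a w = 0" for a b w
    using Rc_props[OF Rc_lin[OF \<alpha>], of "t - b" A v b u w] b(1) by simp_all
  have "Rc (Rc \<alpha> v b) u a w = 0" if "b < s" for a b w
  proof -
    have "Rc \<alpha> v b = (\<lambda>x. 0)" using b(3)[OF that] by blast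
    thus ?thesis by simp
  qed
  moreover have "zmult1 z C (zmult2 z C (\<lambda>a b. Rc (Rc \<alpha> v b) u a w))
           = zmult1 z C (zmult2 z C (\<lambda>a b. \<alpha> (Yo v b (Yo u a w))))" if C: "C \<ge> max A B" for C w
  proof -
    have 1: "zmult1 z C (\<lambda>a b. Rc (Rc \<alpha> v b) u a w) = zmult1 z C (\<lambda>a b. Rc \<alpha> v b (Yo u a w))"
    proof -
      have "(zmult z ^^ C) (\<lambda>a. Rc (Rc \<alpha> v b) u a w) = (zmult z ^^ C) (\<lambda>a. Rc \<alpha> v b (Yo u a w))" for b
        by (rule zmult_pow_eq_mono[of A]) (use F(1) C in \<open>auto simp: pairing_def\<close>)
      thus ?thesis by (simp add: zmult1_def)
    qed
    \<comment> \<open>The vector \<open>Yo u a w\<close> varies with \<open>a\<close>, yet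
      \<open>B\<close> does not.\<close>
    have 2: "zmult2 z C (\<lambda>a b. Rc \<alpha> v b (Yo u a w)) = zmult2 z C (\<lambda>a b. \<alpha> (Yo v b (Yo u a w)))"
    proof -
      have "(zmult z ^^ C) (\<lambda>b. Rc \<alpha> v b (Yo u a w)) = (zmult z ^^ C) (\<lambda>b. \<alpha> (Yo v b (Yo u a w)))" for a
        by (rule zmult_pow_eq_mono[of B]) (use b(2) C in auto)
      thus ?thesis by (simp add: zmult2_def)
    qed
    have "zmult1 z C (zmult2 z C (\<lambda>a b. Rc (Rc \<alpha> v b) u a w))
        = zmult2 z C (zmult1 z C (\<lambda>a b. Rc (Rc \<alpha> v b) u a w))" by (rule zmult1_zmult2_commute)
    also have "\<dots> = zmult1 z C (zmult2 z C (\<lambda>a b. Rc \<alpha> v b (Yo u a w)))"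
      unfolding 1 by (rule zmult1_zmult2_commute[symmetric])
    finally show ?thesis unfolding 2 .
  qed
  ultimately show ?thesis using F(2) by blast
qed

text \<open>Serves the iterate side, whose finitely many nonzero vectors
  \<open>Y u (l + int i) v\<close> need one exponent and one lower bound.\<close>

lemma Rc_bounds_finite:
  assumes \<alpha>: "\<alpha> \<in> Dz" and "finite X"
  shows "\<exists>s B0. \<forall>x\<in>X. \<forall>w. (\<forall>B\<ge>B0. (zmult z ^^ B) (\<lambda>b. Rc \<alpha> x b w) = (zmult z ^^ B) (pairing \<alpha> x w))
     \<and> (\<forall>b<s. Rc \<alpha> x b w = 0)"
  using assms(2)
proof (induction X rule: finite_induct)
  case (insert x X)
  then obtain s B where 1: "\<And>y w B'. y \<in> X \<Longrightarrow> B' \<ge> B \<Longrightarrow> (zmult z ^^ B') (\<lambda>b. Rc \<alpha> y b w) = (zmult z ^^ B') (pairing \<alpha> y w)"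
    "\<And>y w b. y \<in> X \<Longrightarrow> b < s \<Longrightarrow> Rc \<alpha> y b w = 0" by blast
  obtain s' C where 2: "\<And>w. (zmult z ^^ C) (\<lambda>b. Rc \<alpha> x b w) = (zmult z ^^ C) (pairing \<alpha> x w)"
    "\<And>w b. b < s' \<Longrightarrow> Rc \<alpha> x b w = 0" using Rc_bounds[OF \<alpha>, of x] by blast
  have 3: "(zmult z ^^ B') (\<lambda>b. Rc \<alpha> x b w) = (zmult z ^^ B') (pairing \<alpha> x w)" if "B' \<ge> C" for B' w
    using 2(1) that by (rule zmult_pow_eq_mono)
  show ?case
    by (rule exI[of _ "min s s'"], rule exI[of _ "max B C"]) (use 1 2(2) 3 in auto)
qed auto

lemma Rc_jacobi:
  assumes \<alpha>: "\<alpha> \<in> Dz"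
  shows "binom_mult l (\<lambda>a b. Rc (Rc \<alpha> v b) u a w) a b
     - (-1) powi l * binom_mult l (\<lambda>b a. Rc (Rc \<alpha> u a) v b w) b a
     = iterate_side (\<lambda>i j. Rc \<alpha> (Y u (l + int i) v) j w) a b"
proof -
  have lin: "lin \<alpha>" using \<alpha> by (rule DPz_lin)
  define F where "F = (\<lambda>a b. Rc (Rc \<alpha> v b) u a w)"
  define E where "E = (\<lambda>a b. Rc (Rc \<alpha> u a) v b w)"
  define G where "G = (\<lambda>a b. \<alpha> (Yo v b (Yo u a w)))"
  define H where "H = (\<lambda>a b. \<alpha> (Yo u a (Yo v b w)))"
  obtain t1 s1 B1 where F: "\<And>a b. a + b < t1 \<Longrightarrow> F a b = 0" "\<And>a b. b < s1 \<Longrightarrow> F a b = 0"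
      "\<And>B. B \<ge> B1 \<Longrightarrow> zmult1 z B (zmult2 z B F) = zmult1 z B (zmult2 z B G)"
    using Rc_Rc_props[OF \<alpha>, of v u] unfolding F_def G_def by blast
  obtain t2 s2 B2 where E: "\<And>b a. b + a < t2 \<Longrightarrow> E a b = 0" "\<And>b a. a < s2 \<Longrightarrow> E a b = 0"
      "\<And>B. B \<ge> B2 \<Longrightarrow> zmult1 z B (zmult2 z B (flip E)) = zmult1 z B (zmult2 z B (flip H))"
    using Rc_Rc_props[OF \<alpha>, of u v] unfolding E_def H_def by blast
  obtain m where m: "\<And>i. i \<ge> m \<Longrightarrow> Y u (l + int i) v = 0" using Y_shift_trunc by blast
  obtain s3 B3 where K: "\<And>i B. i < m \<Longrightarrow> B \<ge> B3 \<Longrightarrow> (zmult z ^^ B) (\<lambda>b. Rc \<alpha> (Y u (l + int i) v) b w)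
        = (zmult z ^^ B) (pairing \<alpha> (Y u (l + int i) v) w)"
     "\<And>i b. i < m \<Longrightarrow> b < s3 \<Longrightarrow> Rc \<alpha> (Y u (l + int i) v) b w = 0"
  proof -
    obtain s3 B3 where "\<forall>x\<in>(\<lambda>i. Y u (l + int i) v) ` {..<m}. \<forall>w.
        (\<forall>B\<ge>B3. (zmult z ^^ B) (\<lambda>b. Rc \<alpha> x b w) = (zmult z ^^ B) (pairing \<alpha> x w)) \<and> (\<forall>b<s3. Rc \<alpha> x b w = 0)"
      using Rc_bounds_finite[OF \<alpha>, of "(\<lambda>i. Y u (l + int i) v) ` {..<m}"] by blast
    thus ?thesis by (intro that[of B3 s3]) auto
  qed
  have K0: "pairing \<alpha> (Y u (l + int i) v) w j = 0" "Rc \<alpha> (Y u (l + int i) v) j w = 0" if "i \<ge> m" for i j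
    using m[OF that] by (simp_all add: pairing_def lin_zero lin Rc_zero_vector \<alpha>)
  define B where "B = max B1 (max B2 B3)"
  obtain N where N: "\<And>j. j > N \<Longrightarrow> Yo u j w = 0" using Yo_trunc by blast
  obtain N' where N': "\<And>j. j > N' \<Longrightarrow> Yo v j w = 0" using Yo_trunc by blast
  have "binom_mult l F a b - (-1) powi l * binom_mult l (flip E) b a
      = iterate_side (\<lambda>i j. Rc \<alpha> (Y u (l + int i) v) j w) a b"
  proof (rule jacobi_transfer[OF z, where G = G and H = H and K = "\<lambda>i. pairing \<alpha> (Y u (l + int i) v) w"
        and B = B and m = m and t = "min t1 (min t2 s3)"])
    show "binom_mult l G a b - (- 1) powi l * binom_mult l (flip H) b a
        = iterate_side (\<lambda>i. pairing \<alpha> (Y u (l + int i) v) w) a b" for a b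
      unfolding G_def H_def by (rule functional_jacobi[OF lin])
    show "zmult1 z B (zmult2 z B F) = zmult1 z B (zmult2 z B G)" by (rule F(3)) (simp add: B_def)
    \<comment> \<open>\<open>Rc_Rc_props\<close> puts the exponent of the outer \<open>Rc\<close>
      first; for \<open>E\<close> this belongs to \<open>v\<close>, so that lemma speaks of
      \<open>flip E\<close>. Since both powers equal \<open>B\<close>, exchanging the variables is
      harmless.\<close>
    have "zmult1 z B (zmult2 z B E) = flip (zmult1 z B (zmult2 z B (flip E)))"
      unfolding zmult1_zmult2_commute[of z B B "flip E"] by (simp add: zmult1_def zmult2_def)
    also have "zmult1 z B (zmult2 z B (flip E)) = zmult1 z B (zmult2 z B (flip H))"
      by (rule E(3)) (simp add: B_def)
    also have "flip (zmult1 z B (zmult2 z B (flip H))) = zmult1 z B (zmult2 z B H)"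
      unfolding zmult1_zmult2_commute[of z B B "flip H"] by (simp add: zmult1_def zmult2_def)
    finally show "zmult1 z B (zmult2 z B E) = zmult1 z B (zmult2 z B H)" .
    show "(zmult z ^^ B) (\<lambda>j. Rc \<alpha> (Y u (l + int i) v) j w) = (zmult z ^^ B) (pairing \<alpha> (Y u (l + int i) v) w)" for i
    proof (cases "i < m")
      case True
      thus ?thesis by (rule K(1)) (simp add: B_def)
    next
      case False
      hence "pairing \<alpha> (Y u (l + int i) v) w = (\<lambda>j. Rc \<alpha> (Y u (l + int i) v) j w)"
        using K0 by (intro ext) simp
      thus ?thesis by simp
    qed
    show "antidiag_finite F" using F(2) by (rule antidiag_finiteI_low)
    show "antidiag_finite (flip E)" using E(2) by (rule antidiag_finiteI_low)
    show "antidiag_finite G" by (rule antidiag_finiteI_high[of N]) (simp add: G_def N lin_zero lin)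
    show "antidiag_finite (flip H)" by (rule antidiag_finiteI_high[of N']) (simp add: H_def N' lin_zero lin)
    show "F a b = 0" if "a + b < min t1 (min t2 s3)" for a b using F(1) that by simp
    show "E a b = 0" if "a + b < min t1 (min t2 s3)" for a b using E(1) that by (simp add: add.commute)
    show "Rc \<alpha> (Y u (l + int i) v) j w = 0" if "j < min t1 (min t2 s3)" for i j
      using K(2)[of i j] K0(2)[of i j] that by (cases "i < m") auto
  qed (use K0 in auto)
  thus ?thesis by (simp add: F_def E_def)
qed

section \<open>The module axioms in terms of modes\<close>

abbreviation "R \<equiv> YR sc Y om sw YW z"

lemma R_trunc:
  assumes "\<alpha> \<in> Dz"
  shows "\<exists>N. \<forall>n\<ge>N. R v n \<alpha> = 0"
proof -
  obtain s where "\<And>b w. b < s \<Longrightarrow> Rc \<alpha> v b w = 0" using Rc_bounds[OF assms, of v] by blast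
  hence "R v n \<alpha> = 0" if "n \<ge> - s" for n using that by (auto simp: YR_eq zero_fun_def)
  thus ?thesis by blast
qed

lemma R_shift_trunc:
  assumes "\<alpha> \<in> Dz"
  shows "\<exists>N. \<forall>i\<ge>N. R v (n + int i) \<alpha> = 0"
proof -
  obtain N where "\<And>j. j \<ge> N \<Longrightarrow> R v j \<alpha> = 0" using R_trunc[OF assms] by blast
  thus ?thesis by (intro exI[of _ "nat (N - n)"]) auto
qed

lemma R_zero_functional: "R v n 0 = 0"
  by (simp add: YR_eq zero_fun_def fun_eq_iff)

lemma R_jacobi: "jacobi_identity Y dual_scale R Dz"
  unfolding jacobi_identity_def
proof (intro allI ballI)
  fix u v \<alpha> l p q assume \<alpha>: "\<alpha> \<in> Dz"
  obtain N1 where N1: "\<And>i. i \<ge> N1 \<Longrightarrow> R v (q + int i) \<alpha> = 0" using R_shift_trunc[OF \<alpha>] by blast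
  obtain N2 where N2: "\<And>i. i \<ge> N2 \<Longrightarrow> R u (p + int i) \<alpha> = 0" using R_shift_trunc[OF \<alpha>] by blast
  obtain N3 where N3: "\<And>i. i \<ge> N3 \<Longrightarrow> Y u (l + int i) v = 0" using Y_shift_trunc by blast
  have R0: "R 0 n \<alpha> = 0" for n by (simp add: YR_eq zero_fun_def fun_eq_iff Rc_zero_vector \<alpha>)
  have ds: "dual_scale c 0 = 0" for c :: complex by (simp add: dual_scale_def zero_fun_def)
  \<comment> \<open>Mode \<open>n\<close> is the coefficient of \<open>x powi (- n - 1)\<close>. The
    relation \<open>p = - a - 1\<close> also produces the upper index in
    \<open>iterate_side\<close>.\<close>
  define a where "a = - p - 1"
  define b where "b = - q - 1"
  show "fsum (\<lambda>i::nat. dual_scale ((-1) ^ i * (of_int l gchoose i)) (R u (l + p - int i) (R v (q + int i) \<alpha>)))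
     - fsum (\<lambda>i::nat. dual_scale ((-1) powi (l + int i) * (of_int l gchoose i)) (R v (l + q - int i) (R u (p + int i) \<alpha>)))
     = fsum (\<lambda>i::nat. dual_scale ((-1) ^ i * (of_int (int i - p - 1) gchoose i)) (R (Y u (l + int i) v) (p + q - int i) \<alpha>))"
    (is "?A - ?B = ?C")
  proof
    fix w
    have "?A w = fsum (\<lambda>i::nat. dual_scale ((-1) ^ i * (of_int l gchoose i)) (R u (l + p - int i) (R v (q + int i) \<alpha>)) w)"
      by (rule fsum_fun_apply[of N1]) (simp add: N1 R_zero_functional ds)
    also have "\<dots> = binom_mult l (\<lambda>a b. Rc (Rc \<alpha> v b) u a w) a b"
    proof -
      have "- (l + p - int i) - 1 = a - l + int i" "- (q + int i) - 1 = b - int i" for i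
        by (auto simp: a_def b_def)
      thus ?thesis by (simp only: binom_mult_def dual_scale_def YR_eq)
    qed
    finally have A: "?A w = \<dots>" .
    have "?B w = fsum (\<lambda>i::nat. dual_scale ((-1) powi (l + int i) * (of_int l gchoose i)) (R v (l + q - int i) (R u (p + int i) \<alpha>)) w)"
      by (rule fsum_fun_apply[of N2]) (simp add: N2 R_zero_functional ds)
    also have "\<dots> = (-1) powi l * binom_mult l (\<lambda>b a. Rc (Rc \<alpha> u a) v b w) b a"
    proof -
      have "- (l + q - int i) - 1 = b - l + int i" "- (p + int i) - 1 = a - int i" for i
        by (auto simp: a_def b_def)
      moreover have "((-1) powi (l + int i) :: complex) = (-1) powi l * (-1) ^ i" for i
        by (simp add: power_int_add)
      ultimately show ?thesis
        by (simp only: binom_mult_def dual_scale_def YR_eq fsum_cmult[symmetric] mult.assoc)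
    qed
    finally have B: "?B w = \<dots>" .
    have "?C w = fsum (\<lambda>i::nat. dual_scale ((-1) ^ i * (of_int (int i - p - 1) gchoose i)) (R (Y u (l + int i) v) (p + q - int i) \<alpha>) w)"
      by (rule fsum_fun_apply[of N3]) (simp add: N3 R0 ds)
    also have "\<dots> = iterate_side (\<lambda>i j. Rc \<alpha> (Y u (l + int i) v) j w) a b"
    proof -
      have "- (p + q - int i) - 1 = a + b + 1 + int i" for i by (auto simp: a_def b_def)
      moreover have "(-1) ^ i * (of_int (int i - p - 1) gchoose i) = (of_int (- a - 1) gchoose i :: complex)" for i
        by (subst (2) gbinomial_negated_upper) (simp add: a_def)
      ultimately show ?thesis by (simp only: iterate_side_def dual_scale_def YR_eq)
    qed
    finally have C: "?C w = \<dots>" .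
    show "(?A - ?B) w = ?C w"
      using Rc_jacobi[OF \<alpha>, of l v u w a b] A B C by (simp add: fun_diff_def)
  qed
qed

lemma dual_scale_module: "module (dual_scale :: complex \<Rightarrow> ('w \<Rightarrow> complex) \<Rightarrow> 'w \<Rightarrow> complex)"
  by unfold_locales (auto simp: dual_scale_def fun_eq_iff algebra_simps)

lemma dual_lincomb:
  "dual_scale a \<alpha> + dual_scale b \<beta> = (\<lambda>w. a * \<alpha> w + b * \<beta> w)" for \<alpha> \<beta> :: "'w \<Rightarrow> complex"
  by (simp add: dual_scale_def fun_eq_iff)

lemma DPz_subspace: "module.subspace dual_scale Dz"
proof -
  have "0 \<in> Dz" using zero_DPz by (simp add: zero_fun_def)
  moreover have "\<alpha> + \<beta> \<in> Dz" if "\<alpha> \<in> Dz" "\<beta> \<in> Dz" for \<alpha> \<beta>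
    using DPz_lincomb[OF that, of 1 1] by (simp add: plus_fun_def)
  moreover have "dual_scale c \<alpha> \<in> Dz" if "\<alpha> \<in> Dz" for c \<alpha>
    using DPz_lincomb[OF that that, of c 0] by (simp add: dual_scale_def)
  ultimately show ?thesis unfolding module.subspace_def[OF dual_scale_module] by blast
qed

lemma DPz_weak_module: "weak_module sc Y vac Dz dual_scale R"
  unfolding weak_module_def
proof (intro conjI allI ballI)
  show "module (dual_scale :: complex \<Rightarrow> ('w \<Rightarrow> complex) \<Rightarrow> 'w \<Rightarrow> complex)" by (rule dual_scale_module)
  show "module.subspace dual_scale Dz" by (rule DPz_subspace)
  show "jacobi_identity Y dual_scale R Dz" by (rule R_jacobi)
next
  fix v n \<alpha> assume "\<alpha> \<in> Dz"
  thus "R v n \<alpha> \<in> Dz" unfolding YR_eq by (rule Rc_DPz)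
next
  fix a b u u' n \<alpha> assume "\<alpha> \<in> Dz"
  thus "R (sc a u + sc b u') n \<alpha> = dual_scale a (R u n \<alpha>) + dual_scale b (R u' n \<alpha>)"
    by (simp add: dual_lincomb YR_eq Rc_lincomb_vector fun_eq_iff)
next
  fix a b v n \<alpha> \<beta> assume "\<alpha> \<in> Dz" "\<beta> \<in> Dz"
  thus "R v n (dual_scale a \<alpha> + dual_scale b \<beta>) = dual_scale a (R v n \<alpha>) + dual_scale b (R v n \<beta>)"
    by (simp add: dual_lincomb YR_eq Rc_lincomb_functional fun_eq_iff)
next
  fix v \<alpha> assume "\<alpha> \<in> Dz"
  thus "\<exists>N. \<forall>n\<ge>N. R v n \<alpha> = 0" by (rule R_trunc)
next
  fix n \<alpha> assume "\<alpha> \<in> Dz"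
  thus "R vac n \<alpha> = (if n = - 1 then \<alpha> else 0)"
    by (auto simp: YR_eq Rc_vac fun_eq_iff)
qed

end

theorem theorem3p17:
  fixes sc :: "complex \<Rightarrow> 'v::ab_group_add \<Rightarrow> 'v"
    and Y :: "'v \<Rightarrow> int \<Rightarrow> 'v \<Rightarrow> 'v"
    and vac om :: 'v
    and sw :: "complex \<Rightarrow> 'w::ab_group_add \<Rightarrow> 'w"
    and YW :: "'v \<Rightarrow> int \<Rightarrow> 'w \<Rightarrow> 'w"
    and z :: complex
  assumes "is_VOA sc Y vac om"
    and "weak_module sc Y vac UNIV sw YW"
    and "z \<noteq> 0"
  shows "weak_module sc Y vac (DPz sc Y om sw YW z) dual_scale (YR sc Y om sw YW z)"
proof -
  interpret voa sc Y vac om by unfold_locales (rule assms(1))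
  interpret voa_mod_dual sc Y vac om sw YW z
    by unfold_locales (use assms V.module_sc in auto)
  show ?thesis by (rule DPz_weak_module)
qed

end
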